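(* Suppose $\mathbb{P}(B>x)=L(x)x^{-\alpha}$ for some $\alpha>2$, $\alpha\neq 3$, and $L$ slowly varying. Let $\mu=\mathbb{E}[B^2]/(2\mathbb{E}[B])$ and, for any $k>1$, define $x_\rho:=k\,\mu\,(\alpha-1)\frac{1}{1-\rho}\log\frac{1}{1-\rho}$. Then for any fixed $T\in(0,\infty)$ and $\Delta=[0,T)$, the relation $$\sup_{x\geq x_\rho}\left|\frac{\mathbb{P}(M_\infty\in x+\Delta)}{\frac{\rho}{1-\rho}\mathbb{P}(B^*\in x+\Delta)}-1\right|\rightarrow 0\qquad(\rho\uparrow 1)$$ holds. Furthermore, this relation remains valid for $k=1$ provided that $L(x)/(\log x)^\alpha\rightarrow\infty$ as $x\to\infty$.
   Context: Let $B,B_0,B_1,B_2,\ldots$ be i.i.d. non-negative random variables with $\mathbb{P}(B\le 0)=0$, mean $\mathbb{E}[B]>0$ and finite variance. A function $L$ is slowly varying if $\lim_{x\to\infty}L(ax)/L(x)=1$ for all $a>0$. Let $N^1(t)$, $t\ge 0$, be a Poisson process with rate $1/\mathbb{E}[B]$, independent of the $B_i$; for $\rho\in(0,1)$ let $N^\rho(t):=N^1(\rho t)$, a Poisson process with rate $\lambda=\lambda^\rho=\rho/\mathbb{E}[B]$. Define $X(t)=X^\rho(t):=X_0+\sum_{i=1}^{N^\rho(t)}B_i-t$ for $t\ge 0$, with $X_0:=B_0$. The all-time supremum is $M_\infty=M_\infty^\rho:=\sup\{X^\rho(t):t\ge 0\}$. $B^*$ denotes a random variable having the excess distribution of $B$,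 i.e. with density $\frac{1}{\mathbb{E}[B]}\mathbb{P}(B>x)$, $x\geq 0$; its mean is $\mu=\mathbb{E}[B^2]/(2\mathbb{E}[B])$. For $\Delta=[0,T)$ we write $x+\Delta=[x,x+T)$. The distribution of $B$ does not depend on $\rho$. *)

theory Defs
  imports "HOL-Probability.Probability"
begin

text \<open>No measurability or positivity is required; in the theorem both are consequences of the
  tail equation on the positive half-line.\<close>

definition slowly_varying :: "(real \<Rightarrow> real) \<Rightarrow> bool" where
  "slowly_varying L \<longleftrightarrow> (\<forall>a>0. ((\<lambda>x. L (a * x) / L x) \<longlongrightarrow> 1) at_top)"

text \<open>Only the times \<open>t \<ge> 0\<close> are relevant. The path properties (start in \<open>0\<close>, monotone,
  right-continuous in the discrete topology of \<open>nat\<close>) are required for every outcome, as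
  for a counting process; they make suprema over uncountably many times measurable.
  Monotonicity also ensures that the truncated subtraction in the increments is exact.\<close>

definition poisson_process :: "'a measure \<Rightarrow> real \<Rightarrow> (real \<Rightarrow> 'a \<Rightarrow> nat) \<Rightarrow> bool" where
  "poisson_process M r N \<longleftrightarrow>
     0 < r \<and>
     (\<forall>t\<ge>0. N t \<in> measurable M (count_space UNIV)) \<and>
     (\<forall>\<omega>\<in>space M. N 0 \<omega> = 0 \<and> mono_on {0..} (\<lambda>t. N t \<omega>) \<and>
        (\<forall>t\<ge>0. continuous (at_right t) (\<lambda>u. N u \<omega>))) \<and>
     (\<forall>(n::nat) (\<tau>::nat \<Rightarrow> real). 0 \<le> \<tau> 0 \<and> (\<forall>i<n. \<tau> i \<le> \<tau> (Suc i)) \<longrightarrow>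
        prob_space.indep_vars M (\<lambda>_. count_space UNIV)
          (\<lambda>i \<omega>. N (\<tau> (Suc i)) \<omega> - N (\<tau> i) \<omega>) {..<n}) \<and>
     (\<forall>s t. 0 \<le> s \<and> s < t \<longrightarrow>
        distr M (count_space UNIV) (\<lambda>\<omega>. N t \<omega> - N s \<omega>) = measure_pmf (poisson_pmf (r * (t - s))))"

definition excess_distribution :: "'a measure \<Rightarrow> ('a \<Rightarrow> real) \<Rightarrow> real measure" where
  "excess_distribution M B = density lborel
     (\<lambda>x. ennreal (indicator {0..} x * (measure M {\<omega> \<in> space M. B \<omega> > x} / integral\<^sup>L M B)))"

text \<open>Here \<open>N\<close> is the Poisson process \<open>N\<^sup>1\<close>, so that \<open>N (\<rho> * t)\<close> is \<open>N\<^sup>\<rho>(t)\<close>.\<close>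

definition net_input ::
  "(nat \<Rightarrow> 'a \<Rightarrow> real) \<Rightarrow> (real \<Rightarrow> 'a \<Rightarrow> nat) \<Rightarrow> real \<Rightarrow> real \<Rightarrow> 'a \<Rightarrow> real" where
  "net_input Bs N \<rho> t \<omega> = Bs 0 \<omega> + (\<Sum>i=1..N (\<rho> * t) \<omega>. Bs i \<omega>) - t"

text \<open>Extended-real valued: the supremum is finite only almost surely.\<close>

definition all_time_sup ::
  "(nat \<Rightarrow> 'a \<Rightarrow> real) \<Rightarrow> (real \<Rightarrow> 'a \<Rightarrow> nat) \<Rightarrow> real \<Rightarrow> 'a \<Rightarrow> ereal" where
  "all_time_sup Bs N \<rho> \<omega> = (SUP t\<in>{0..}. ereal (net_input Bs N \<rho> t \<omega>))"

definition x_threshold :: "real \<Rightarrow> real \<Rightarrow> real \<Rightarrow> real \<Rightarrow> real" where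
  "x_threshold k \<mu> \<alpha> \<rho> = k * \<mu> * (\<alpha> - 1) * (1 / (1 - \<rho>)) * ln (1 / (1 - \<rho>))"

definition local_rel_error ::
  "'a measure \<Rightarrow> ('a \<Rightarrow> real) \<Rightarrow> (nat \<Rightarrow> 'a \<Rightarrow> real) \<Rightarrow> (real \<Rightarrow> 'a \<Rightarrow> nat) \<Rightarrow>
    real \<Rightarrow> real \<Rightarrow> real \<Rightarrow> real" where
  "local_rel_error M B Bs N T \<rho> x =
     \<bar>measure M {\<omega> \<in> space M. all_time_sup Bs N \<rho> \<omega> \<in> {ereal x..<ereal (x + T)}} /
        (\<rho> / (1 - \<rho>) * measure (excess_distribution M B) {x..<x + T}) - 1\<bar>"

end

theory Submission
  imports Defs
begin

text \<open>
  Write \<open>\<epsilon> = 1 - \<rho>\<close>, let \<open>W\<close> be the supremum of the net input without the initial claim, so that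
  \<open>M\<^sub>\<infinity> = B\<^sub>0 + W\<close>, and let \<open>g\<close> be the density of the excess distribution. The law of \<open>W\<close> has an atom
  \<open>\<epsilon>\<close> at \<open>0\<close> and a density \<open>f\<close> with \<open>f = \<rho> \<epsilon> g + \<rho> g \<diamondop> f\<close>, where \<open>\<diamondop>\<close> is convolution; and
  \<open>P(M\<^sub>\<infinity> \<le> x) = P(W \<le> x) - f(x) / \<lambda>\<close>. Hence, if \<open>f(x)\<close> is close to \<open>g(x) / \<epsilon>\<close> in relative terms,
  uniformly for \<open>x\<close> above the threshold, then \<open>P(W \<in> x + \<Delta>)\<close> is close to
  \<open>\<epsilon>\<^sup>-\<^sup>1 P(B\<^sup>* \<in> x + \<Delta>)\<close>, while the remaining term \<open>(f(x) - f(x + T)) / \<lambda>\<close> is of smaller order because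
  \<open>g\<close> is nearly constant on bounded intervals far out. This passage is lemma \<open>local_estimate\<close>.

  The estimate of \<open>f\<close> (lemma \<open>density_asymptotics\<close>) is analytic and uses only the renewal equation.
  Multiplying that equation by \<open>x\<close> and applying the product rule for convolutions gives the
  size-bias identity
  \<open>\<epsilon> x f(x) = \<rho> E[(x - S) g(x - S)]\<close>, in which \<open>S\<close> is the sum of two independent copies of \<open>W\<close> and \<open>g\<close>
  vanishes on negative arguments (lemma \<open>size_bias\<close>). On the event \<open>S \<le> \<beta> x\<close>, which has
  probability close to \<open>1\<close> because \<open>S\<close> lives on the scale \<open>1 / \<epsilon>\<close>, much smaller than \<open>x\<close>, the right-hand side
  is close to \<open>x g(x)\<close> by regular variation. The event \<open>S > \<beta> x\<close> is controlled by the crude bound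
  \<open>f(x) \<le> A \<epsilon> exp(- c \<epsilon> x / \<mu>) + (D / \<epsilon>) \<psi>(x + K / \<epsilon>)\<close>, for any \<open>c < 1\<close>, where \<open>\<psi>\<close> is a
  function comparable to \<open>g\<close> (lemma \<open>crude_bound\<close>). Its first summand is the heavy-traffic regime and
  the second the one-big-jump regime. At \<open>x = \<kappa> \<epsilon>\<^sup>-\<^sup>1 log \<epsilon>\<^sup>-\<^sup>1\<close> the first summand is \<open>\<epsilon>\<close> to the power
  \<open>1 + c \<kappa> / \<mu>\<close>, whereas \<open>g(x) / \<epsilon>\<close> is \<open>\<epsilon>\<close> to the power \<open>\<alpha> - 1\<close> up to a slowly varying factor, so a big jump
  dominates as soon as \<open>\<kappa> > \<mu> (\<alpha> - 2)\<close>. The threshold of the theorem has \<open>\<kappa> \<ge> \<mu> (\<alpha> - 1)\<close>.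
  The crude bound is proved by comparison: convolution with \<open>\<rho> g\<close> is a contraction for the
  supremum norm, so any supersolution of the renewal equation dominates \<open>f\<close>, provided it does so on
  \<open>[0, \<mu> / (c \<epsilon>)]\<close>; there \<open>f = O(\<epsilon>)\<close> suffices, and this follows from renewal theory (lemma \<open>renewal_bound\<close>).

  The renewal equation for \<open>f\<close> is obtained without identifying the interarrival times of the Poisson process.
  Observed on a grid of mesh \<open>h\<close>, the net input is a random walk, and conditioning on the number of
  claims in the first cell gives
  \<open>P(W\<^sub>h \<le> x) = exp(-\<lambda>h) (P(W\<^sub>h \<le> x + h) + \<lambda>h P(B\<^sub>0 + W\<^sub>h \<le> x + h)) + O(h\<^sup>2)\<close>. Telescoping along the grid and
  letting \<open>h\<close> tend to \<open>0\<close> gives the level-crossing identity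
  \<open>P(W \<le> c) - P(W = 0) = \<lambda> \<integral>\<^sub>0\<^sup>c (P(W \<le> y) - P(M\<^sub>\<infinity> \<le> y)) dy\<close> (lemma \<open>level_crossing\<close>), from which
  \<open>f(y) = \<lambda> (P(W \<le> y) - P(M\<^sub>\<infinity> \<le> y))\<close>. The atom is at most \<open>\<epsilon>\<close> because the total mass is at most \<open>1\<close>;
  it is at least \<open>\<epsilon>\<close> because the mean of the running maximum of the walk cannot decrease
  (lemma \<open>drift\<close>). Together they give \<open>P(W = 0) = \<epsilon>\<close> and \<open>W < \<infinity>\<close> almost surely.
\<close>

section \<open>Convolution and elementary estimates\<close>

definition conv :: "(real \<Rightarrow> ennreal) \<Rightarrow> (real \<Rightarrow> ennreal) \<Rightarrow> real \<Rightarrow> ennreal" (infixl "\<diamondop>" 75) where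
  "(p \<diamondop> q) x = (\<integral>\<^sup>+y. p (x - y) * q y \<partial>lborel)"

lemma conv_measurable [measurable]:
  assumes [measurable]: "p \<in> borel_measurable borel" "q \<in> borel_measurable borel"
  shows "(p \<diamondop> q) \<in> borel_measurable borel"
  unfolding conv_def by measurable

lemma nn_integral_reflect:
  fixes p :: "real \<Rightarrow> ennreal"
  assumes [measurable]: "p \<in> borel_measurable borel"
  shows "(\<integral>\<^sup>+y. p (x - y) \<partial>lborel) = (\<integral>\<^sup>+y. p y \<partial>lborel)"
  using nn_integral_real_affine[of p "-1" x] by simp

lemma nn_integral_shift:
  fixes p :: "real \<Rightarrow> ennreal"
  assumes [measurable]: "p \<in> borel_measurable borel"
  shows "(\<integral>\<^sup>+y. p (x + y) \<partial>lborel) = (\<integral>\<^sup>+y. p y \<partial>lborel)"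
  using nn_integral_real_affine[of p 1 x] by simp

lemma conv_commute:
  assumes [measurable]: "p \<in> borel_measurable borel" "q \<in> borel_measurable borel"
  shows "p \<diamondop> q = q \<diamondop> p"
proof
  fix x
  have "(\<integral>\<^sup>+y. p (x - y) * q y \<partial>lborel) = (\<integral>\<^sup>+y. (\<lambda>y. p y * q (x - y)) (x - y) \<partial>lborel)" by simp
  also have "\<dots> = (\<integral>\<^sup>+y. p y * q (x - y) \<partial>lborel)" by (rule nn_integral_reflect) measurable
  finally show "(p \<diamondop> q) x = (q \<diamondop> p) x" by (simp add: conv_def mult.commute)
qed

lemma conv_assoc:
  assumes [measurable]: "p \<in> borel_measurable borel" "q \<in> borel_measurable borel" "r \<in> borel_measurable borel"
  shows "(p \<diamondop> q) \<diamondop> r = p \<diamondop> (q \<diamondop> r)"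
proof
  fix x
  have "((p \<diamondop> q) \<diamondop> r) x = (\<integral>\<^sup>+y. (\<integral>\<^sup>+z. p (x - y - z) * q z * r y \<partial>lborel) \<partial>lborel)"
    by (simp add: conv_def nn_integral_multc)
  also have "\<dots> = (\<integral>\<^sup>+y. (\<integral>\<^sup>+z. p (x - z) * q (z - y) * r y \<partial>lborel) \<partial>lborel)"
  proof (rule nn_integral_cong)
    fix y
    have "(\<integral>\<^sup>+z. p (x - y - z) * q z * r y \<partial>lborel)
        = (\<integral>\<^sup>+z. (\<lambda>z. p (x - z) * q (z - y) * r y) (y + z) \<partial>lborel)"
      by (simp add: algebra_simps)
    also have "\<dots> = (\<integral>\<^sup>+z. p (x - z) * q (z - y) * r y \<partial>lborel)"
      by (rule nn_integral_shift) measurable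
    finally show "(\<integral>\<^sup>+z. p (x - y - z) * q z * r y \<partial>lborel) = \<dots>" .
  qed
  also have "\<dots> = (\<integral>\<^sup>+z. (\<integral>\<^sup>+y. p (x - z) * q (z - y) * r y \<partial>lborel) \<partial>lborel)"
    by (rule lborel_pair.Fubini') measurable
  also have "\<dots> = (p \<diamondop> (q \<diamondop> r)) x"
    by (simp add: conv_def nn_integral_cmult mult.assoc)
  finally show "((p \<diamondop> q) \<diamondop> r) x = (p \<diamondop> (q \<diamondop> r)) x" .
qed

lemma conv_add_right:
  assumes [measurable]: "p \<in> borel_measurable borel" "q \<in> borel_measurable borel" "r \<in> borel_measurable borel"
  shows "p \<diamondop> (\<lambda>y. q y + r y) = (\<lambda>x. (p \<diamondop> q) x + (p \<diamondop> r) x)"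
  by (simp add: conv_def fun_eq_iff distrib_left nn_integral_add)

lemma conv_cmult_right:
  assumes [measurable]: "p \<in> borel_measurable borel" "q \<in> borel_measurable borel"
  shows "p \<diamondop> (\<lambda>y. c * q y) = (\<lambda>x. c * (p \<diamondop> q) x)"
  by (simp add: conv_def fun_eq_iff nn_integral_cmult mult.left_commute[of _ c])

lemma conv_mono_on:
  assumes "\<And>y. q y \<le> r y"
  shows "(p \<diamondop> q) x \<le> (p \<diamondop> r) x"
  unfolding conv_def by (intro nn_integral_mono mult_left_mono assms) auto

lemma nn_integral_conv:
  assumes [measurable]: "p \<in> borel_measurable borel" "q \<in> borel_measurable borel"
  shows "(\<integral>\<^sup>+x. (p \<diamondop> q) x \<partial>lborel) = (\<integral>\<^sup>+x. p x \<partial>lborel) * (\<integral>\<^sup>+x. q x \<partial>lborel)"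
proof -
  have "(\<integral>\<^sup>+x. (p \<diamondop> q) x \<partial>lborel) = (\<integral>\<^sup>+y. (\<integral>\<^sup>+x. p (x - y) * q y \<partial>lborel) \<partial>lborel)"
    unfolding conv_def by (rule lborel_pair.Fubini'[symmetric]) measurable
  also have "\<dots> = (\<integral>\<^sup>+y. (\<integral>\<^sup>+x. p x \<partial>lborel) * q y \<partial>lborel)"
  proof (rule nn_integral_cong)
    fix y
    show "(\<integral>\<^sup>+x. p (x - y) * q y \<partial>lborel) = (\<integral>\<^sup>+x. p x \<partial>lborel) * q y"
      using nn_integral_shift[of p "-y"] by (simp add: nn_integral_multc add.commute)
  qed
  also have "\<dots> = (\<integral>\<^sup>+x. p x \<partial>lborel) * (\<integral>\<^sup>+x. q x \<partial>lborel)"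
    by (simp add: nn_integral_cmult)
  finally show ?thesis .
qed

lemma nn_integral_exp_ray:
  fixes a :: real assumes "a > 0"
  shows "(\<integral>\<^sup>+y. ennreal (exp (- a * (x - y))) * indicator {..x} y \<partial>lborel) = ennreal (1 / a)"
proof -
  have "(\<integral>\<^sup>+y. ennreal (exp (- a * (x - y))) * indicator {..x} y \<partial>lborel)
      = (\<integral>\<^sup>+y. (\<lambda>y. ennreal (exp (- a * y)) * indicator {0..} y) (x - y) \<partial>lborel)"
    by (intro nn_integral_cong) (auto simp: indicator_def)
  also have "\<dots> = (\<integral>\<^sup>+y. ennreal (exp (- a * y)) * indicator {0..} y \<partial>lborel)"
    by (rule nn_integral_reflect) measurable
  also have "\<dots> = ennreal (0 - (- exp (- a * 0) / a))"
  proof (rule nn_integral_FTC_atLeast)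
    show "((\<lambda>y. - exp (- a * y) / a) has_real_derivative exp (- a * y)) (at y)" for y
      using assms by (auto intro!: derivative_eq_intros)
    have "((\<lambda>y. - exp (- (a * y)) / a) \<longlongrightarrow> - 0 / a) at_top"
      using assms
      by (intro tendsto_intros filterlim_compose[OF exp_at_bot]
           filterlim_uminus_at_bot_at_top filterlim_tendsto_pos_mult_at_top[OF tendsto_const] filterlim_ident)
        (auto intro!: filterlim_compose[OF filterlim_uminus_at_bot_at_top] filterlim_tendsto_pos_mult_at_top[OF tendsto_const] filterlim_ident)
    then show "((\<lambda>y. - exp (- a * y) / a) \<longlongrightarrow> 0) at_top" by simp
  qed auto
  finally show ?thesis by simp
qed

lemma nn_integral_exp_tail:
  fixes a b :: real assumes "a > 0"
  shows "(\<integral>\<^sup>+y. ennreal (exp (- a * y)) * indicator {b<..} y \<partial>lborel) \<le> ennreal (exp (- a * b) / a)"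
proof -
  have "(\<integral>\<^sup>+y. ennreal (exp (- a * y)) * indicator {b<..} y \<partial>lborel)
    = (\<integral>\<^sup>+y. (\<lambda>y. ennreal (exp (- a * y)) * indicator {b<..} y) (0 - y) \<partial>lborel)"
    by (rule nn_integral_reflect[symmetric]) measurable
  also have "\<dots> \<le> (\<integral>\<^sup>+y. ennreal (exp (- a * b)) * (ennreal (exp (- a * (- b - y))) * indicator {..- b} y) \<partial>lborel)"
    by (intro nn_integral_mono)
       (auto simp: indicator_def ennreal_mult[symmetric] exp_add[symmetric] algebra_simps)
  also have "\<dots> = ennreal (exp (- a * b)) * ennreal (1 / a)"
    by (subst nn_integral_cmult, measurable, subst nn_integral_exp_ray) (use assms in auto)
  also have "\<dots> = ennreal (exp (- a * b) / a)" using assms by (simp add: ennreal_mult[symmetric])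
  finally show ?thesis .
qed

lemma exp_minus_mult_le: "exp (- u) * u \<le> (1::real)"
proof -
  have "u \<le> exp u" using exp_ge_add_one_self[of u] by linarith
  then show ?thesis by (simp add: exp_minus field_simps)
qed

text \<open>Polynomial growth is paid for by half of an exponential; this lets regularly varying
  factors be absorbed into exponential weights.\<close>

lemma pow_le_exp:
  fixes t :: real assumes "0 \<le> t" "0 < p"
  shows "(1 + t) ^ p \<le> (2 * real p) ^ p * exp (t / 2)"
proof -
  have "1 + t \<le> 2 * real p * (1 + t / (2 * real p))" using assms by (simp add: field_simps)
  also have "\<dots> \<le> 2 * real p * exp (t / (2 * real p))" using assms by (intro mult_left_mono exp_ge_add_one_self) auto
  finally have "(1 + t) ^ p \<le> (2 * real p * exp (t / (2 * real p))) ^ p" using assms by (intro power_mono) auto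
  also have "\<dots> = (2 * real p) ^ p * exp (real p * (t / (2 * real p)))"
    by (subst power_mult_distrib) (simp only: exp_of_nat_mult)
  also have "real p * (t / (2 * real p)) = t / 2" using assms by simp
  finally show ?thesis .
qed

lemma one_plus_pow_le:
  fixes t :: real assumes "0 \<le> t" "t \<le> 1"
  shows "(1 + t) ^ p \<le> 1 + (2 ^ p - 1) * t"
proof (induction p)
  case (Suc p)
  have "(1 + t) ^ Suc p \<le> (1 + t) * (1 + (2 ^ p - 1) * t)" using Suc assms by (simp add: mult_left_mono)
  also have "\<dots> = 1 + t + (2 ^ p - 1) * t + (2 ^ p - 1) * t * t" by (simp add: algebra_simps)
  also have "(2 ^ p - 1) * t * t \<le> (2 ^ p - 1) * t * 1"
    using assms by (intro mult_left_mono mult_nonneg_nonneg) auto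
  finally show ?case by (simp add: algebra_simps)
qed simp

section \<open>Regularly varying excess densities\<close>

text \<open>The excess density: nonincreasing, of mean \<open>\<mu>\<close> and regularly varying of index \<open>-\<alpha>\<close>.\<close>

locale rv_density =
  fixes g :: "real \<Rightarrow> real" and \<alpha> \<mu> :: real
  assumes g_neg: "x < 0 \<Longrightarrow> g x = 0"
    and g_nonneg [simp]: "0 \<le> g x"
    and g_anti: "0 \<le> x \<Longrightarrow> x \<le> y \<Longrightarrow> g y \<le> g x"
    and g_meas [measurable]: "g \<in> borel_measurable borel"
    and g_mass: "(\<integral>\<^sup>+x. ennreal (g x) \<partial>lborel) = 1"
    and g_mean: "(\<integral>\<^sup>+x. ennreal (x * g x) \<partial>lborel) = ennreal \<mu>"
    and g_rv: "a > 0 \<Longrightarrow> ((\<lambda>x. g (a * x) / g x) \<longlongrightarrow> a powr (- \<alpha>)) at_top"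
    and alpha_gt: "\<alpha> > 2" and mu_pos: "\<mu> > 0"
begin

lemma g_pos: "0 \<le> x \<Longrightarrow> 0 < g x"
proof -
  assume x: "0 \<le> x"
  have "((\<lambda>x. g (2 * x) / g x) \<longlongrightarrow> 2 powr (- \<alpha>)) at_top" by (rule g_rv) simp
  then have "eventually (\<lambda>x. g (2 * x) / g x > 0) at_top" by (rule order_tendstoD) simp
  then obtain y where "y \<ge> x" "g (2 * y) / g y > 0"
    unfolding eventually_at_top_linorder by (metis nle_le)
  then have "g y > 0" using g_nonneg[of y] by (cases "g y = 0") (auto simp: less_le)
  with g_anti[OF x \<open>y \<ge> x\<close>] show ?thesis by simp
qed

text \<open>Potter's bound. Regular variation controls the ratio over one doubling of the argument; iterating
  it over the dyadic points between \<open>y\<close> and \<open>x\<close> and using monotonicity in between gives all ratios.\<close>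

lemma potter:
  assumes q: "q > \<alpha>"
  shows "\<exists>x0>0. \<forall>y\<ge>x0. \<forall>x\<ge>y. g y \<le> 2 powr q * (x / y) powr q * g x"
proof -
  have "((\<lambda>x. g (2 * x) / g x) \<longlongrightarrow> 2 powr (- \<alpha>)) at_top" by (rule g_rv) simp
  then have "eventually (\<lambda>x. g (2 * x) / g x > 2 powr (- q)) at_top"
    by (rule order_tendstoD) (use q in simp)
  then obtain x0 where x0: "\<And>x. x \<ge> x0 \<Longrightarrow> g (2 * x) / g x > 2 powr (- q)"
    unfolding eventually_at_top_linorder by auto
  define x1 where "x1 = max 1 x0"
  have x1: "x1 > 0" and dbl: "\<And>x. x \<ge> x1 \<Longrightarrow> g x \<le> 2 powr q * g (2 * x)"
  proof -
    show "x1 > 0" by (simp add: x1_def)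
    fix x assume "x \<ge> x1"
    then have "x \<ge> x0" "x \<ge> 0" by (auto simp: x1_def)
    then show "g x \<le> 2 powr q * g (2 * x)" using x0[of x] g_pos[of x]
      by (simp add: field_simps powr_minus)
  qed
  have iter: "g y \<le> 2 powr (q * n) * g (2 ^ n * y)" if "y \<ge> x1" for y and n :: nat
  proof (induction n)
    case (Suc n)
    have "1 * y \<le> 2 ^ n * y" using that x1 by (intro mult_right_mono) auto
    then have "g (2 ^ n * y) \<le> 2 powr q * g (2 * (2 ^ n * y))" using that by (intro dbl) simp
    then have "2 powr (q * n) * g (2 ^ n * y) \<le> 2 powr (q * n) * (2 powr q * g (2 * (2 ^ n * y)))"
      by (intro mult_left_mono) auto
    also have "\<dots> = 2 powr (q * Suc n) * g (2 ^ Suc n * y)" by (simp add: powr_add algebra_simps)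
    finally show ?case using Suc by simp
  qed (use that x1 in simp)
  show ?thesis
  proof (intro exI[of _ x1] conjI allI impI x1)
    fix y x assume y: "x1 \<le> y" and x: "y \<le> x"
    have yp: "y > 0" using y x1 by simp
    define n where "n = nat \<lfloor>log 2 (x / y)\<rfloor>"
    have l0: "0 \<le> log 2 (x / y)" using x yp by simp
    have n1: "real n \<le> log 2 (x / y)" and n2: "log 2 (x / y) < real n + 1"
      using l0 unfolding n_def by linarith+
    have "2 powr real n \<le> 2 powr log 2 (x / y)" using n1 by simp
    then have a: "2 powr real n \<le> x / y" using x yp by simp
    have "2 powr log 2 (x / y) < 2 powr (real n + 1)" using n2 by simp
    then have b: "x / y < 2 powr (real n + 1)" using x yp by simp
    then have "x \<le> 2 ^ Suc n * y" using yp
      by (simp add: field_simps powr_add powr_realpow)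
    then have gx: "g (2 ^ Suc n * y) \<le> g x" using x yp by (intro g_anti) auto
    have "2 powr (q * Suc n) = 2 powr q * (2 powr real n) powr q"
      by (simp add: powr_powr powr_add[symmetric] algebra_simps)
    also have "\<dots> \<le> 2 powr q * (x / y) powr q"
      using a q alpha_gt by (intro mult_left_mono powr_mono2) auto
    finally have "2 powr (q * Suc n) \<le> 2 powr q * (x / y) powr q" .
    with iter[OF y, of "Suc n"] gx show "g y \<le> 2 powr q * (x / y) powr q * g x"
      by (meson g_nonneg mult_mono order_trans powr_ge_zero mult_nonneg_nonneg)
  qed
qed

text \<open>The claim-size tail may have jumps, so increments of \<open>g\<close> are not controlled at a fixed
  relative precision \<open>O(y / x)\<close>. The envelope below is comparable to \<open>g\<close>, and \<open>x ^ p * env x\<close> is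
  nondecreasing by construction, which makes \<open>env (x - y) / env x \<le> (x / (x - y)) ^ p\<close> for all
  \<open>0 \<le> y < x\<close>. Any integer exponent above \<open>\<alpha>\<close> would do.\<close>

definition p :: nat where "p = nat \<lceil>\<alpha>\<rceil> + 1"

lemma p_gt: "real p > \<alpha>" "p > 0" unfolding p_def using alpha_gt by linarith+

definition psup :: "real \<Rightarrow> real" where "psup x = (SUP w\<in>{0..max 0 x}. w ^ p * g w)"
definition env :: "real \<Rightarrow> real" where "env x = psup x / x ^ p"

lemma psup_bdd: "bdd_above ((\<lambda>w. w ^ p * g w) ` {0..max 0 x})"
  by (rule bdd_aboveI[of _ "(max 0 x) ^ p * g 0"]) (auto intro!: mult_mono power_mono g_anti)

lemma psup_mono: "mono psup"
  unfolding psup_def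
  by (intro monoI cSUP_subset_mono psup_bdd) auto

lemma psup_meas [measurable]: "psup \<in> borel_measurable borel"
  by (rule borel_measurable_mono[OF psup_mono])

lemma env_meas [measurable]: "env \<in> borel_measurable borel"
  unfolding env_def[abs_def] by measurable

lemma psup_ge: "0 \<le> w \<Longrightarrow> w \<le> x \<Longrightarrow> w ^ p * g w \<le> psup x"
  unfolding psup_def by (intro cSUP_upper psup_bdd) auto

lemma psup_nonneg: "0 \<le> psup x"
  using psup_ge[of 0 "max 0 x"] by (simp add: psup_def zero_power[OF p_gt(2)])

lemma env_nonneg [simp]: "0 \<le> x \<Longrightarrow> 0 \<le> env x"
  unfolding env_def using psup_nonneg by (intro divide_nonneg_nonneg) auto

lemma g_le_env: "0 < x \<Longrightarrow> g x \<le> env x"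
  unfolding env_def using psup_ge[of x x] by (simp add: field_simps)

lemma env_scale:
  assumes "0 < w" "w \<le> x" shows "env w \<le> (x / w) ^ p * env x"
proof -
  have "(x / w) ^ p * env x = psup x / w ^ p"
    unfolding env_def using assms by (simp add: power_divide)
  moreover have "psup w / w ^ p \<le> psup x / w ^ p"
    using assms monoD[OF psup_mono, of w x] by (intro divide_right_mono) auto
  ultimately show ?thesis by (simp add: env_def)
qed

text \<open>By Potter's bound \<open>w ^ p * g w\<close> grows essentially monotonically, so its running supremum is
  attained near the right end point up to a constant factor.\<close>

lemma env_le: "\<exists>C\<ge>1. \<exists>x0>0. \<forall>x\<ge>x0. env x \<le> C * g x"
proof -
  obtain x0 where x0: "x0 > 0" "\<And>y x. x0 \<le> y \<Longrightarrow> y \<le> x \<Longrightarrow> g y \<le> 2 powr p * (x / y) powr p * g x"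
    using potter[of p] p_gt by auto
  then have pot: "y ^ p * g y \<le> 2 ^ p * x ^ p * g x" if "x0 \<le> y" "y \<le> x" for x y
    using x0(2)[OF that] that x0(1) by (simp add: powr_realpow power_divide field_simps)
  define C where "C = 2 ^ p * (g 0 / g x0)"
  have g0: "g 0 / g x0 \<ge> 1" using g_anti[of 0 x0] g_pos[of x0] x0(1) by simp
  have C: "C \<ge> 2 ^ p" using g0 unfolding C_def
    by (metis mult.right_neutral mult_left_mono zero_le_numeral zero_le_power)
  have "env x \<le> C * g x" if x: "x \<ge> x0" for x
  proof -
    have "psup x \<le> C * x ^ p * g x"
      unfolding psup_def
    proof (rule cSUP_least)
      fix w assume "w \<in> {0..max 0 x}"
      then have w: "0 \<le> w" "w \<le> x" using x x0 by auto
      show "w ^ p * g w \<le> C * x ^ p * g x"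
      proof (cases "x0 \<le> w")
        case True
        have "w ^ p * g w \<le> 2 ^ p * x ^ p * g x" by (rule pot[OF True w(2)])
        also have "\<dots> \<le> C * x ^ p * g x" using C x x0 by (intro mult_right_mono) auto
        finally show ?thesis .
      next
        case False
        have "w ^ p * g w \<le> x0 ^ p * g 0" using False w by (intro mult_mono power_mono g_anti) auto
        also have "\<dots> = (g 0 / g x0) * (x0 ^ p * g x0)" using g_pos[of x0] x0 by simp
        also have "\<dots> \<le> (g 0 / g x0) * (2 ^ p * x ^ p * g x)"
          using pot[OF order_refl x] g0 by (intro mult_left_mono) auto
        finally show ?thesis by (simp add: C_def mult_ac)
      qed
    qed auto
    then show ?thesis unfolding env_def using x x0(1) by (simp add: field_simps)
  qed
  moreover have "C \<ge> 1" using C by (meson one_le_numeral one_le_power order_trans)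
  ultimately show ?thesis using x0(1) by blast
qed

lemma mean_tail:
  assumes "\<eta> > 0"
  shows "\<exists>z0>0. \<forall>z\<ge>z0. (\<integral>\<^sup>+x. ennreal (x * g x) * indicator {z..} x \<partial>lborel) \<le> ennreal \<eta>"
proof -
  have "(\<lambda>n. \<integral>\<^sup>+x. ennreal (x * g x) * indicator {real n..} x \<partial>lborel) \<longlonglongrightarrow> (\<integral>\<^sup>+x. 0 \<partial>(lborel::real measure))"
  proof (rule nn_integral_dominated_convergence[where w = "\<lambda>x. ennreal (x * g x)"])
    show "(\<integral>\<^sup>+x. ennreal (x * g x) \<partial>lborel) < \<infinity>" by (simp add: g_mean)
    show "AE x in lborel. (\<lambda>n. ennreal (x * g x) * indicator {real n..} x) \<longlonglongrightarrow> 0"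
    proof (rule AE_I2)
      fix x :: real
      obtain m :: nat where m: "x < real m" using reals_Archimedean2 by blast
      have "eventually (\<lambda>n. ennreal (x * g x) * indicator {real n..} x = 0) sequentially"
        using eventually_ge_at_top[of m] by eventually_elim (use m in auto)
      then show "(\<lambda>n. ennreal (x * g x) * indicator {real n..} x) \<longlonglongrightarrow> 0"
        by (rule tendsto_eventually)
    qed
  qed (auto simp: indicator_def)
  then have "eventually (\<lambda>n. (\<integral>\<^sup>+x. ennreal (x * g x) * indicator {real n..} x \<partial>lborel) < ennreal \<eta>) sequentially"
    using assms by (intro order_tendstoD(2)) auto
  then obtain n where n: "n > 0" "(\<integral>\<^sup>+x. ennreal (x * g x) * indicator {real n..} x \<partial>lborel) < ennreal \<eta>"
    unfolding eventually_at_top_linorder by (metis nat_le_linear Suc_n_not_le_n gr0I le_SucI)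
  show ?thesis
  proof (intro exI[of _ "real n"] conjI allI impI)
    fix z assume "real n \<le> z"
    then have "(\<integral>\<^sup>+x. ennreal (x * g x) * indicator {z..} x \<partial>lborel) \<le> (\<integral>\<^sup>+x. ennreal (x * g x) * indicator {real n..} x \<partial>lborel)"
      by (intro nn_integral_mono) (auto simp: indicator_def)
    with n show "(\<integral>\<^sup>+x. ennreal (x * g x) * indicator {z..} x \<partial>lborel) \<le> ennreal \<eta>" by simp
  qed (use n in simp)
qed

lemma ennreal_x_g_mono: "a \<le> b \<Longrightarrow> ennreal (y * g y * a) \<le> ennreal (y * g y * b)"
  using g_neg[of y] by (cases "y < 0") (auto intro!: ennreal_leI mult_left_mono)

text \<open>First-order Taylor expansion of a truncated exponential moment of \<open>g\<close>: the weight
  \<open>min 1 (t * y)\<close> is the relative size of the remainder, and it vanishes in the mean by dominated convergence.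
  The second moment of \<open>g\<close>, on which the usual remainder rests, is infinite when \<open>\<alpha> < 3\<close>.\<close>

lemma mean_near_zero:
  assumes "\<eta> > 0"
  shows "\<exists>t0>0. \<forall>t. 0 < t \<and> t \<le> t0 \<longrightarrow> (\<integral>\<^sup>+y. ennreal (y * g y * min 1 (t * y)) \<partial>lborel) \<le> ennreal \<eta>"
proof -
  have "(\<lambda>n. \<integral>\<^sup>+y. ennreal (y * g y * min 1 (1 / real (Suc n) * y)) \<partial>lborel) \<longlonglongrightarrow> (\<integral>\<^sup>+x. 0 \<partial>(lborel::real measure))"
  proof (rule nn_integral_dominated_convergence[where w = "\<lambda>x. ennreal (x * g x)"])
    show "(\<integral>\<^sup>+x. ennreal (x * g x) \<partial>lborel) < \<infinity>" by (simp add: g_mean)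
    show "AE y in lborel. ennreal (y * g y * min 1 (1 / real (Suc n) * y)) \<le> ennreal (y * g y)" for n
      using ennreal_x_g_mono[of _ 1] by (intro AE_I2) (metis min.cobounded1 mult.right_neutral)
    show "AE y in lborel. (\<lambda>n. ennreal (y * g y * min 1 (1 / real (Suc n) * y))) \<longlonglongrightarrow> 0"
    proof (rule AE_I2)
      fix y :: real
      have "(\<lambda>n. y * g y * min 1 (1 / real (Suc n) * y)) \<longlonglongrightarrow> y * g y * min 1 (0 * y)"
        by (intro tendsto_intros LIMSEQ_Suc[OF lim_1_over_n])
      then show "(\<lambda>n. ennreal (y * g y * min 1 (1 / real (Suc n) * y))) \<longlonglongrightarrow> 0"
        using tendsto_ennrealI by fastforce
    qed
  qed auto
  then have "eventually (\<lambda>n. (\<integral>\<^sup>+y. ennreal (y * g y * min 1 (1 / real (Suc n) * y)) \<partial>lborel) < ennreal \<eta>) sequentially"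
    using assms by (intro order_tendstoD(2)) auto
  then obtain n where n: "(\<integral>\<^sup>+y. ennreal (y * g y * min 1 (1 / real (Suc n) * y)) \<partial>lborel) < ennreal \<eta>"
    unfolding eventually_at_top_linorder by blast
  show ?thesis
  proof (intro exI[of _ "1 / real (Suc n)"] conjI allI impI)
    fix t assume t: "0 < t \<and> t \<le> 1 / real (Suc n)"
    have "(\<integral>\<^sup>+y. ennreal (y * g y * min 1 (t * y)) \<partial>lborel) \<le> (\<integral>\<^sup>+y. ennreal (y * g y * min 1 (1 / real (Suc n) * y)) \<partial>lborel)"
    proof (rule nn_integral_mono)
      fix y
      show "ennreal (y * g y * min 1 (t * y)) \<le> ennreal (y * g y * min 1 (1 / real (Suc n) * y))"
      proof (cases "y < 0")
        case False
        then show ?thesis using t by (intro ennreal_x_g_mono min.mono order_refl mult_right_mono) auto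
      qed (simp add: g_neg)
    qed
    with n show "(\<integral>\<^sup>+y. ennreal (y * g y * min 1 (t * y)) \<partial>lborel) \<le> ennreal \<eta>" by simp
  qed simp
qed

text \<open>Since \<open>g\<close> has a finite mean, its tail integral is \<open>o(1 / z)\<close>.\<close>

lemma env_tail:
  assumes "\<eta> > 0"
  shows "\<exists>z0>0. \<forall>z\<ge>z0. (\<integral>\<^sup>+x. ennreal (env x) * indicator {z..} x \<partial>lborel) \<le> ennreal (\<eta> / z)"
proof -
  obtain C x0 where C: "C \<ge> 1" "x0 > 0" "\<And>x. x \<ge> x0 \<Longrightarrow> env x \<le> C * g x" using env_le by blast
  obtain z0 where z0: "z0 > 0" "\<And>z. z \<ge> z0 \<Longrightarrow> (\<integral>\<^sup>+x. ennreal (x * g x) * indicator {z..} x \<partial>lborel) \<le> ennreal (\<eta> / C)"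
    using mean_tail[of "\<eta> / C"] assms C by auto
  show ?thesis
  proof (intro exI[of _ "max z0 x0"] conjI allI impI)
    fix z assume z: "max z0 x0 \<le> z"
    then have zp: "z > 0" using z0 by simp
    have "(\<integral>\<^sup>+x. ennreal (env x) * indicator {z..} x \<partial>lborel)
      \<le> (\<integral>\<^sup>+x. ennreal (C / z) * (ennreal (x * g x) * indicator {z..} x) \<partial>lborel)"
    proof (rule nn_integral_mono)
      fix x
      show "ennreal (env x) * indicator {z..} x \<le> ennreal (C / z) * (ennreal (x * g x) * indicator {z..} x)"
      proof (cases "x \<ge> z")
        case True
        have "env x \<le> C * g x * 1" using C(3)[of x] True z by simp
        also have "\<dots> \<le> C * g x * (x / z)" using True zp C by (intro mult_left_mono) auto
        finally have "env x \<le> C / z * (x * g x)" by (simp add: mult_ac)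
        then show ?thesis using True zp C by (simp add: ennreal_mult[symmetric] ennreal_leI)
      qed simp
    qed
    also have "\<dots> = ennreal (C / z) * (\<integral>\<^sup>+x. ennreal (x * g x) * indicator {z..} x \<partial>lborel)"
      by (rule nn_integral_cmult) measurable
    also have "\<dots> \<le> ennreal (C / z) * ennreal (\<eta> / C)" using z0(2)[of z] z by (intro mult_left_mono) auto
    also have "\<dots> = ennreal (\<eta> / z)" using C assms zp by (simp add: ennreal_mult[symmetric])
    finally show "(\<integral>\<^sup>+x. ennreal (env x) * indicator {z..} x \<partial>lborel) \<le> ennreal (\<eta> / z)" .
  qed (use z0 in simp)
qed

text \<open>Beyond \<open>1 / \<theta>\<close> a function of polynomial growth varies more slowly than \<open>exp (\<theta> x / 2)\<close>.\<close>

lemma env_growth: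
  assumes "\<theta> > 0" "1 / \<theta> \<le> w" "w \<le> x"
  shows "env w \<le> (2 * real p) ^ p * exp (\<theta> / 2 * (x - w)) * env x"
proof -
  have w: "w > 0" using assms by (meson less_le_trans zero_less_divide_1_iff)
  have "env w \<le> (x / w) ^ p * env x" by (rule env_scale[OF w assms(3)])
  also have "\<dots> \<le> (1 + \<theta> * (x - w)) ^ p * env x"
  proof (intro mult_right_mono power_mono)
    have "(x - w) * 1 \<le> (x - w) * (\<theta> * w)" using assms by (intro mult_left_mono) (auto simp: field_simps)
    then show "x / w \<le> 1 + \<theta> * (x - w)" using w by (simp add: field_simps)
  qed (use w assms in auto)
  also have "\<dots> \<le> ((2 * real p) ^ p * exp (\<theta> * (x - w) / 2)) * env x"
    using p_gt w assms by (intro mult_right_mono pow_le_exp) auto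
  finally show ?thesis by simp
qed

abbreviation "G \<equiv> \<lambda>x. ennreal (g x)"

text \<open>An exponential is almost an eigenfunction of convolution with \<open>g\<close>, with eigenvalue about \<open>1 + \<theta> \<mu>\<close>.
  Jumps below \<open>1 / \<theta>\<close> are handled by Taylor expansion. For a jump \<open>y\<close> beyond \<open>1 / \<theta>\<close> the integrand is
  largest near \<open>y = x\<close>, where one big jump alone reaches \<open>x\<close>; this is the term with \<open>env x\<close>.\<close>

lemma exp_conv:
  assumes th: "\<theta> > 0" and x: "x > 0" and eta: "\<eta> \<ge> 0"
    and near: "(\<integral>\<^sup>+y. ennreal (y * g y * min 1 (\<theta> * y)) \<partial>lborel) \<le> ennreal \<eta>"
  shows "(G \<diamondop> (\<lambda>y. ennreal (exp (- \<theta> * y)) * indicator {0..} y)) x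
    \<le> ennreal (exp (- \<theta> * x) * (1 + \<theta> * \<mu> + \<theta> * \<eta>) + 2 * (2 * real p) ^ p / \<theta> * env x)"
proof -
  let ?C = "(2 * real p) ^ p" and ?e = "exp (- \<theta> * x)"
  let ?E = "\<lambda>y. ennreal (exp (- \<theta> * y)) * indicator {0..} y"
  have "(G \<diamondop> ?E) x = (\<integral>\<^sup>+y. ?E (x - y) * G y \<partial>lborel)"
    by (subst conv_commute) (auto simp: conv_def)
  also have "\<dots> \<le> (\<integral>\<^sup>+y. ennreal ?e * G y + ennreal (?e * \<theta>) * ennreal (y * g y)
      + ennreal (?e * \<theta>) * ennreal (y * g y * min 1 (\<theta> * y))
      + ennreal (?C * env x) * (ennreal (exp (- (\<theta> / 2) * (x - y))) * indicator {..x} y) \<partial>lborel)"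
  proof (rule nn_integral_mono)
    fix y
    show "?E (x - y) * G y \<le> ennreal ?e * G y + ennreal (?e * \<theta>) * ennreal (y * g y)
      + ennreal (?e * \<theta>) * ennreal (y * g y * min 1 (\<theta> * y))
      + ennreal (?C * env x) * (ennreal (exp (- (\<theta> / 2) * (x - y))) * indicator {..x} y)" (is "?l \<le> ?r")
    proof (cases "0 \<le> y \<and> y \<le> x")
      case True
      then have y: "0 \<le> y" "y \<le> x" by auto
      have l: "?l = ennreal (exp (- \<theta> * (x - y)) * g y)" using y by (simp add: ennreal_mult)
      have r: "?r = ennreal (?e * g y + ?e * \<theta> * (y * g y) + ?e * \<theta> * (y * g y * min 1 (\<theta> * y))
          + ?C * env x * exp (- (\<theta> / 2) * (x - y)))"
        using y x th by (simp add: ennreal_mult ennreal_plus)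
      have e: "exp (- \<theta> * (x - y)) = ?e * exp (\<theta> * y)" by (simp add: exp_add[symmetric] algebra_simps)
      have nn: "0 \<le> ?C * env x * exp (- (\<theta> / 2) * (x - y))" "0 \<le> ?e * g y + ?e * \<theta> * (y * g y) + ?e * \<theta> * (y * g y * min 1 (\<theta> * y))"
        using x y th by auto
      have "exp (- \<theta> * (x - y)) * g y \<le> ?e * g y + ?e * \<theta> * (y * g y) + ?e * \<theta> * (y * g y * min 1 (\<theta> * y))
          + ?C * env x * exp (- (\<theta> / 2) * (x - y))"
      proof (cases "\<theta> * y \<le> 1")
        case True
        have "exp (\<theta> * y) \<le> 1 + \<theta> * y + (\<theta> * y)\<^sup>2" using True y th by (intro exp_bound) auto
        then have "?e * exp (\<theta> * y) * g y \<le> ?e * (1 + \<theta> * y + (\<theta> * y)\<^sup>2) * g y"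
          by (intro mult_right_mono mult_left_mono) auto
        also have "\<dots> = ?e * g y + ?e * \<theta> * (y * g y) + ?e * \<theta> * (y * g y * min 1 (\<theta> * y))"
          using True by (simp add: algebra_simps power2_eq_square)
        finally show ?thesis using e nn by simp
      next
        case False
        then have y1: "1 / \<theta> \<le> y" "y > 0" using th y by (auto simp: field_simps intro!: le_neq_trans)
        have "g y \<le> ?C * exp (\<theta> / 2 * (x - y)) * env x"
          using g_le_env[OF y1(2)] env_growth[OF th y1(1) y(2)] by simp
        then have "exp (- \<theta> * (x - y)) * g y \<le> exp (- \<theta> * (x - y)) * (?C * exp (\<theta> / 2 * (x - y)) * env x)"
          by (intro mult_left_mono) auto
        also have "\<dots> = ?C * env x * (exp (- \<theta> * (x - y)) * exp (\<theta> / 2 * (x - y)))" by simp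
        also have "exp (- \<theta> * (x - y)) * exp (\<theta> / 2 * (x - y)) = exp (- (\<theta> / 2) * (x - y))"
          by (simp add: exp_add[symmetric] algebra_simps)
        finally show ?thesis using nn by simp
      qed
      then show ?thesis unfolding l r by (rule ennreal_leI)
    next
      case False
      then show ?thesis using g_neg[of y] by (auto simp: indicator_def)
    qed
  qed
  also have "\<dots> = ennreal ?e * (\<integral>\<^sup>+y. G y \<partial>lborel) + ennreal (?e * \<theta>) * (\<integral>\<^sup>+y. ennreal (y * g y) \<partial>lborel)
      + ennreal (?e * \<theta>) * (\<integral>\<^sup>+y. ennreal (y * g y * min 1 (\<theta> * y)) \<partial>lborel)
      + ennreal (?C * env x) * (\<integral>\<^sup>+y. ennreal (exp (- (\<theta> / 2) * (x - y))) * indicator {..x} y \<partial>lborel)"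
    by (simp add: nn_integral_add nn_integral_cmult)
  also have "\<dots> \<le> ennreal ?e * 1 + ennreal (?e * \<theta>) * ennreal \<mu> + ennreal (?e * \<theta>) * ennreal \<eta>
      + ennreal (?C * env x) * ennreal (1 / (\<theta> / 2))"
    using th near by (subst nn_integral_exp_ray) (auto simp: g_mass g_mean intro!: add_mono mult_left_mono)
  also have "\<dots> = ennreal (?e * (1 + \<theta> * \<mu> + \<theta> * \<eta>) + 2 * ?C / \<theta> * env x)"
    using th x eta mu_pos by (simp add: ennreal_mult[symmetric] ennreal_plus[symmetric] algebra_simps del: ennreal_plus)
  finally show ?thesis .
qed

text \<open>The shift by \<open>z\<close> keeps the envelope away from its peak. For small \<open>y\<close> the envelope is almost
  constant, with relative error of order \<open>y / z\<close>; for large \<open>y\<close> it is \<open>g\<close> that supplies the factor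
  \<open>env (x + z)\<close>, and only the small mass \<open>s\<close> of the shifted envelope remains.\<close>

lemma env_conv:
  assumes z: "z > 0" and x: "x \<ge> 0" and s: "s \<ge> 0"
    and tail: "(\<integral>\<^sup>+x. ennreal (env x) * indicator {z..} x \<partial>lborel) \<le> ennreal s"
  shows "(G \<diamondop> (\<lambda>y. ennreal (env (y + z)) * indicator {0..} y)) x
    \<le> ennreal (env (x + z) * (1 + 2 ^ (p + 1) * \<mu> / z + 2 ^ p * s))"
proof -
  let ?E = "\<lambda>y. ennreal (env (y + z)) * indicator {0..} y"
  let ?T = "\<lambda>y. ennreal (env y) * indicator {z..} y"
  let ?v = "env (x + z)"
  have "(G \<diamondop> ?E) x = (\<integral>\<^sup>+y. ?E (x - y) * G y \<partial>lborel)"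
    by (subst conv_commute) (auto simp: conv_def)
  also have "\<dots> \<le> (\<integral>\<^sup>+y. ennreal ?v * G y + ennreal (2 ^ (p + 1) / z * ?v) * ennreal (y * g y)
      + ennreal (2 ^ p * ?v) * ?T (x + z - y) \<partial>lborel)"
  proof (rule nn_integral_mono)
    fix y
    show "?E (x - y) * G y \<le> ennreal ?v * G y + ennreal (2 ^ (p + 1) / z * ?v) * ennreal (y * g y)
      + ennreal (2 ^ p * ?v) * ?T (x + z - y)" (is "?l \<le> ?r")
    proof (cases "0 \<le> y \<and> y \<le> x")
      case True
      then have y: "0 \<le> y" "y \<le> x" by auto
      have l: "?l = ennreal (env (x + z - y) * g y)" using y z by (simp add: ennreal_mult algebra_simps)
      have r: "?r = ennreal (?v * g y + 2 ^ (p + 1) / z * ?v * (y * g y) + 2 ^ p * ?v * env (x + z - y))"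
        using y x z by (simp add: ennreal_mult[symmetric] ennreal_plus[symmetric] algebra_simps del: ennreal_plus)
      have nn: "0 \<le> 2 ^ p * ?v * env (x + z - y)" "0 \<le> ?v * g y" "0 \<le> 2 ^ (p + 1) / z * ?v * (y * g y)"
        using x y z by auto
      have "env (x + z - y) * g y \<le> ?v * g y + 2 ^ (p + 1) / z * ?v * (y * g y) + 2 ^ p * ?v * env (x + z - y)"
      proof (cases "2 * y \<le> x + z")
        case True
        define t where "t = 2 * y / (x + z)"
        have t: "0 \<le> t" "t \<le> 1" "t \<le> 2 * y / z" using True y z x by (auto simp: t_def field_simps intro!: mult_left_mono)
        have q: "(x + z) / (x + z - y) \<le> 1 + t"
        proof -
          have "(x + z) / (x + z - y) = 1 + y / (x + z - y)" using y z x by (simp add: field_simps)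
          also have "y / (x + z - y) \<le> y / ((x + z) / 2)" using True y z x by (intro divide_left_mono) auto
          finally show ?thesis by (simp add: t_def mult.commute)
        qed
        have "env (x + z - y) \<le> ((x + z) / (x + z - y)) ^ p * ?v" using y z x by (intro env_scale) auto
        also have "\<dots> \<le> (1 + t) ^ p * ?v" using q y z x by (intro mult_right_mono power_mono) auto
        also have "\<dots> \<le> (1 + (2 ^ p - 1) * t) * ?v" using t z x by (intro mult_right_mono one_plus_pow_le) auto
        also have "\<dots> \<le> (1 + 2 ^ p * (2 * y / z)) * ?v" using t z x y
          by (intro mult_right_mono add_mono mult_mono) auto
        finally have "env (x + z - y) * g y \<le> (1 + 2 ^ p * (2 * y / z)) * ?v * g y" by (intro mult_right_mono) auto
        also have "\<dots> = ?v * g y + 2 ^ (p + 1) / z * ?v * (y * g y)" by (simp add: algebra_simps)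
        finally show ?thesis using nn by simp
      next
        case False
        then have yp: "y > 0" using x z by simp
        have "g y \<le> ((x + z) / y) ^ p * ?v" using g_le_env[OF yp] env_scale[OF yp, of "x + z"] y z by simp
        also have "\<dots> \<le> 2 ^ p * ?v" using False yp x z by (intro mult_right_mono power_mono) (auto simp: field_simps)
        finally have "env (x + z - y) * g y \<le> env (x + z - y) * (2 ^ p * ?v)" using y z by (intro mult_left_mono) auto
        then show ?thesis using nn by (simp add: mult_ac)
      qed
      then show ?thesis unfolding l r by (rule ennreal_leI)
    next
      case False
      then show ?thesis using g_neg[of y] by (auto simp: indicator_def)
    qed
  qed
  also have "\<dots> = ennreal ?v * (\<integral>\<^sup>+y. G y \<partial>lborel) + ennreal (2 ^ (p + 1) / z * ?v) * (\<integral>\<^sup>+y. ennreal (y * g y) \<partial>lborel)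
      + ennreal (2 ^ p * ?v) * (\<integral>\<^sup>+y. ?T (x + z - y) \<partial>lborel)"
    by (simp add: nn_integral_add nn_integral_cmult)
  also have "(\<integral>\<^sup>+y. ?T (x + z - y) \<partial>lborel) = (\<integral>\<^sup>+y. ?T y \<partial>lborel)"
    by (rule nn_integral_reflect) measurable
  also have "ennreal ?v * (\<integral>\<^sup>+y. G y \<partial>lborel) + ennreal (2 ^ (p + 1) / z * ?v) * (\<integral>\<^sup>+y. ennreal (y * g y) \<partial>lborel)
      + ennreal (2 ^ p * ?v) * (\<integral>\<^sup>+y. ?T y \<partial>lborel)
     \<le> ennreal ?v * 1 + ennreal (2 ^ (p + 1) / z * ?v) * ennreal \<mu> + ennreal (2 ^ p * ?v) * ennreal s"
    using tail by (auto simp: g_mass g_mean intro!: add_mono mult_left_mono)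
  also have "\<dots> = ennreal (?v * (1 + 2 ^ (p + 1) * \<mu> / z + 2 ^ p * s))"
    using x z s mu_pos by (simp add: ennreal_mult[symmetric] ennreal_plus[symmetric] algebra_simps del: ennreal_plus)
  finally show ?thesis .
qed

section \<open>The renewal equation and a crude bound\<close>

text \<open>The tail integral of \<open>g\<close> beyond \<open>x\<close> is at least \<open>g (x + 1)\<close>, which is comparable to \<open>g x\<close>.\<close>

lemma g_le_tail:
  "\<exists>C>0. \<forall>x\<ge>0. ennreal (g x) \<le> ennreal C * (\<integral>\<^sup>+y. G y * indicator {x<..} y \<partial>lborel)"
proof -
  obtain q where q: "q > \<alpha>" by (meson gt_ex)
  obtain x0 where x0: "x0 > 0" "\<And>y x. x0 \<le> y \<Longrightarrow> y \<le> x \<Longrightarrow> g y \<le> 2 powr q * (x / y) powr q * g x"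
    using potter[OF q] by blast
  define C where "C = 2 powr q * (1 + 1 / x0) powr q + g 0 / g (x0 + 1)"
  have C: "C > 0" using x0 g_pos[of 0] g_pos[of "x0 + 1"] by (auto simp: C_def intro!: add_nonneg_pos)
  have step: "g x \<le> C * g (x + 1)" if "x \<ge> 0" for x
  proof (cases "x0 \<le> x")
    case True
    have "g x \<le> 2 powr q * ((x + 1) / x) powr q * g (x + 1)" using x0(2)[OF True, of "x + 1"] by simp
    also have "\<dots> \<le> 2 powr q * (1 + 1 / x0) powr q * g (x + 1)"
      using True x0(1) q alpha_gt by (intro mult_right_mono mult_left_mono powr_mono2) (auto simp: field_simps)
    also have "\<dots> \<le> C * g (x + 1)" unfolding C_def by (intro mult_right_mono) auto
    finally show ?thesis .
  next
    case False
    have "g x \<le> g 0 / g (x0 + 1) * g (x0 + 1)" using that g_anti[of 0 x] g_pos[of "x0 + 1"] x0 by simp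
    also have "\<dots> \<le> g 0 / g (x0 + 1) * g (x + 1)" using False that by (intro mult_left_mono g_anti) auto
    also have "\<dots> \<le> C * g (x + 1)" unfolding C_def by (intro mult_right_mono) auto
    finally show ?thesis .
  qed
  have "ennreal (g x) \<le> ennreal C * (\<integral>\<^sup>+y. G y * indicator {x<..} y \<partial>lborel)" if x: "x \<ge> 0" for x
  proof -
    have "ennreal (g (x + 1)) = (\<integral>\<^sup>+y. ennreal (g (x + 1)) * indicator {x<..x + 1} y \<partial>lborel)"
      by (simp add: nn_integral_cmult_indicator)
    also have "\<dots> \<le> (\<integral>\<^sup>+y. G y * indicator {x<..} y \<partial>lborel)"
      using x by (intro nn_integral_mono) (auto simp: indicator_def intro!: ennreal_leI g_anti)
    finally have "ennreal C * ennreal (g (x + 1)) \<le> ennreal C * (\<integral>\<^sup>+y. G y * indicator {x<..} y \<partial>lborel)"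
      by (intro mult_left_mono) auto
    moreover have "ennreal (g x) \<le> ennreal C * ennreal (g (x + 1))"
      using step[OF x] C by (simp add: ennreal_mult[symmetric] ennreal_leI)
    ultimately show ?thesis by simp
  qed
  with C show ?thesis by blast
qed

text \<open>The density of the stationary workload of an M/G/1 queue with load \<open>1 - \<epsilon>\<close>, whose law also
  has an atom \<open>\<epsilon>\<close> at \<open>0\<close>: the Pollaczek--Khinchine formula written as a renewal equation.\<close>

definition workload_density :: "real \<Rightarrow> (real \<Rightarrow> real) \<Rightarrow> bool" where
  "workload_density \<epsilon> f \<longleftrightarrow> f \<in> borel_measurable borel \<and> (\<forall>x. 0 \<le> f x) \<and> (\<forall>x<0. f x = 0) \<and> (\<exists>b. \<forall>x. f x \<le> b) \<and>
     (\<integral>\<^sup>+x. ennreal (f x) \<partial>lborel) = ennreal (1 - \<epsilon>) \<and>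
     (\<lambda>x. ennreal (f x)) = (\<lambda>x. ennreal ((1 - \<epsilon>) * \<epsilon>) * G x + ennreal (1 - \<epsilon>) * (G \<diamondop> (\<lambda>x. ennreal (f x))) x)"

text \<open>Convolving the equation with the indicator of the positive half-line shows that the tail
  integral \<open>T\<close> of \<open>g\<close> satisfies \<open>T \<diamondop> f \<le> \<epsilon>\<close>: up to the factor \<open>\<epsilon>\<close>, this is the probability that a renewal process
  jumps over a level. Since \<open>g\<close> is at most a multiple of \<open>T\<close>, the equation bounds \<open>f\<close> itself.\<close>

lemma renewal_bound:
  "\<exists>A>0. \<forall>\<epsilon> f. 0 < \<epsilon> \<and> \<epsilon> < 1 \<and> workload_density \<epsilon> f \<longrightarrow> (\<forall>x. f x \<le> A * \<epsilon>)"
proof -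
  obtain C where C: "C > 0" "\<And>x. x \<ge> 0 \<Longrightarrow> ennreal (g x) \<le> ennreal C * (\<integral>\<^sup>+y. G y * indicator {x<..} y \<partial>lborel)"
    using g_le_tail by blast
  show ?thesis
  proof (intro exI[of _ "g 0 + C"] conjI allI impI)
    show "g 0 + C > 0" using C by (simp add: add_nonneg_pos)
    fix \<epsilon> f x assume *: "0 < \<epsilon> \<and> \<epsilon> < 1 \<and> workload_density \<epsilon> f"
    define F where "F = (\<lambda>x. ennreal (f x))"
    from * have e: "0 < \<epsilon>" "\<epsilon> < 1" and [measurable]: "f \<in> borel_measurable borel"
      and F: "F = (\<lambda>x. ennreal ((1 - \<epsilon>) * \<epsilon>) * G x + ennreal (1 - \<epsilon>) * (G \<diamondop> F) x)"
      and mass: "(\<integral>\<^sup>+x. F x \<partial>lborel) = ennreal (1 - \<epsilon>)" and neg: "\<And>x. x < 0 \<Longrightarrow> F x = 0"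
      by (auto simp: workload_density_def F_def)
    have [measurable]: "F \<in> borel_measurable borel" unfolding F_def by measurable
    define H :: "real \<Rightarrow> ennreal" where "H = indicator {0..}"
    define T where "T = (\<lambda>x. indicator {0..} x * (\<integral>\<^sup>+y. G y * indicator {x<..} y \<partial>lborel))"
    have [measurable]: "H \<in> borel_measurable borel" unfolding H_def by measurable
    have "T = (\<lambda>x. indicator {0..} x * (\<integral>\<^sup>+y. G y * (if x < y then 1 else 0) \<partial>lborel))"
      unfolding T_def by (intro ext arg_cong2[where f = "(*)"] nn_integral_cong) auto
    then have [measurable]: "T \<in> borel_measurable borel" by simp
    have HG: "(H \<diamondop> G) x = (\<integral>\<^sup>+y. G y * indicator {..x} y \<partial>lborel)" for x
      unfolding conv_def H_def by (intro nn_integral_cong) (auto simp: indicator_def)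
    have HG1: "(H \<diamondop> G) x \<le> 1" for x
      unfolding HG g_mass[symmetric] by (intro nn_integral_mono) (auto simp: indicator_def)
    have Heq: "H = (\<lambda>x. (H \<diamondop> G) x + T x)"
    proof
      fix x show "H x = (H \<diamondop> G) x + T x"
      proof (cases "x \<ge> 0")
        case True
        have "(H \<diamondop> G) x + T x = (\<integral>\<^sup>+y. G y * indicator {..x} y + G y * indicator {x<..} y \<partial>lborel)"
          unfolding HG T_def using True by (simp add: nn_integral_add)
        also have "\<dots> = (\<integral>\<^sup>+y. G y \<partial>lborel)" by (intro nn_integral_cong) (auto simp: indicator_def)
        finally show ?thesis using True by (simp add: g_mass H_def)
      next
        case False
        have "(H \<diamondop> G) x = (\<integral>\<^sup>+y. 0 \<partial>(lborel :: real measure))"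
          unfolding HG by (intro nn_integral_cong) (use False g_neg in \<open>auto simp: indicator_def\<close>)
        then show ?thesis using False by (simp add: T_def H_def)
      qed
    qed
    \<comment> \<open>insert \<open>H = H \<diamondop> G + T\<close> on one side and the renewal equation on the other, and cancel\<close>
    have TF: "(T \<diamondop> F) x \<le> ennreal \<epsilon>" for x
    proof -
      have a: "(H \<diamondop> F) x = (H \<diamondop> G \<diamondop> F) x + (T \<diamondop> F) x"
      proof -
        have "(H \<diamondop> F) x = ((\<lambda>x. (H \<diamondop> G) x + T x) \<diamondop> F) x" using Heq by simp
        also have "\<dots> = (F \<diamondop> (\<lambda>x. (H \<diamondop> G) x + T x)) x" by (subst conv_commute) auto
        also have "\<dots> = (F \<diamondop> (H \<diamondop> G)) x + (F \<diamondop> T) x" by (subst conv_add_right) auto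
        also have "F \<diamondop> (H \<diamondop> G) = H \<diamondop> G \<diamondop> F" by (rule conv_commute) auto
        also have "F \<diamondop> T = T \<diamondop> F" by (rule conv_commute) auto
        finally show ?thesis .
      qed
      have b: "(H \<diamondop> F) x = ennreal ((1 - \<epsilon>) * \<epsilon>) * (H \<diamondop> G) x + ennreal (1 - \<epsilon>) * (H \<diamondop> G \<diamondop> F) x"
      proof -
        have "(H \<diamondop> F) x = (H \<diamondop> (\<lambda>x. ennreal ((1 - \<epsilon>) * \<epsilon>) * G x + ennreal (1 - \<epsilon>) * (G \<diamondop> F) x)) x" 
          using F by simp
        also have "\<dots> = ennreal ((1 - \<epsilon>) * \<epsilon>) * (H \<diamondop> G) x + ennreal (1 - \<epsilon>) * (H \<diamondop> (G \<diamondop> F)) x"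
          by (simp add: conv_add_right conv_cmult_right)
        finally show ?thesis by (simp add: conv_assoc)
      qed
      have fin: "(H \<diamondop> G \<diamondop> F) x \<noteq> \<top>"
      proof -
        have "(H \<diamondop> G \<diamondop> F) x \<le> (\<integral>\<^sup>+y. 1 * F y \<partial>lborel)"
          by (subst conv_def) (intro nn_integral_mono mult_right_mono HG1, auto)
        then show ?thesis using mass by (auto simp: top_unique)
      qed
      have "(H \<diamondop> G \<diamondop> F) x + (T \<diamondop> F) x \<le> ennreal \<epsilon> * 1 + 1 * (H \<diamondop> G \<diamondop> F) x"
        unfolding a[symmetric] b using e
        by (intro add_mono mult_mono HG1) (auto intro!: ennreal_leI mult_left_le_one_le simp: ennreal_1[symmetric] simp del: ennreal_1)
      then have "(H \<diamondop> G \<diamondop> F) x + (T \<diamondop> F) x \<le> (H \<diamondop> G \<diamondop> F) x + ennreal \<epsilon>" by (simp add: add.commute)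
      with fin show ?thesis by (simp add: ennreal_add_left_cancel_le)
    qed
    have GT: "G x \<le> ennreal C * T x" for x
      using C(2)[of x] g_neg[of x] by (cases "x \<ge> 0") (auto simp: T_def)
    have "(G \<diamondop> F) x \<le> (\<integral>\<^sup>+y. ennreal C * (T (x - y) * F y) \<partial>lborel)"
      unfolding conv_def by (intro nn_integral_mono) (simp add: mult.assoc[symmetric] mult_right_mono GT)
    also have "\<dots> = ennreal C * (T \<diamondop> F) x" unfolding conv_def by (rule nn_integral_cmult) measurable
    also have "\<dots> \<le> ennreal C * ennreal \<epsilon>" by (intro mult_left_mono TF) auto
    finally have GF: "(G \<diamondop> F) x \<le> ennreal (C * \<epsilon>)" using C e by (simp add: ennreal_mult)
    have "g x \<le> g 0" using g_anti[of 0 x] g_neg[of x] by (cases "x \<ge> 0") auto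
    then have "F x \<le> ennreal (1 * \<epsilon>) * ennreal (g 0) + 1 * ennreal (C * \<epsilon>)"
      using e by (subst F, intro add_mono mult_mono GF) (auto intro!: ennreal_leI mult_right_mono simp: ennreal_1[symmetric] simp del: ennreal_1)
    also have "\<dots> = ennreal ((g 0 + C) * \<epsilon>)"
      using e C by (simp add: ennreal_mult[symmetric] ennreal_plus[symmetric] algebra_simps del: ennreal_plus)
    finally show "f x \<le> (g 0 + C) * \<epsilon>" unfolding F_def using e C by (simp add: ennreal_le_iff)
  qed
qed

text \<open>If \<open>f\<close> exceeds \<open>\<Phi>\<close> by at most a constant, then one application of the equation shrinks this constant
  by the factor \<open>1 - \<epsilon>\<close>, because \<open>g\<close> has mass one.\<close>

lemma comparison:
  assumes e: "0 < \<epsilon>" "\<epsilon> < 1" and w: "workload_density \<epsilon> f"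
    and [measurable]: "\<Phi> \<in> borel_measurable borel"
    and small: "\<And>x. x < a \<Longrightarrow> ennreal (f x) \<le> \<Phi> x"
    and super: "\<And>x. a \<le> x \<Longrightarrow> ennreal ((1 - \<epsilon>) * \<epsilon>) * G x + ennreal (1 - \<epsilon>) * (G \<diamondop> \<Phi>) x \<le> \<Phi> x"
  shows "ennreal (f x) \<le> \<Phi> x"
proof -
  define F where "F = (\<lambda>x. ennreal (f x))"
  from w obtain b where [measurable]: "f \<in> borel_measurable borel"
      and F: "F = (\<lambda>x. ennreal ((1 - \<epsilon>) * \<epsilon>) * G x + ennreal (1 - \<epsilon>) * (G \<diamondop> F) x)"
      and b: "\<And>x. f x \<le> b"
    by (auto simp: workload_density_def F_def)
  define r where "r = ennreal (1 - \<epsilon>)"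
  have [measurable]: "F \<in> borel_measurable borel" unfolding F_def by measurable
  have it: "F x \<le> \<Phi> x + r ^ n * ennreal b" for n x
  proof (induction n arbitrary: x)
    case 0
    then show ?case using b[of x] unfolding F_def by (simp add: add_increasing ennreal_leI)
  next
    case (Suc n)
    show ?case
    proof (cases "x < a")
      case True
      then show ?thesis using small[OF True] unfolding F_def by (simp add: add_increasing2)
    next
      case False
      have "(G \<diamondop> F) x \<le> (G \<diamondop> (\<lambda>x. \<Phi> x + r ^ n * ennreal b)) x" by (rule conv_mono_on) (rule Suc)
      also have "\<dots> = (G \<diamondop> \<Phi>) x + (G \<diamondop> (\<lambda>x. r ^ n * ennreal b)) x"
        by (subst conv_add_right) auto
      also have "(G \<diamondop> (\<lambda>x. r ^ n * ennreal b)) x = r ^ n * ennreal b"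
        unfolding conv_def by (subst nn_integral_multc) (auto simp: nn_integral_reflect[of G] g_mass)
      finally have "F x \<le> ennreal ((1 - \<epsilon>) * \<epsilon>) * G x + r * ((G \<diamondop> \<Phi>) x + r ^ n * ennreal b)"
        unfolding r_def by (subst F) (intro add_mono mult_left_mono order_refl, auto)
      also have "\<dots> \<le> \<Phi> x + r ^ Suc n * ennreal b"
        using super[of x] False by (simp add: distrib_left add.assoc[symmetric] add_mono mult.assoc r_def)
      finally show ?thesis .
    qed
  qed
  have "(\<lambda>n. \<Phi> x + r ^ n * ennreal b) \<longlonglongrightarrow> \<Phi> x + 0 * ennreal b"
  proof (intro tendsto_add tendsto_const)
    have "(\<lambda>n. (1 - \<epsilon>) ^ n * b) \<longlonglongrightarrow> 0 * b" using e by (intro tendsto_intros LIMSEQ_realpow_zero) auto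
    then have "(\<lambda>n. ennreal ((1 - \<epsilon>) ^ n * b)) \<longlonglongrightarrow> ennreal (0 * b)" by (rule tendsto_ennrealI)
    then show "(\<lambda>n. r ^ n * ennreal b) \<longlonglongrightarrow> 0 * ennreal b"
      using e by (simp add: r_def ennreal_power ennreal_mult')
  qed
  then have "F x \<le> \<Phi> x + 0 * ennreal b" by (rule LIMSEQ_le_const) (use it in auto)
  then show ?thesis by (simp add: F_def)
qed

text \<open>The supersolution is a sum of two terms. For the exponential, the choice \<open>c < 1\<close> leaves
  room for the Taylor remainder: \<open>(1 - \<epsilon>) (1 + \<epsilon>) \<le> 1\<close> once the remainder is absorbed. It produces an error of
  order \<open>env x\<close>. The shift \<open>K / \<epsilon>\<close> makes the relative error of convolving the envelope smaller than
  \<open>\<epsilon> / 2\<close>; the remaining margin \<open>(D / 2) env (x + K / \<epsilon>)\<close> pays for that error and for the forcing term.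
  On \<open>[0, \<mu> / (c \<epsilon>)]\<close>, where the forcing term is too large for this, the bound \<open>O(\<epsilon>)\<close> for \<open>f\<close> is used.\<close>

lemma crude_bound:
  assumes c: "0 < c" "c < 1"
  shows "\<exists>A>0. \<exists>D>0. \<exists>e0>0. \<forall>\<epsilon> f. 0 < \<epsilon> \<and> \<epsilon> < e0 \<and> \<epsilon> < 1 \<and> workload_density \<epsilon> f \<longrightarrow>
     (\<integral>\<^sup>+x. ennreal (env x) * indicator {2 ^ (p + 3) * \<mu> / c / \<epsilon>..} x \<partial>lborel) \<le> ennreal \<epsilon> \<and>
     (\<forall>x\<ge>0. f x \<le> A * \<epsilon> * exp (- (c * \<epsilon> / \<mu>) * x) + D / \<epsilon> * env (x + 2 ^ (p + 3) * \<mu> / c / \<epsilon>))"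
proof -
  define K where "K = 2 ^ (p + 3) * \<mu> / c"
  have K: "K > 0" "2 ^ (p + 1) * \<mu> / K \<le> 1 / 4"
    using c mu_pos by (auto simp: K_def field_simps power_add)
  \<comment> \<open>the Taylor remainder that turns the factor \<open>1 + c * \<epsilon>\<close> into exactly \<open>1 + \<epsilon>\<close>\<close>
  define \<eta> where "\<eta> = \<mu> * (1 - c) / c"
  have eta: "\<eta> > 0" using c mu_pos by (simp add: \<eta>_def)
  obtain t0 where t0: "t0 > 0" "\<And>t. 0 < t \<Longrightarrow> t \<le> t0 \<Longrightarrow> (\<integral>\<^sup>+y. ennreal (y * g y * min 1 (t * y)) \<partial>lborel) \<le> ennreal \<eta>"
    using mean_near_zero[OF eta] by blast
  define \<eta>' where "\<eta>' = K / 2 ^ (p + 2)"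
  have eta': "\<eta>' > 0" using K by (simp add: \<eta>'_def)
  obtain z0 where z0: "z0 > 0" "\<And>z. z \<ge> z0 \<Longrightarrow> (\<integral>\<^sup>+x. ennreal (env x) * indicator {z..} x \<partial>lborel) \<le> ennreal (\<eta>' / z)"
    using env_tail[OF eta'] by blast
  obtain A0 where A0: "A0 > 0" "\<And>\<epsilon> f x. 0 < \<epsilon> \<Longrightarrow> \<epsilon> < 1 \<Longrightarrow> workload_density \<epsilon> f \<Longrightarrow> f x \<le> A0 * \<epsilon>"
    using renewal_bound by blast
  define A where "A = A0 * exp 1"
  define Cp where "Cp = (2 * real p) ^ p"
  define C3 where "C3 = (1 + K * c / \<mu>) ^ p"
  define D where "D = 2 * C3 * (1 + 2 * A * Cp * \<mu> / c)"
  have pos: "A > 0" "Cp > 0" "C3 > 0"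
    using A0 p_gt c mu_pos K by (auto simp: A_def Cp_def C3_def intro!: zero_less_power add_pos_pos)
  have D: "D > 0" using pos c mu_pos by (auto simp: D_def intro!: mult_pos_pos add_pos_pos)
  define e0 where "e0 = min (t0 * \<mu> / c) (K / z0)"
  have "e0 > 0" using t0 z0 K c mu_pos by (simp add: e0_def)
  moreover have "(\<integral>\<^sup>+x. ennreal (env x) * indicator {K / \<epsilon>..} x \<partial>lborel) \<le> ennreal \<epsilon> \<and>
     (\<forall>x\<ge>0. f x \<le> A * \<epsilon> * exp (- (c * \<epsilon> / \<mu>) * x) + D / \<epsilon> * env (x + K / \<epsilon>))"
    if e: "0 < \<epsilon>" "\<epsilon> < e0" "\<epsilon> < 1" and w: "workload_density \<epsilon> f" for \<epsilon> f
  proof -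
    define \<theta> where "\<theta> = c * \<epsilon> / \<mu>"
    define z where "z = K / \<epsilon>"
    have th: "\<theta> > 0" "\<theta> \<le> t0" using e c mu_pos by (auto simp: \<theta>_def e0_def field_simps)
    have z: "z > 0" "z \<ge> z0" using e K z0 by (auto simp: z_def e0_def field_simps)
    define s where "s = \<epsilon> / 2 ^ (p + 2)"
    have p4: "1 \<le> 4 * (2::real) ^ p" using one_le_power[of "2::real" p] by linarith
    have s: "s \<ge> 0" "s \<le> \<epsilon>" "2 ^ p * s = \<epsilon> / 4"
      using e p4 by (auto simp: s_def power_add field_simps)
    have tail: "(\<integral>\<^sup>+x. ennreal (env x) * indicator {z..} x \<partial>lborel) \<le> ennreal s"
      using z0(2)[OF z(2)] K e by (simp add: \<eta>'_def z_def s_def)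
    have near: "(\<integral>\<^sup>+y. ennreal (y * g y * min 1 (\<theta> * y)) \<partial>lborel) \<le> ennreal \<eta>" using t0(2) th by blast
    have te: "\<theta> * \<mu> + \<theta> * \<eta> = \<epsilon>" using mu_pos c by (simp add: \<theta>_def \<eta>_def field_simps)
    let ?E1 = "\<lambda>y. ennreal (exp (- \<theta> * y)) * indicator {0..} y"
    let ?E2 = "\<lambda>y. ennreal (env (y + z)) * indicator {0..} y"
    define \<Phi> where "\<Phi> = (\<lambda>y. ennreal (A * \<epsilon>) * ?E1 y + ennreal (D / \<epsilon>) * ?E2 y)"
    have [measurable]: "\<Phi> \<in> borel_measurable borel" unfolding \<Phi>_def by measurable
    have Phi: "\<Phi> x = ennreal (A * \<epsilon> * exp (- \<theta> * x) + D / \<epsilon> * env (x + z))" if "x \<ge> 0" for x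
      using that pos D e z by (simp add: \<Phi>_def ennreal_mult[symmetric] ennreal_plus[symmetric] del: ennreal_plus)
    have main: "ennreal (f x) \<le> \<Phi> x" for x
    proof (rule comparison[OF e(1,3) w, where a = "1 / \<theta>"])
      fix x assume x: "x < 1 / \<theta>"
      show "ennreal (f x) \<le> \<Phi> x"
      proof (cases "x < 0")
        case True
        then show ?thesis using w by (simp add: workload_density_def)
      next
        case False
        have "f x \<le> A0 * \<epsilon> * 1" using A0(2)[OF e(1,3) w] by simp
        also have "\<dots> \<le> A0 * \<epsilon> * exp (1 - \<theta> * x)"
          using A0 e x th by (intro mult_left_mono) (auto simp: field_simps)
        also have "\<dots> = A * \<epsilon> * exp (- \<theta> * x)" by (simp add: A_def exp_add[symmetric])
        also have "\<dots> \<le> A * \<epsilon> * exp (- \<theta> * x) + D / \<epsilon> * env (x + z)" using D e z False by simp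
        finally show ?thesis using False by (subst Phi) (auto intro: ennreal_leI)
      qed
    next
      fix x assume x1: "1 / \<theta> \<le> x"
      then have x: "x > 0" using th by (meson less_le_trans zero_less_divide_1_iff)
      let ?v = "env (x + z)" and ?ex = "exp (- \<theta> * x)"
      have v: "?v \<ge> 0" using x z by simp
      have ev: "env x \<le> C3 * ?v"
      proof -
        have "env x \<le> ((x + z) / x) ^ p * ?v" using x z by (intro env_scale) auto
        also have "\<dots> \<le> C3 * ?v"
        proof (unfold C3_def, intro mult_right_mono power_mono)
          have "z / x \<le> z / (1 / \<theta>)" using x1 x th z by (intro divide_left_mono) auto
          also have "z / (1 / \<theta>) = K * c / \<mu>" using e by (simp add: z_def \<theta>_def)
          finally show "(x + z) / x \<le> 1 + K * c / \<mu>" using x by (simp add: add_divide_distrib)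
        qed (use x z v in auto)
        finally show ?thesis .
      qed
      have "ennreal ((1 - \<epsilon>) * \<epsilon>) * G x + ennreal (1 - \<epsilon>) * (G \<diamondop> \<Phi>) x
        = ennreal ((1 - \<epsilon>) * \<epsilon>) * G x + ennreal (1 - \<epsilon>) * (ennreal (A * \<epsilon>) * (G \<diamondop> ?E1) x + ennreal (D / \<epsilon>) * (G \<diamondop> ?E2) x)"
        unfolding \<Phi>_def by (simp add: conv_add_right conv_cmult_right)
      also have "\<dots> \<le> ennreal ((1 - \<epsilon>) * \<epsilon>) * G x + ennreal (1 - \<epsilon>) *
         (ennreal (A * \<epsilon>) * ennreal (?ex * (1 + \<theta> * \<mu> + \<theta> * \<eta>) + 2 * (2 * real p) ^ p / \<theta> * env x)
        + ennreal (D / \<epsilon>) * ennreal (?v * (1 + 2 ^ (p + 1) * \<mu> / z + 2 ^ p * s)))"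
        using eta th near x z s tail
        by (intro add_mono order_refl mult_left_mono exp_conv env_conv) auto
      also have "\<dots> = ennreal ((1 - \<epsilon>) * \<epsilon> * g x + (1 - \<epsilon>) *
         (A * \<epsilon> * (?ex * (1 + \<theta> * \<mu> + \<theta> * \<eta>) + 2 * Cp / \<theta> * env x)
        + D / \<epsilon> * (?v * (1 + 2 ^ (p + 1) * \<mu> / z + 2 ^ p * s))))"
        using e pos D th x z s v eta mu_pos unfolding Cp_def[symmetric]
        by (simp add: ennreal_mult[symmetric] ennreal_plus[symmetric] del: ennreal_plus)
      also have "\<dots> \<le> ennreal (A * \<epsilon> * ?ex + D / \<epsilon> * ?v)"
      proof (rule ennreal_leI)
        have a1: "(1 - \<epsilon>) * \<epsilon> * g x \<le> \<epsilon> * (C3 * ?v)"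
          using e ev g_le_env[OF x] by (intro mult_mono) (auto intro: order_trans mult_left_le_one_le)
        have a2: "(1 - \<epsilon>) * (A * \<epsilon> * (?ex * (1 + \<theta> * \<mu> + \<theta> * \<eta>))) \<le> A * \<epsilon> * ?ex"
        proof -
          have "(1 - \<epsilon>) * (A * \<epsilon> * (?ex * (1 + \<theta> * \<mu> + \<theta> * \<eta>))) = (A * \<epsilon> * ?ex) * ((1 - \<epsilon>) * (1 + \<epsilon>))"
            using te by (simp add: algebra_simps)
          also have "\<dots> \<le> (A * \<epsilon> * ?ex) * 1" using pos e by (intro mult_left_mono) (auto simp: algebra_simps)
          finally show ?thesis by simp
        qed
        have a3: "(1 - \<epsilon>) * (A * \<epsilon> * (2 * Cp / \<theta> * env x)) \<le> A * (2 * Cp * \<mu> / c) * (C3 * ?v)"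
        proof -
          have "(1 - \<epsilon>) * (A * \<epsilon> * (2 * Cp / \<theta> * env x)) \<le> 1 * (A * \<epsilon> * (2 * Cp / \<theta> * (C3 * ?v)))"
            using e pos th ev x by (intro mult_mono mult_left_mono) auto
          also have "\<dots> = A * (2 * Cp * \<mu> / c) * (C3 * ?v)" using e by (simp add: \<theta>_def)
          finally show ?thesis .
        qed
        have a4: "(1 - \<epsilon>) * (D / \<epsilon> * (?v * (1 + 2 ^ (p + 1) * \<mu> / z + 2 ^ p * s))) \<le> D / \<epsilon> * ?v - D / 2 * ?v"
        proof -
          have "2 ^ (p + 1) * \<mu> / z = \<epsilon> * (2 ^ (p + 1) * \<mu> / K)" by (simp add: z_def)
          also have "\<dots> \<le> \<epsilon> * (1 / 4)" using K e by (intro mult_left_mono) auto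
          finally have "1 + 2 ^ (p + 1) * \<mu> / z + 2 ^ p * s \<le> 1 + \<epsilon> / 2" using s by simp
          then have "(1 - \<epsilon>) * (1 + 2 ^ (p + 1) * \<mu> / z + 2 ^ p * s) \<le> (1 - \<epsilon>) * (1 + \<epsilon> / 2)"
            using e by (intro mult_left_mono) auto
          also have "\<dots> \<le> 1 - \<epsilon> / 2" by (simp add: algebra_simps)
          finally have "D / \<epsilon> * ?v * ((1 - \<epsilon>) * (1 + 2 ^ (p + 1) * \<mu> / z + 2 ^ p * s)) \<le> D / \<epsilon> * ?v * (1 - \<epsilon> / 2)"
            using D e v by (intro mult_left_mono) auto
          also have "\<dots> = D / \<epsilon> * ?v - D / 2 * ?v" using e by (simp add: field_simps)
          finally show ?thesis by (simp add: mult_ac)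
        qed
        have a5: "\<epsilon> * (C3 * ?v) + A * (2 * Cp * \<mu> / c) * (C3 * ?v) \<le> D / 2 * ?v"
        proof -
          have "\<epsilon> * (C3 * ?v) \<le> 1 * (C3 * ?v)" using e pos v by (intro mult_right_mono) auto
          then show ?thesis by (simp add: D_def algebra_simps)
        qed
        show "(1 - \<epsilon>) * \<epsilon> * g x + (1 - \<epsilon>) *
         (A * \<epsilon> * (?ex * (1 + \<theta> * \<mu> + \<theta> * \<eta>) + 2 * Cp / \<theta> * env x)
        + D / \<epsilon> * (?v * (1 + 2 ^ (p + 1) * \<mu> / z + 2 ^ p * s))) \<le> A * \<epsilon> * ?ex + D / \<epsilon> * ?v"
          using a1 a2 a3 a4 a5 by (simp only: distrib_left)
      qed
      also have "\<dots> = \<Phi> x" using x by (simp add: Phi)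
      finally show "ennreal ((1 - \<epsilon>) * \<epsilon>) * G x + ennreal (1 - \<epsilon>) * (G \<diamondop> \<Phi>) x \<le> \<Phi> x" .
    qed measurable
    have "f x \<le> A * \<epsilon> * exp (- \<theta> * x) + D / \<epsilon> * env (x + z)" if x: "x \<ge> 0" for x
      using main[of x] unfolding Phi[OF x] using pos D e x z by (subst (asm) ennreal_le_iff) auto
    moreover have "(\<integral>\<^sup>+x. ennreal (env x) * indicator {z..} x \<partial>lborel) \<le> ennreal \<epsilon>"
      using tail s by (meson ennreal_leI order_trans)
    ultimately show ?thesis by (auto simp: z_def \<theta>_def)
  qed
  ultimately show ?thesis using pos D unfolding K_def by blast
qed

section \<open>Size biasing and the sharp asymptotics\<close>

text \<open>With \<open>a x = x * f x\<close> and \<open>k x = x * g x\<close>, the product rule turns the equation for \<open>f\<close> into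
  \<open>a = (1 - \<epsilon>) (\<epsilon> k + k \<diamondop> f + g \<diamondop> a)\<close>. Evaluating \<open>f \<diamondop> a\<close> once with this equation and once with the
  equation for \<open>f\<close>, and cancelling the common term, eliminates \<open>g \<diamondop> a\<close>. The function
  \<open>2 \<epsilon> f + f \<diamondop> f\<close> is the density of the sum of two independent workloads, which also has an atom
  \<open>\<epsilon>\<^sup>2\<close> at \<open>0\<close>.\<close>

lemma size_bias:
  assumes e: "0 < \<epsilon>" "\<epsilon> < 1" and w: "workload_density \<epsilon> f"
  defines "F \<equiv> \<lambda>x. ennreal (f x)" and "k \<equiv> \<lambda>x. ennreal (x * g x)"
  shows "ennreal (\<epsilon> * (x * f x)) = ennreal (1 - \<epsilon>) *
    (ennreal (\<epsilon>\<^sup>2) * k x + (k \<diamondop> (\<lambda>y. ennreal (2 * \<epsilon>) * F y + (F \<diamondop> F) y)) x)"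
proof -
  from w obtain b where [measurable]: "f \<in> borel_measurable borel"
      and F: "F = (\<lambda>x. ennreal ((1 - \<epsilon>) * \<epsilon>) * G x + ennreal (1 - \<epsilon>) * (G \<diamondop> F) x)"
      and b: "\<And>x. f x \<le> b" and fnn: "\<And>x. 0 \<le> f x" and fneg: "\<And>x. x < 0 \<Longrightarrow> f x = 0"
      and mass: "(\<integral>\<^sup>+x. F x \<partial>lborel) = ennreal (1 - \<epsilon>)"
    by (auto simp: workload_density_def F_def)
  have [measurable]: "F \<in> borel_measurable borel" "k \<in> borel_measurable borel"
    unfolding F_def k_def by measurable
  define r where "r = ennreal (1 - \<epsilon>)"
  define e' where "e' = ennreal \<epsilon>"
  have F': "F = (\<lambda>x. r * e' * G x + r * (G \<diamondop> F) x)"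
    using F e by (simp add: r_def e'_def ennreal_mult)
  define a where "a = (\<lambda>x. ennreal (x * f x))"
  have [measurable]: "a \<in> borel_measurable borel" unfolding a_def by measurable
  have aF: "a x = ennreal x * F x" for x
    using fneg[of x] fnn[of x] by (cases "x < 0") (auto simp: a_def F_def ennreal_mult)
  have kG: "k x = ennreal x * G x" for x
    using g_neg[of x] by (cases "x < 0") (auto simp: k_def ennreal_mult)
  have leibniz: "ennreal x * (G \<diamondop> F) x = (k \<diamondop> F) x + (G \<diamondop> a) x" for x
  proof -
    have "ennreal x * (G \<diamondop> F) x = (\<integral>\<^sup>+y. ennreal x * (G (x - y) * F y) \<partial>lborel)"
      unfolding conv_def by (rule nn_integral_cmult[symmetric]) measurable
    also have "\<dots> = (\<integral>\<^sup>+y. k (x - y) * F y + G (x - y) * a y \<partial>lborel)"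
    proof (rule nn_integral_cong)
      fix y
      show "ennreal x * (G (x - y) * F y) = k (x - y) * F y + G (x - y) * a y"
      proof (cases "0 \<le> y \<and> y \<le> x")
        case True
        then have "ennreal x = ennreal (x - y) + ennreal y" by (simp add: ennreal_plus[symmetric] del: ennreal_plus)
        then show ?thesis by (simp add: kG aF distrib_right distrib_left mult_ac)
      next
        case False
        then show ?thesis using g_neg[of "x - y"] fneg[of y] by (auto simp: kG aF F_def)
      qed
    qed
    also have "\<dots> = (k \<diamondop> F) x + (G \<diamondop> a) x" unfolding conv_def by (rule nn_integral_add) measurable
    finally show ?thesis .
  qed
  have a_eq: "a = (\<lambda>x. r * e' * k x + (r * (k \<diamondop> F) x + r * (G \<diamondop> a) x))"
  proof
    fix x
    have "a x = ennreal x * (r * e' * G x + r * (G \<diamondop> F) x)" unfolding aF by (subst F') simp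
    also have "\<dots> = r * e' * k x + r * (ennreal x * (G \<diamondop> F) x)" unfolding kG by (simp add: distrib_left mult_ac)
    finally show "a x = r * e' * k x + (r * (k \<diamondop> F) x + r * (G \<diamondop> a) x)" unfolding leibniz by (simp add: distrib_left)
  qed
  have one: "(F \<diamondop> a) x = r * e' * (F \<diamondop> k) x + (r * (F \<diamondop> (k \<diamondop> F)) x + r * (F \<diamondop> (G \<diamondop> a)) x)"
  proof -
    have "(F \<diamondop> a) x = (F \<diamondop> (\<lambda>x. r * e' * k x + (r * (k \<diamondop> F) x + r * (G \<diamondop> a) x))) x" using a_eq by simp
    also have "\<dots> = r * e' * (F \<diamondop> k) x + (r * (F \<diamondop> (k \<diamondop> F)) x + r * (F \<diamondop> (G \<diamondop> a)) x)"
      by (simp add: conv_add_right conv_cmult_right)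
    finally show ?thesis .
  qed
  have two: "(F \<diamondop> a) x = r * e' * (G \<diamondop> a) x + r * (F \<diamondop> (G \<diamondop> a)) x"
  proof -
    have "(F \<diamondop> a) x = (a \<diamondop> F) x" by (subst conv_commute) auto
    also have "\<dots> = (a \<diamondop> (\<lambda>x. r * e' * G x + r * (G \<diamondop> F) x)) x" using F' by simp
    also have "\<dots> = r * e' * (a \<diamondop> G) x + r * (a \<diamondop> (G \<diamondop> F)) x"
      by (simp add: conv_add_right conv_cmult_right)
    also have "a \<diamondop> G = G \<diamondop> a" by (rule conv_commute) auto
    also have "a \<diamondop> (G \<diamondop> F) = F \<diamondop> (G \<diamondop> a)"
    proof -
      have "a \<diamondop> (G \<diamondop> F) = (a \<diamondop> G) \<diamondop> F" by (rule conv_assoc[symmetric]) auto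
      also have "a \<diamondop> G = G \<diamondop> a" by (rule conv_commute) auto
      also have "(G \<diamondop> a) \<diamondop> F = F \<diamondop> (G \<diamondop> a)" by (rule conv_commute) auto
      finally show ?thesis .
    qed
    finally show ?thesis .
  qed
  have fin: "(F \<diamondop> a) x \<noteq> \<top>"
  proof -
    have bnn: "b \<ge> 0" using b[of 0] fnn[of 0] by simp
    have "(F \<diamondop> a) x = (a \<diamondop> F) x" by (subst conv_commute) auto
    also have "\<dots> \<le> (\<integral>\<^sup>+y. ennreal (\<bar>x\<bar> * b) * F y \<partial>lborel)"
      unfolding conv_def
    proof (rule nn_integral_mono)
      fix y show "a (x - y) * F y \<le> ennreal (\<bar>x\<bar> * b) * F y"
      proof (cases "y < 0")
        case False
        have "(x - y) * f (x - y) \<le> \<bar>x\<bar> * b"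
        proof (cases "x - y < 0")
          case False
          then show ?thesis using \<open>\<not> y < 0\<close> b[of "x - y"] fnn[of "x - y"] by (intro mult_mono) auto
        qed (use bnn fneg in simp)
        then show ?thesis unfolding a_def by (intro mult_right_mono ennreal_leI) auto
      qed (simp add: F_def fneg)
    qed
    also have "\<dots> = ennreal (\<bar>x\<bar> * b) * ennreal (1 - \<epsilon>)" by (simp add: nn_integral_cmult mass)
    finally show ?thesis by (auto simp: top_unique ennreal_mult_eq_top_iff)
  qed
  then have "r * (F \<diamondop> (G \<diamondop> a)) x \<noteq> \<top>" using two by auto
  then have canc: "r * e' * (G \<diamondop> a) x = r * e' * (F \<diamondop> k) x + r * (F \<diamondop> (k \<diamondop> F)) x"
  proof -
    have "r * (F \<diamondop> (G \<diamondop> a)) x + r * e' * (G \<diamondop> a) x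
        = r * (F \<diamondop> (G \<diamondop> a)) x + (r * e' * (F \<diamondop> k) x + r * (F \<diamondop> (k \<diamondop> F)) x)"
      using one[unfolded two] by (simp only: ac_simps)
    with \<open>r * (F \<diamondop> (G \<diamondop> a)) x \<noteq> \<top>\<close> show ?thesis by (simp only: ennreal_add_left_cancel) auto
  qed
  have Fk: "F \<diamondop> k = k \<diamondop> F" by (rule conv_commute) auto
  have FkF: "F \<diamondop> (k \<diamondop> F) = k \<diamondop> (F \<diamondop> F)"
  proof -
    have "F \<diamondop> (k \<diamondop> F) = (k \<diamondop> F) \<diamondop> F" by (rule conv_commute) auto
    also have "\<dots> = k \<diamondop> (F \<diamondop> F)" by (rule conv_assoc) auto
    finally show ?thesis .
  qed
  have "ennreal (\<epsilon> * (x * f x)) = e' * a x" using e by (simp add: e'_def a_def ennreal_mult')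
  also have "\<dots> = e' * (r * e' * k x + (r * (k \<diamondop> F) x + r * (G \<diamondop> a) x))" using a_eq by metis
  also have "\<dots> = r * e'\<^sup>2 * k x + r * e' * (k \<diamondop> F) x + r * e' * (G \<diamondop> a) x"
    by (simp add: distrib_left mult_ac power2_eq_square add.assoc)
  also have "\<dots> = r * (e'\<^sup>2 * k x + (ennreal 2 * e' * (k \<diamondop> F) x + (k \<diamondop> (F \<diamondop> F)) x))"
    unfolding canc Fk FkF by (simp add: distrib_left mult_ac mult_2[symmetric] add.assoc)
  also have "ennreal 2 * e' * (k \<diamondop> F) x + (k \<diamondop> (F \<diamondop> F)) x = (k \<diamondop> (\<lambda>y. ennreal (2 * \<epsilon>) * F y + (F \<diamondop> F) y)) x"
    using e by (simp add: conv_add_right conv_cmult_right ennreal_mult e'_def)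
  finally show ?thesis using e by (simp add: r_def e'_def ennreal_power)
qed

text \<open>The sum of two independent workloads obeys a bound of the same shape as \<open>crude_bound\<close>. The
  convolution of two exponentials of rate \<open>\<theta>\<close> carries an extra factor \<open>x\<close>, absorbed by passing to a
  slightly smaller rate; in every product that contains an envelope, one envelope factor is evaluated
  near \<open>x\<close> and the other factor is integrated out.\<close>

lemma pair_density_bound:
  assumes c: "0 < c" "c < 1"
  shows "\<exists>C>0. \<exists>x0>0. \<exists>e0>0. \<forall>\<epsilon> f y. 0 < \<epsilon> \<and> \<epsilon> < e0 \<and> \<epsilon> < 1 \<and> workload_density \<epsilon> f \<and> y \<ge> x0 \<longrightarrow>
     ennreal (2 * \<epsilon>) * ennreal (f y) + ((\<lambda>x. ennreal (f x)) \<diamondop> (\<lambda>x. ennreal (f x))) y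
       \<le> ennreal (C * (\<epsilon> * exp (- (c * \<epsilon> / \<mu>) * y) + g y / \<epsilon>))"
proof -
  define d where "d = (1 + c) / 2"
  have d: "0 < d" "d < 1" "c < d" using c by (auto simp: d_def)
  let ?crude = "\<lambda>A D \<epsilon> f. (\<integral>\<^sup>+x. ennreal (env x) * indicator {2 ^ (p + 3) * \<mu> / d / \<epsilon>..} x \<partial>lborel) \<le> ennreal \<epsilon> \<and>
     (\<forall>x\<ge>0. f x \<le> A * \<epsilon> * exp (- (d * \<epsilon> / \<mu>) * x) + D / \<epsilon> * env (x + 2 ^ (p + 3) * \<mu> / d / \<epsilon>))"
  from crude_bound[OF d(1,2)] obtain A D e0 where AD: "A > 0" "D > 0" "e0 > 0" and
    crude': "\<forall>\<epsilon> f. 0 < \<epsilon> \<and> \<epsilon> < e0 \<and> \<epsilon> < 1 \<and> workload_density \<epsilon> f \<longrightarrow> ?crude A D \<epsilon> f"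
    by (elim exE conjE) (rule that)
  have crude: "?crude A D \<epsilon> f" if "0 < \<epsilon>" "\<epsilon> < e0" "\<epsilon> < 1" "workload_density \<epsilon> f" for \<epsilon> f
    using crude' that by simp
  obtain Ce x0 where Ce: "Ce \<ge> 1" "x0 > 0" "\<And>x. x \<ge> x0 \<Longrightarrow> env x \<le> Ce * g x" using env_le by blast
  define Cp where "Cp = (2 * real p) ^ p"
  have Cp: "Cp > 0" using p_gt by (simp add: Cp_def)
  define C1 where "C1 = 2 * A + A\<^sup>2 * (\<mu> / (d - c))"
  define C2 where "C2 = 2 * D + (A * D * Cp * 4 * \<mu> / d + D\<^sup>2 * 2 ^ p * 2)"
  have C12: "C1 > 0" "C2 > 0" using AD d mu_pos Cp by (auto simp: C1_def C2_def intro!: add_pos_pos mult_pos_pos)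
  define C where "C = max C1 (C2 * Ce)"
  have "ennreal (2 * \<epsilon>) * ennreal (f x) + ((\<lambda>x. ennreal (f x)) \<diamondop> (\<lambda>x. ennreal (f x))) x
       \<le> ennreal (C * (\<epsilon> * exp (- (c * \<epsilon> / \<mu>) * x) + g x / \<epsilon>))"
    if e: "0 < \<epsilon>" "\<epsilon> < e0" "\<epsilon> < 1" and w: "workload_density \<epsilon> f" and x0: "x \<ge> x0" for \<epsilon> f x
  proof -
    define z where "z = 2 ^ (p + 3) * \<mu> / d / \<epsilon>"
    define \<theta> where "\<theta> = d * \<epsilon> / \<mu>"
    have th: "\<theta> > 0" using d e mu_pos by (simp add: \<theta>_def)
    have thz: "1 / \<theta> \<le> z" using d e mu_pos one_le_power[of "2::real" "p + 3"]
      by (simp add: \<theta>_def z_def field_simps)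
    have z: "z > 0" using th thz by (meson less_le_trans zero_less_divide_1_iff)
    have x: "x > 0" using x0 Ce by simp
    have tail: "(\<integral>\<^sup>+x. ennreal (env x) * indicator {z..} x \<partial>lborel) \<le> ennreal \<epsilon>"
      and fb: "\<And>y. y \<ge> 0 \<Longrightarrow> f y \<le> A * \<epsilon> * exp (- \<theta> * y) + D / \<epsilon> * env (y + z)"
      using crude[OF e w] by (auto simp: z_def \<theta>_def)
    have fnn: "\<And>y. 0 \<le> f y" and fneg: "\<And>y. y < 0 \<Longrightarrow> f y = 0" and [measurable]: "f \<in> borel_measurable borel"
      using w by (auto simp: workload_density_def)
    let ?v = "env (x + z)" and ?ex = "exp (- \<theta> * x)"
    let ?X = "\<lambda>y. ennreal (exp (- (\<theta> / 2) * (x - y))) * indicator {..x} y"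
    let ?T = "\<lambda>y. ennreal (env y) * indicator {z..} y"
    have v: "?v \<ge> 0" using x z by simp
    have "((\<lambda>x. ennreal (f x)) \<diamondop> (\<lambda>x. ennreal (f x))) x
      \<le> (\<integral>\<^sup>+y. ennreal (A\<^sup>2 * \<epsilon>\<^sup>2 * ?ex) * indicator {0..x} y
          + ennreal (A * D * Cp * ?v) * (?X y + ?X (x - y))
          + ennreal ((D / \<epsilon>)\<^sup>2 * 2 ^ p * ?v) * (?T (z + y) + ?T (x + z - y)) \<partial>lborel)"
      unfolding conv_def
    proof (rule nn_integral_mono)
      fix y
      show "ennreal (f (x - y)) * ennreal (f y) \<le> ennreal (A\<^sup>2 * \<epsilon>\<^sup>2 * ?ex) * indicator {0..x} y
          + ennreal (A * D * Cp * ?v) * (?X y + ?X (x - y))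
          + ennreal ((D / \<epsilon>)\<^sup>2 * 2 ^ p * ?v) * (?T (z + y) + ?T (x + z - y))" (is "?l \<le> ?r")
      proof (cases "0 \<le> y \<and> y \<le> x")
        case True
        then have y: "0 \<le> y" "y \<le> x" by auto
        let ?a = "\<lambda>y. A * \<epsilon> * exp (- \<theta> * y)" and ?b = "\<lambda>y. D / \<epsilon> * env (y + z)"
        have r: "?r = ennreal (A\<^sup>2 * \<epsilon>\<^sup>2 * ?ex + A * D * Cp * ?v * (exp (- (\<theta> / 2) * (x - y)) + exp (- (\<theta> / 2) * y))
            + (D / \<epsilon>)\<^sup>2 * 2 ^ p * ?v * (env (y + z) + env (x - y + z)))"
          using y AD e Cp v z by (simp add: ennreal_mult[symmetric] ennreal_plus[symmetric] algebra_simps del: ennreal_plus)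
        have ab: "?a (x - u) * ?b u \<le> A * D * Cp * ?v * exp (- (\<theta> / 2) * (x - u))" if "0 \<le> u" "u \<le> x" for u
        proof -
          have "env (u + z) \<le> Cp * exp (\<theta> / 2 * (x - u)) * ?v"
            using env_growth[OF th, of "u + z" "x + z"] thz that by (simp add: Cp_def)
          then have "?a (x - u) * ?b u \<le> ?a (x - u) * (D / \<epsilon> * (Cp * exp (\<theta> / 2 * (x - u)) * ?v))"
            using AD e by (intro mult_left_mono) auto
          also have "\<dots> = A * D * Cp * ?v * (exp (- \<theta> * (x - u)) * exp (\<theta> / 2 * (x - u)))" using e by simp
          also have "exp (- \<theta> * (x - u)) * exp (\<theta> / 2 * (x - u)) = exp (- (\<theta> / 2) * (x - u))"
            by (simp add: exp_add[symmetric] algebra_simps)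
          finally show ?thesis .
        qed
        have half: "env (u + z) \<le> 2 ^ p * ?v" if "x \<le> 2 * u" "u \<le> x" for u
        proof -
          have "env (u + z) \<le> ((x + z) / (u + z)) ^ p * ?v" using that x z by (intro env_scale) auto
          also have "\<dots> \<le> 2 ^ p * ?v" using that x z by (intro mult_right_mono power_mono) (auto simp: field_simps)
          finally show ?thesis .
        qed
        have bb: "?b (x - y) * ?b y \<le> (D / \<epsilon>)\<^sup>2 * 2 ^ p * ?v * (env (y + z) + env (x - y + z))"
        proof -
          have "env (x - y + z) * env (y + z) \<le> 2 ^ p * ?v * (env (y + z) + env (x - y + z))"
          proof (cases "x \<le> 2 * y")
            case True
            have "env (x - y + z) * env (y + z) \<le> env (x - y + z) * (2 ^ p * ?v)"
              using half[OF True y(2)] y z by (intro mult_left_mono) auto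
            also have "\<dots> \<le> 2 ^ p * ?v * (env (y + z) + env (x - y + z))" using y z v by (simp add: algebra_simps)
            finally show ?thesis .
          next
            case False
            have "env (x - y + z) * env (y + z) \<le> (2 ^ p * ?v) * env (y + z)"
              using half[of "x - y"] False y z by (intro mult_right_mono) auto
            also have "\<dots> \<le> 2 ^ p * ?v * (env (y + z) + env (x - y + z))" using y z v by (simp add: algebra_simps)
            finally show ?thesis .
          qed
          then have "(D / \<epsilon>)\<^sup>2 * (env (x - y + z) * env (y + z)) \<le> (D / \<epsilon>)\<^sup>2 * (2 ^ p * ?v * (env (y + z) + env (x - y + z)))"
            by (intro mult_left_mono) auto
          then show ?thesis by (simp add: power2_eq_square mult_ac)
        qed
        have aa: "?a (x - y) * ?a y = A\<^sup>2 * \<epsilon>\<^sup>2 * ?ex"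
          by (simp add: power2_eq_square exp_add[symmetric] algebra_simps)
        have "f (x - y) * f y \<le> (?a (x - y) + ?b (x - y)) * (?a y + ?b y)"
          using fb[of y] fb[of "x - y"] y fnn AD e z by (intro mult_mono) auto
        also have "\<dots> = ?a (x - y) * ?a y + ?a (x - y) * ?b y + ?a (x - (x - y)) * ?b (x - y) + ?b (x - y) * ?b y"
          by (simp add: algebra_simps)
        also have "\<dots> \<le> A\<^sup>2 * \<epsilon>\<^sup>2 * ?ex + A * D * Cp * ?v * exp (- (\<theta> / 2) * (x - y))
          + A * D * Cp * ?v * exp (- (\<theta> / 2) * (x - (x - y)))
          + (D / \<epsilon>)\<^sup>2 * 2 ^ p * ?v * (env (y + z) + env (x - y + z))"
          by (rule add_mono[OF add_mono[OF add_mono[OF eq_refl[OF aa] ab] ab] bb]) (use y in auto)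
        finally show ?thesis unfolding r using fnn
          by (simp add: ennreal_mult[symmetric] ennreal_leI distrib_left add.assoc)
      next
        case False
        then show ?thesis using fneg[of y] fneg[of "x - y"] by auto
      qed
    qed
    also have "\<dots> = ennreal (A\<^sup>2 * \<epsilon>\<^sup>2 * ?ex) * (\<integral>\<^sup>+y. indicator {0..x} y \<partial>lborel)
        + ennreal (A * D * Cp * ?v) * ((\<integral>\<^sup>+y. ?X y \<partial>lborel) + (\<integral>\<^sup>+y. ?X (x - y) \<partial>lborel))
        + ennreal ((D / \<epsilon>)\<^sup>2 * 2 ^ p * ?v) * ((\<integral>\<^sup>+y. ?T (z + y) \<partial>lborel) + (\<integral>\<^sup>+y. ?T (x + z - y) \<partial>lborel))"
      by (subst nn_integral_add, measurable, subst nn_integral_add, measurable)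
         (simp add: nn_integral_cmult nn_integral_add)
    also have "(\<integral>\<^sup>+y. ?X (x - y) \<partial>lborel) = (\<integral>\<^sup>+y. ?X y \<partial>lborel)"
      by (rule nn_integral_reflect) measurable
    also have "(\<integral>\<^sup>+y. ?T (x + z - y) \<partial>lborel) = (\<integral>\<^sup>+y. ?T y \<partial>lborel)"
      by (rule nn_integral_reflect) measurable
    also have "(\<integral>\<^sup>+y. ?T (z + y) \<partial>lborel) = (\<integral>\<^sup>+y. ?T y \<partial>lborel)"
      by (rule nn_integral_shift) measurable
    also have "(\<integral>\<^sup>+y. ?X y \<partial>lborel) = ennreal (1 / (\<theta> / 2))"
      by (rule nn_integral_exp_ray) (use th in simp)
    also have "(\<integral>\<^sup>+y. indicator {0..x} y \<partial>lborel) = ennreal x" using x by simp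
    also have "ennreal (A\<^sup>2 * \<epsilon>\<^sup>2 * ?ex) * ennreal x
        + ennreal (A * D * Cp * ?v) * (ennreal (1 / (\<theta> / 2)) + ennreal (1 / (\<theta> / 2)))
        + ennreal ((D / \<epsilon>)\<^sup>2 * 2 ^ p * ?v) * ((\<integral>\<^sup>+y. ?T y \<partial>lborel) + (\<integral>\<^sup>+y. ?T y \<partial>lborel))
      \<le> ennreal (A\<^sup>2 * \<epsilon>\<^sup>2 * ?ex) * ennreal x
        + ennreal (A * D * Cp * ?v) * (ennreal (1 / (\<theta> / 2)) + ennreal (1 / (\<theta> / 2)))
        + ennreal ((D / \<epsilon>)\<^sup>2 * 2 ^ p * ?v) * (ennreal \<epsilon> + ennreal \<epsilon>)"
      by (intro add_mono order_refl mult_left_mono tail) auto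
    also have "\<dots> = ennreal (A\<^sup>2 * \<epsilon>\<^sup>2 * ?ex * x + A * D * Cp * ?v * (4 / \<theta>) + (D / \<epsilon>)\<^sup>2 * 2 ^ p * ?v * (2 * \<epsilon>))"
      using AD e Cp v th x by (simp add: ennreal_mult[symmetric] ennreal_plus[symmetric] del: ennreal_plus)
    finally have FF: "((\<lambda>x. ennreal (f x)) \<diamondop> (\<lambda>x. ennreal (f x))) x \<le> \<dots>" .
    have "ennreal (2 * \<epsilon>) * ennreal (f x) \<le> ennreal (2 * \<epsilon> * (A * \<epsilon> * ?ex + D / \<epsilon> * ?v))"
      using e fb[of x] x fnn by (simp add: ennreal_mult[symmetric] ennreal_leI)
    then have "ennreal (2 * \<epsilon>) * ennreal (f x) + ((\<lambda>x. ennreal (f x)) \<diamondop> (\<lambda>x. ennreal (f x))) x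
      \<le> ennreal (2 * \<epsilon> * (A * \<epsilon> * ?ex + D / \<epsilon> * ?v))
       + ennreal (A\<^sup>2 * \<epsilon>\<^sup>2 * ?ex * x + A * D * Cp * ?v * (4 / \<theta>) + (D / \<epsilon>)\<^sup>2 * 2 ^ p * ?v * (2 * \<epsilon>))"
      by (intro add_mono FF)
    also have "\<dots> = ennreal (2 * \<epsilon> * (A * \<epsilon> * ?ex + D / \<epsilon> * ?v)
       + (A\<^sup>2 * \<epsilon>\<^sup>2 * ?ex * x + A * D * Cp * ?v * (4 / \<theta>) + (D / \<epsilon>)\<^sup>2 * 2 ^ p * ?v * (2 * \<epsilon>)))"
      using AD e Cp v th x by (intro ennreal_plus[symmetric]) (auto intro!: add_nonneg_nonneg)
    also have "\<dots> \<le> ennreal (C * (\<epsilon> * exp (- (c * \<epsilon> / \<mu>) * x) + g x / \<epsilon>))"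
    proof (rule ennreal_leI)
      let ?ec = "exp (- (c * \<epsilon> / \<mu>) * x)"
      let ?t = "(d - c) * \<epsilon> / \<mu>"
      have t: "?t > 0" using d e mu_pos by simp
      have split: "?ex = ?ec * exp (- (?t * x))" 
        using mu_pos by (simp add: \<theta>_def exp_add[symmetric] field_simps)
      have "exp (- (?t * x)) \<le> exp 0" using mult_pos_pos[OF t x] by (simp only: exp_le_cancel_iff)
      then have ex1: "?ex \<le> ?ec" unfolding split by (intro mult_left_le) simp_all
      have ex2: "?ex * x * \<epsilon> \<le> ?ec * (\<mu> / (d - c))"
      proof -
        have "exp (- (?t * x)) * (?t * x) \<le> 1" by (rule exp_minus_mult_le)
        then have "exp (- (?t * x)) * x * \<epsilon> \<le> \<mu> / (d - c)" using d mu_pos by (simp add: field_simps)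
        then have "?ec * (exp (- (?t * x)) * x * \<epsilon>) \<le> ?ec * (\<mu> / (d - c))" by (intro mult_left_mono) auto
        then show ?thesis unfolding split by (simp add: mult_ac)
      qed
      have v2: "?v \<le> Ce * g x" using Ce(3)[of "x + z"] g_anti[of x "x + z"] x z x0 Ce(1)
        by (smt (verit) mult_left_mono)
      have "2 * \<epsilon> * (A * \<epsilon> * ?ex) \<le> 2 * \<epsilon> * A * ?ec * 1"
      proof -
        have "2 * \<epsilon> * A * (\<epsilon> * ?ex) \<le> 2 * \<epsilon> * A * (1 * ?ec)" using e AD ex1 by (intro mult_left_mono mult_mono) auto
        then show ?thesis by (simp add: mult_ac)
      qed
      moreover have "A\<^sup>2 * \<epsilon>\<^sup>2 * ?ex * x \<le> A\<^sup>2 * \<epsilon> * (?ec * (\<mu> / (d - c)))"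
      proof -
        have "A\<^sup>2 * \<epsilon> * (?ex * x * \<epsilon>) \<le> A\<^sup>2 * \<epsilon> * (?ec * (\<mu> / (d - c)))" using e ex2 by (intro mult_left_mono) auto
        then show ?thesis by (simp add: mult_ac power2_eq_square)
      qed
      moreover have "2 * \<epsilon> * (D / \<epsilon> * ?v) \<le> 2 * D * ?v / \<epsilon>"
      proof -
        have "2 * D * ?v * 1 \<le> 2 * D * ?v * (1 / \<epsilon>)" using e AD v by (intro mult_left_mono) auto
        then show ?thesis using e by simp
      qed
      moreover have "A * D * Cp * ?v * (4 / \<theta>) = A * D * Cp * 4 * \<mu> / d * ?v / \<epsilon>"
        using e by (simp add: \<theta>_def)
      moreover have "(D / \<epsilon>)\<^sup>2 * 2 ^ p * ?v * (2 * \<epsilon>) = D\<^sup>2 * 2 ^ p * 2 * ?v / \<epsilon>"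
        using e by (simp add: power2_eq_square)
      ultimately have "2 * \<epsilon> * (A * \<epsilon> * ?ex + D / \<epsilon> * ?v)
       + (A\<^sup>2 * \<epsilon>\<^sup>2 * ?ex * x + A * D * Cp * ?v * (4 / \<theta>) + (D / \<epsilon>)\<^sup>2 * 2 ^ p * ?v * (2 * \<epsilon>))
        \<le> C1 * (\<epsilon> * ?ec) + C2 * (?v / \<epsilon>)"
        by (simp add: C1_def C2_def algebra_simps add_divide_distrib)
      also have "\<dots> \<le> C1 * (\<epsilon> * ?ec) + C2 * (Ce * g x / \<epsilon>)"
        using v2 C12 e by (intro add_mono order_refl mult_left_mono divide_right_mono) auto
      also have "\<dots> \<le> C * (\<epsilon> * ?ec) + C * (g x / \<epsilon>)"
      proof -
        have "C1 * (\<epsilon> * ?ec) \<le> C * (\<epsilon> * ?ec)" using e by (intro mult_right_mono) (auto simp: C_def)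
        moreover have "C2 * Ce * (g x / \<epsilon>) \<le> C * (g x / \<epsilon>)" using e by (intro mult_right_mono) (auto simp: C_def)
        ultimately show ?thesis by simp
      qed
      finally show "2 * \<epsilon> * (A * \<epsilon> * ?ex + D / \<epsilon> * ?v)
       + (A\<^sup>2 * \<epsilon>\<^sup>2 * ?ex * x + A * D * Cp * ?v * (4 / \<theta>) + (D / \<epsilon>)\<^sup>2 * 2 ^ p * ?v * (2 * \<epsilon>))
        \<le> C * (\<epsilon> * ?ec + g x / \<epsilon>)" by (simp add: distrib_left)
    qed
    finally show ?thesis .
  qed
  moreover have "C > 0" using C12 by (simp add: C_def)
  ultimately show ?thesis using AD(3) Ce(2) by blast
qed

text \<open>The same splitting as in \<open>exp_conv\<close>, but restricted to \<open>y > b * x\<close>. A big jump has size at most \<open>(1 - b) x\<close>,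
  so its term keeps the additional factor \<open>exp (- \<theta> * b * x)\<close>.\<close>

lemma k_exp_conv:
  assumes th: "\<theta> > 0" and x: "x > 0" and b: "0 < b" "b < 1"
  shows "(\<integral>\<^sup>+y. ennreal ((x - y) * g (x - y)) * (ennreal (exp (- \<theta> * y)) * indicator {b * x<..} y) \<partial>lborel)
    \<le> ennreal (exp 1 * exp (- \<theta> * x) * \<mu> + x * (2 * real p) ^ p * env ((1 - b) * x) * exp (- \<theta> * b * x) * (2 / \<theta>))"
proof -
  define X where "X = (1 - b) * x"
  have X: "X > 0" using b x by (simp add: X_def)
  let ?k = "\<lambda>t. ennreal (t * g t)"
  let ?C = "x * (2 * real p) ^ p * env X * exp (- \<theta> * b * x)"
  let ?R = "\<lambda>t. ennreal (exp 1 * exp (- \<theta> * x)) * ?k t + ennreal ?C * (ennreal (exp (- (\<theta> / 2) * (X - t))) * indicator {..X} t)"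
  have C: "?C \<ge> 0" using x X by simp
  have "(\<integral>\<^sup>+y. ?k (x - y) * (ennreal (exp (- \<theta> * y)) * indicator {b * x<..} y) \<partial>lborel)
    \<le> (\<integral>\<^sup>+y. ?R (x - y) \<partial>lborel)"
  proof (rule nn_integral_mono)
    fix y
    define t where "t = x - y"
    have y: "y = x - t" by (simp add: t_def)
    have "?k t * (ennreal (exp (- \<theta> * y)) * indicator {b * x<..} y) \<le> ?R t"
    proof (cases "0 \<le> t \<and> t < X")
      case True
      then have t: "0 \<le> t" "t \<le> X" by auto
      have tx: "t \<le> x" using t b x by (simp add: X_def) (smt (verit) mult_left_le_one_le mult.commute)
      have "t * g t * exp (- \<theta> * y) \<le> exp 1 * exp (- \<theta> * x) * (t * g t) + ?C * exp (- (\<theta> / 2) * (X - t))"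
      proof (cases "\<theta> * t \<le> 1")
        case True
        have "exp (- \<theta> * y) = exp (\<theta> * t) * exp (- \<theta> * x)" by (simp add: y exp_add[symmetric] algebra_simps)
        also have "\<dots> \<le> exp 1 * exp (- \<theta> * x)" using True by (intro mult_right_mono) auto
        finally have "t * g t * exp (- \<theta> * y) \<le> t * g t * (exp 1 * exp (- \<theta> * x))" using t by (intro mult_left_mono) auto
        then have "t * g t * exp (- \<theta> * y) \<le> exp 1 * exp (- \<theta> * x) * (t * g t)" by (simp add: mult_ac)
        moreover have "0 \<le> ?C * exp (- (\<theta> / 2) * (X - t))" using C by simp
        ultimately show ?thesis by linarith
      next
        case False
        then have t1: "1 / \<theta> \<le> t" using th by (simp add: field_simps)
        then have t0: "t > 0" using th by (meson less_le_trans zero_less_divide_1_iff)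
        have "g t \<le> (2 * real p) ^ p * exp (\<theta> / 2 * (X - t)) * env X"
          using g_le_env[OF t0] env_growth[OF th t1 t(2)] by simp
        then have "t * g t * exp (- \<theta> * y) \<le> x * ((2 * real p) ^ p * exp (\<theta> / 2 * (X - t)) * env X) * exp (- \<theta> * y)"
          using t tx by (intro mult_right_mono mult_mono) auto
        also have "\<dots> = x * (2 * real p) ^ p * env X * (exp (\<theta> / 2 * (X - t)) * exp (- \<theta> * y))" by simp
        also have "exp (\<theta> / 2 * (X - t)) * exp (- \<theta> * y) = exp (- \<theta> * b * x) * exp (- (\<theta> / 2) * (X - t))"
          unfolding exp_add[symmetric] y X_def by (simp add: algebra_simps)
        finally have "t * g t * exp (- \<theta> * y) \<le> ?C * exp (- (\<theta> / 2) * (X - t))" by (simp add: mult_ac)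
        moreover have "0 \<le> exp 1 * exp (- \<theta> * x) * (t * g t)" using t by simp
        ultimately show ?thesis by linarith
      qed
      then have "ennreal (t * g t * exp (- \<theta> * y)) \<le> ?R t"
        using t C by (simp add: ennreal_mult[symmetric] ennreal_plus[symmetric] ennreal_leI del: ennreal_plus)
      moreover have "?k t * (ennreal (exp (- \<theta> * y)) * indicator {b * x<..} y) \<le> ennreal (t * g t * exp (- \<theta> * y))"
        using t by (auto simp: indicator_def ennreal_mult[symmetric])
      ultimately show ?thesis by (rule order_trans[rotated])
    next
      case False
      then have "t < 0 \<or> y \<le> b * x" by (auto simp: y X_def algebra_simps)
      then show ?thesis using g_neg[of t] by auto
    qed
    then show "?k (x - y) * (ennreal (exp (- \<theta> * y)) * indicator {b * x<..} y) \<le> ?R (x - y)"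
      unfolding t_def .
  qed
  also have "\<dots> = (\<integral>\<^sup>+t. ?R t \<partial>lborel)" by (rule nn_integral_reflect) measurable
  also have "\<dots> = ennreal (exp 1 * exp (- \<theta> * x)) * (\<integral>\<^sup>+t. ?k t \<partial>lborel)
     + ennreal ?C * (\<integral>\<^sup>+t. ennreal (exp (- (\<theta> / 2) * (X - t))) * indicator {..X} t \<partial>lborel)"
    by (subst nn_integral_add) (auto simp: nn_integral_cmult)
  also have "\<dots> = ennreal (exp 1 * exp (- \<theta> * x)) * ennreal \<mu> + ennreal ?C * ennreal (1 / (\<theta> / 2))"
    using th by (subst nn_integral_exp_ray) (auto simp: g_mean)
  also have "\<dots> = ennreal (exp 1 * exp (- \<theta> * x) * \<mu> + ?C * (2 / \<theta>))"
    using C th mu_pos by (simp add: ennreal_mult[symmetric] ennreal_plus[symmetric] del: ennreal_plus)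
  finally show ?thesis by (simp add: X_def)
qed

text \<open>For large \<open>y\<close> the point \<open>y + T\<close> lies below \<open>a * y\<close> with \<open>a\<close> arbitrarily close to \<open>1\<close>.\<close>

lemma long_tail:
  assumes "\<delta> > 0"
  shows "\<exists>y0\<ge>0. \<forall>y\<ge>y0. g y \<le> (1 + \<delta>) * g (y + T)"
proof -
  \<comment> \<open>so that \<open>a powr \<alpha>\<close> is the square root of \<open>1 + \<delta>\<close>\<close>
  define a where "a = (1 + \<delta>) powr (1 / (2 * \<alpha>))"
  have a: "a > 1" using assms alpha_gt by (simp add: a_def)
  have "a powr (- \<alpha>) = (1 + \<delta>) powr (- 1 / 2)" using alpha_gt by (simp add: a_def powr_powr)
  also have "\<dots> > (1 + \<delta>) powr (- 1)" using assms by (intro powr_less_mono) auto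
  finally have "a powr (- \<alpha>) > 1 / (1 + \<delta>)" using assms by (simp add: powr_minus inverse_eq_divide)
  then have "eventually (\<lambda>y. g (a * y) / g y > 1 / (1 + \<delta>)) at_top"
    using g_rv[of a] a by (intro order_tendstoD(1)) auto
  then obtain y1 where y1: "\<And>y. y \<ge> y1 \<Longrightarrow> g (a * y) / g y > 1 / (1 + \<delta>)"
    unfolding eventually_at_top_linorder by blast
  define y0 where "y0 = max (max 0 y1) (max (- T) (T / (a - 1)))"
  have "g y \<le> (1 + \<delta>) * g (y + T)" if y: "y \<ge> y0" for y
  proof -
    have y': "y \<ge> 0" "y \<ge> y1" "y + T \<ge> 0" "T / (a - 1) \<le> y" using y by (auto simp: y0_def)
    then have "y + T \<le> a * y" using a by (simp add: field_simps)
    then have "g (a * y) \<le> g (y + T)" using y' by (intro g_anti) auto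
    moreover have "g y \<le> (1 + \<delta>) * g (a * y)" using y1[OF y'(2)] g_pos[OF y'(1)] assms by (simp add: field_simps)
    ultimately show ?thesis using assms by (meson order_trans mult_left_mono add_nonneg_nonneg less_imp_le zero_le_one)
  qed
  then show ?thesis by (intro exI[of _ y0]) (auto simp: y0_def)
qed

text \<open>Where the big jump beats the exponential. In terms of \<open>y = \<epsilon> * x \<ge> \<kappa> ln (1 / \<epsilon>)\<close> and the lower
  bound \<open>x powr (- q)\<close> for \<open>g\<close>, the claim compares \<open>y powr (q - 1) * exp (- \<nu> * y)\<close> with a multiple of
  \<open>\<epsilon> powr (q - 2)\<close>, and the left-hand side is at most about \<open>\<epsilon> powr (\<nu> * \<kappa>)\<close>.\<close>

lemma exp_negligible:
  assumes nu: "\<nu> > 0" and kap: "\<kappa> > 0" and q: "q > \<alpha>" and rate: "\<nu> * \<kappa> > q - 2" and eta: "\<eta> > 0"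
  shows "\<exists>e0>0. \<forall>\<epsilon> x. 0 < \<epsilon> \<and> \<epsilon> < e0 \<and> \<epsilon> < 1 \<and> x \<ge> \<kappa> / \<epsilon> * ln (1 / \<epsilon>) \<and> x \<ge> 1 / \<epsilon> \<longrightarrow>
    \<epsilon> * exp (- \<nu> * \<epsilon> * x) \<le> \<eta> * (x * g x)"
proof -
  define \<nu>2 where "\<nu>2 = (\<nu> + (q - 2) / \<kappa>) / 2"
  have nu2: "\<nu>2 < \<nu>" "\<nu>2 * \<kappa> > q - 2" "\<nu>2 > 0"
  proof -
    have "(q - 2) / \<kappa> < \<nu>" using rate kap by (simp add: divide_less_eq)
    moreover have "(q - 2) / \<kappa> > 0" using q alpha_gt kap by simp
    ultimately show "\<nu>2 < \<nu>" "\<nu>2 > 0" using nu by (auto simp: \<nu>2_def)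
    have "\<nu>2 * \<kappa> = (\<nu> * \<kappa> + (q - 2)) / 2" using kap by (simp add: \<nu>2_def field_simps)
    then show "\<nu>2 * \<kappa> > q - 2" using rate by simp
  qed
  define a b where "a = q - 1" and "b = \<nu> - \<nu>2"
  have ab: "a > 0" "b > 0" using q alpha_gt nu2 by (auto simp: a_def b_def)
  \<comment> \<open>the value that makes \<open>y powr a \<le> C * exp (b * y)\<close> follow from \<open>1 + t \<le> exp t\<close> at \<open>t = b * y / a\<close>\<close>
  define C where "C = (a / b) powr a"
  have C: "C > 0" using ab by (simp add: C_def)
  have powexp: "y powr a \<le> C * exp (b * y)" if "y > 0" for y
  proof -
    have "b * y / a \<le> exp (b * y / a)" using exp_ge_add_one_self[of "b * y / a"] by linarith
    then have "y \<le> a / b * exp (b * y / a)" using ab by (simp add: field_simps)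
    then have "y powr a \<le> (a / b * exp (b * y / a)) powr a" using that ab by (intro powr_mono2) auto
    also have "\<dots> = (a / b) powr a * exp (b * y / a) powr a" by (rule powr_mult)
    also have "\<dots> = C * exp (b * y)" using ab by (simp add: C_def exp_powr_real)
    finally show ?thesis .
  qed
  obtain x0 where x0: "x0 > 0" "\<And>y x. x0 \<le> y \<Longrightarrow> y \<le> x \<Longrightarrow> g y \<le> 2 powr q * (x / y) powr q * g x"
    using potter[OF q] by blast
  define c0 where "c0 = g x0 * x0 powr q / 2 powr q"
  have c0: "c0 > 0" using g_pos[of x0] x0 by (simp add: c0_def)
  have low: "c0 * x powr (- q) \<le> g x" if "x \<ge> x0" for x
    using x0(2)[OF order_refl that] x0(1) that
    by (simp add: c0_def powr_divide powr_minus field_simps)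
  define h where "h = \<nu>2 * \<kappa> - (q - 2)"
  have h: "h > 0" using nu2 by (simp add: h_def)
  define e0 where "e0 = min (1 / x0) ((\<eta> * c0 / C) powr (1 / h))"
  have "e0 > 0" using x0 eta c0 C by (simp add: e0_def)
  moreover have "\<epsilon> * exp (- \<nu> * \<epsilon> * x) \<le> \<eta> * (x * g x)"
    if e: "0 < \<epsilon>" "\<epsilon> < e0" "\<epsilon> < 1" and x: "x \<ge> \<kappa> / \<epsilon> * ln (1 / \<epsilon>)" "x \<ge> 1 / \<epsilon>" for \<epsilon> x
  proof -
    define y where "y = \<epsilon> * x"
    have "x0 \<le> 1 / \<epsilon>" using e x0 by (simp add: e0_def field_simps)
    then have xx0: "x \<ge> x0" using x by simp
    have xp: "x > 0" using xx0 x0 by simp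
    have y: "y > 0" "y \<ge> \<kappa> * ln (1 / \<epsilon>)" using e x xp by (auto simp: y_def field_simps)
    have "\<epsilon> powr h \<le> ((\<eta> * c0 / C) powr (1 / h)) powr h" using e h by (intro powr_mono2) (auto simp: e0_def)
    also have "\<dots> = \<eta> * c0 / C" using h eta c0 C by (simp add: powr_powr)
    finally have eh: "C * \<epsilon> powr h \<le> \<eta> * c0" using C by (simp add: field_simps)
    have "y powr a * exp (- \<nu> * y) \<le> C * exp (b * y) * exp (- \<nu> * y)" using powexp[OF y(1)] by (intro mult_right_mono) auto
    also have "\<dots> = C * exp (- \<nu>2 * y)" by (simp add: b_def exp_add[symmetric] algebra_simps)
    also have "\<dots> \<le> C * exp (- \<nu>2 * (\<kappa> * ln (1 / \<epsilon>)))" using C y nu2 by (intro mult_left_mono) auto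
    also have "exp (- \<nu>2 * (\<kappa> * ln (1 / \<epsilon>))) = \<epsilon> powr (\<nu>2 * \<kappa>)" using e by (simp add: powr_def ln_div)
    also have "C * \<epsilon> powr (\<nu>2 * \<kappa>) = C * \<epsilon> powr h * \<epsilon> powr (q - 2)" by (simp add: h_def powr_add[symmetric])
    also have "\<dots> \<le> \<eta> * c0 * \<epsilon> powr (q - 2)" using eh by (intro mult_right_mono) auto
    finally have main: "y powr a * exp (- \<nu> * y) \<le> \<eta> * c0 * \<epsilon> powr (q - 2)" .
    have "\<epsilon> * exp (- \<nu> * y) = \<epsilon> * y powr (- a) * (y powr a * exp (- \<nu> * y))"
      using y by (simp add: powr_minus)
    also have "\<dots> \<le> \<epsilon> * y powr (- a) * (\<eta> * c0 * \<epsilon> powr (q - 2))" using main e by (intro mult_left_mono) auto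
    also have "\<dots> = \<eta> * c0 * (y powr (- a) * (\<epsilon> powr 1 * \<epsilon> powr (q - 2)))" using e by simp
    also have "\<epsilon> powr 1 * \<epsilon> powr (q - 2) = \<epsilon> powr a" by (subst powr_add[symmetric]) (simp add: a_def)
    also have "y powr (- a) = \<epsilon> powr (- a) * x powr (- a)" using e xp by (simp add: y_def powr_mult)
    also have "\<epsilon> powr (- a) * x powr (- a) * \<epsilon> powr a = x powr (- a)" using e by (simp add: powr_minus)
    also have "x powr (- a) = x powr 1 * x powr (- q)" by (subst powr_add[symmetric]) (simp add: a_def)
    also have "\<eta> * c0 * (x powr 1 * x powr (- q)) = \<eta> * (x * (c0 * x powr (- q)))" using xp by simp
    also have "\<dots> \<le> \<eta> * (x * g x)" using eta xp low[OF xx0] by (intro mult_left_mono) auto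
    finally show ?thesis by (simp add: y_def mult_ac)
  qed
  ultimately show ?thesis by blast
qed

text \<open>In the size-bias identity the range \<open>y \<le> \<beta> * x\<close> gives the main term. The remaining range is \<open>y > \<beta> * x\<close>:
  its probability enters the lower estimate, and its contribution to the integral the upper one; both are
  bounded by \<open>pair_density_bound\<close>. Replacing the index \<open>\<alpha>\<close> by \<open>q > \<alpha>\<close>, which absorbs the slowly
  varying factor, and the full rate \<open>1 / \<mu>\<close> by \<open>c / \<mu>\<close> each use up one third of the gap
  \<open>\<kappa> / \<mu> - (\<alpha> - 2)\<close>; the last third keeps the inequality demanded by \<open>exp_negligible\<close> strict.\<close>
lemma density_asymptotics:
  assumes kap: "\<kappa> > \<mu> * (\<alpha> - 2)" and del: "\<delta> > 0"
  shows "\<exists>e0>0. \<forall>\<epsilon> f x. 0 < \<epsilon> \<and> \<epsilon> < e0 \<and> \<epsilon> < 1 \<and> workload_density \<epsilon> f \<and> x \<ge> \<kappa> / \<epsilon> * ln (1 / \<epsilon>)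
     \<longrightarrow> \<bar>\<epsilon> * f x / g x - 1\<bar> \<le> \<delta>"
proof -
  have kp: "\<kappa> > 0" using kap mu_pos alpha_gt by (smt (verit) mult_pos_pos)
  define \<Delta> where "\<Delta> = \<kappa> / \<mu> - (\<alpha> - 2)"
  have Del: "\<Delta> > 0" "\<Delta> < \<kappa> / \<mu>" using kap mu_pos alpha_gt by (auto simp: \<Delta>_def field_simps)
  define q where "q = \<alpha> + \<Delta> / 3"
  define c where "c = 1 - (\<Delta> / 3) / (\<kappa> / \<mu>)"
  have q: "q > \<alpha>" using Del by (simp add: q_def)
  have kmu: "\<kappa> / \<mu> > 0" using kp mu_pos by simp
  have "(\<Delta> / 3) / (\<kappa> / \<mu>) < 1" using Del by (subst divide_less_eq_1_pos[OF kmu]) linarith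
  moreover have "(\<Delta> / 3) / (\<kappa> / \<mu>) > 0" using Del kmu by (intro divide_pos_pos[of "\<Delta> / 3" "\<kappa> / \<mu>"]) auto
  ultimately have c: "0 < c" "c < 1" by (auto simp: c_def)
  define \<nu> where "\<nu> = c / \<mu>"
  have nu: "\<nu> > 0" using c mu_pos by (simp add: \<nu>_def)
  have rate: "\<nu> * \<kappa> > q - 2"
  proof -
    have "\<nu> * \<kappa> = c * (\<kappa> / \<mu>)" by (simp add: \<nu>_def)
    also have "\<dots> = \<kappa> / \<mu> - \<Delta> / 3" using kmu kp mu_pos by (simp add: c_def field_simps)
    also have "\<dots> > q - 2"
    proof -
      have "\<kappa> / \<mu> = \<Delta> + \<alpha> - 2" by (simp add: \<Delta>_def)
      then show ?thesis using Del(1) unfolding q_def by linarith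
    qed
    finally show ?thesis .
  qed
  define \<eta> where "\<eta> = min \<delta> 1 / 4"
  have eta: "\<eta> > 0" "\<eta> \<le> 1 / 4" "4 * \<eta> \<le> \<delta>" using del by (auto simp: \<eta>_def)
  \<comment> \<open>chosen so that \<open>(1 - \<beta>) powr (- \<alpha>)\<close> is the square root of \<open>1 + \<eta>\<close>, leaving room for the limit\<close>
  define \<beta> where "\<beta> = 1 - (1 + \<eta>) powr (- (1 / (2 * \<alpha>)))"
  have b1: "(1 - \<beta>) powr (- \<alpha>) = (1 + \<eta>) powr (1 / 2)"
    using eta alpha_gt by (simp add: \<beta>_def powr_powr)
  have b2: "0 < \<beta>" "\<beta> < 1" "\<beta> \<le> \<eta>"
  proof -
    have "(1 + \<eta>) powr (- (1 / (2 * \<alpha>))) < (1 + \<eta>) powr 0" using eta alpha_gt by (intro powr_less_mono) auto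
    then show "0 < \<beta>" using eta by (simp add: \<beta>_def)
    show "\<beta> < 1" using eta by (simp add: \<beta>_def)
    have "(1 + \<eta>) powr (- 1) \<le> (1 + \<eta>) powr (- (1 / (2 * \<alpha>)))" using eta alpha_gt by (intro powr_mono) auto
    moreover have "1 - \<eta> \<le> (1 + \<eta>) powr (- 1)" using eta by (simp add: powr_minus field_simps)
    ultimately show "\<beta> \<le> \<eta>" by (simp add: \<beta>_def)
  qed
  have "(1 + \<eta>) powr (1 / 2) < (1 + \<eta>) powr 1" using eta by (intro powr_less_mono) auto
  then have "(1 - \<beta>) powr (- \<alpha>) < 1 + \<eta>" using eta unfolding b1 by simp
  then have "eventually (\<lambda>x. g ((1 - \<beta>) * x) / g x < 1 + \<eta>) at_top"
    using g_rv[of "1 - \<beta>"] b2 by (intro order_tendstoD(2)) auto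
  then obtain xa where xa: "\<And>x. x \<ge> xa \<Longrightarrow> g ((1 - \<beta>) * x) / g x < 1 + \<eta>"
    unfolding eventually_at_top_linorder by blast
  define Cb where "Cb = \<beta> powr (- \<alpha>) + 1"
  have "eventually (\<lambda>x. g (\<beta> * x) / g x < Cb) at_top"
    using g_rv[of \<beta>] b2 by (intro order_tendstoD(2)) (auto simp: Cb_def)
  then obtain xb where xb: "\<And>x. x \<ge> xb \<Longrightarrow> g (\<beta> * x) / g x < Cb"
    unfolding eventually_at_top_linorder by blast
  have Cb: "Cb > 0" by (simp add: Cb_def add_nonneg_pos)
  obtain Ce xc where Ce: "Ce \<ge> 1" "xc > 0" "\<And>x. x \<ge> xc \<Longrightarrow> env x \<le> Ce * g x" using env_le by blast
  obtain C xp e1 where C: "C > 0" "xp > 0" "e1 > 0" and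
    pair: "\<And>\<epsilon> f y. 0 < \<epsilon> \<Longrightarrow> \<epsilon> < e1 \<Longrightarrow> \<epsilon> < 1 \<Longrightarrow> workload_density \<epsilon> f \<Longrightarrow> y \<ge> xp \<Longrightarrow>
     ennreal (2 * \<epsilon>) * ennreal (f y) + ((\<lambda>x. ennreal (f x)) \<diamondop> (\<lambda>x. ennreal (f x))) y
       \<le> ennreal (C * (\<epsilon> * exp (- (c * \<epsilon> / \<mu>) * y) + g y / \<epsilon>))"
    using pair_density_bound[OF c] by blast
  define \<eta>1 where "\<eta>1 = \<eta> / (3 * C * exp 1 * \<mu>)"
  have eta1: "\<eta>1 > 0" using eta C mu_pos by (simp add: \<eta>1_def)
  obtain e2 where e2: "e2 > 0" and negl: "\<And>\<epsilon> x. 0 < \<epsilon> \<Longrightarrow> \<epsilon> < e2 \<Longrightarrow> \<epsilon> < 1 \<Longrightarrow> x \<ge> \<kappa> / \<epsilon> * ln (1 / \<epsilon>) \<Longrightarrow> x \<ge> 1 / \<epsilon> \<Longrightarrow>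
    \<epsilon> * exp (- \<nu> * \<epsilon> * x) \<le> \<eta>1 * (x * g x)"
    using exp_negligible[OF nu kp q rate eta1] by blast
  define Cp where "Cp = (2 * real p) ^ p"
  have Cp: "Cp > 0" using p_gt by (simp add: Cp_def)
  define B where "B = 2 * C * Cp * \<mu> / c * Ce * 2"
  have B: "B > 0" using C Cp c Ce mu_pos by (simp add: B_def)
  \<comment> \<open>a lower bound for \<open>\<epsilon> * x\<close>, hence for \<open>x\<close>, beyond which every estimate below applies\<close>
  define Y where "Y = Max {1, xa, xb, xc / (1 - \<beta>), xp / \<beta>, 3 * C * Cb * \<mu> / \<eta>, 3 * B / (\<eta> * \<nu> * \<beta>),
     2 * (C * \<mu> / c) / (\<eta> * \<nu> * \<beta>), 2 * C * \<mu> / (\<eta> * \<beta>)}"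
  have Y: "1 \<le> Y" "xa \<le> Y" "xb \<le> Y" "xc / (1 - \<beta>) \<le> Y" "xp / \<beta> \<le> Y" "3 * C * Cb * \<mu> / \<eta> \<le> Y"
     "3 * B / (\<eta> * \<nu> * \<beta>) \<le> Y" "2 * (C * \<mu> / c) / (\<eta> * \<nu> * \<beta>) \<le> Y" "2 * C * \<mu> / (\<eta> * \<beta>) \<le> Y"
    unfolding Y_def by (rule Max_ge, simp only: finite.intros finite_insert, blast)+
  define e0 where "e0 = Min {e1, e2, \<eta>, exp (- Y / \<kappa>)}"
  have e0: "e0 > 0" "e0 \<le> e1" "e0 \<le> e2" "e0 \<le> \<eta>" "e0 \<le> exp (- Y / \<kappa>)"
    using C e2 eta by (auto simp: e0_def)
  have "\<bar>\<epsilon> * f x / g x - 1\<bar> \<le> \<delta>"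
    if e: "0 < \<epsilon>" "\<epsilon> < e0" "\<epsilon> < 1" and w: "workload_density \<epsilon> f" and x: "x \<ge> \<kappa> / \<epsilon> * ln (1 / \<epsilon>)" for \<epsilon> f x
  proof -
    have "ln \<epsilon> \<le> ln (exp (- Y / \<kappa>))" using e e0 by (subst ln_le_cancel_iff) auto
    then have "Y \<le> \<kappa> * ln (1 / \<epsilon>)" using kp e by (simp add: ln_div field_simps)
    also have "\<dots> \<le> \<epsilon> * x" using x e by (simp add: field_simps)
    finally have exY: "Y \<le> \<epsilon> * x" .
    then have x1: "1 / \<epsilon> \<le> x" using Y(1) e by (simp add: field_simps)
    have xp0: "x > 0" using x1 e by (meson less_le_trans zero_less_divide_1_iff)
    have "\<epsilon> * x \<le> 1 * x" using e xp0 by (intro mult_right_mono) auto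
    then have xY: "Y \<le> x" using exY by simp
    have gx: "g x > 0" using g_pos xp0 by simp
    have ga: "g ((1 - \<beta>) * x) \<le> (1 + \<eta>) * g x" using xa[of x] xY Y gx by (simp add: field_simps)
    have gb: "g (\<beta> * x) \<le> Cb * g x" using xb[of x] xY Y gx by (simp add: field_simps)
    have xcb: "xc \<le> (1 - \<beta>) * x" using order_trans[OF Y(4) xY] b2 by (simp add: pos_divide_le_eq mult.commute)
    have xpb: "xp \<le> \<beta> * x" using order_trans[OF Y(5) xY] b2 by (simp add: pos_divide_le_eq mult.commute)
    define \<theta> where "\<theta> = c * \<epsilon> / \<mu>"
    have th: "\<theta> > 0" using c e mu_pos by (simp add: \<theta>_def)
    have thx: "\<theta> * x = \<nu> * (\<epsilon> * x)" by (simp add: \<theta>_def \<nu>_def)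
    define F where "F = (\<lambda>x. ennreal (f x))"
    define S where "S = (\<lambda>y. ennreal (2 * \<epsilon>) * F y + (F \<diamondop> F) y)"
    let ?k = "\<lambda>x. ennreal (x * g x)"
    have [measurable]: "f \<in> borel_measurable borel" and fneg: "\<And>y. y < 0 \<Longrightarrow> f y = 0" and fnn: "\<And>y. 0 \<le> f y"
      and mass: "(\<integral>\<^sup>+x. F x \<partial>lborel) = ennreal (1 - \<epsilon>)"
      using w by (auto simp: workload_density_def F_def)
    have [measurable]: "F \<in> borel_measurable borel" unfolding F_def by measurable
    have [measurable]: "S \<in> borel_measurable borel" unfolding S_def by measurable
    have Sneg: "S y = 0" if "y < 0" for y
    proof -
      have "F (y - u) * F u = 0" for u
        using that fneg[of u] fneg[of "y - u"] by (cases "u < 0") (auto simp: F_def)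
      then have "(F \<diamondop> F) y = 0" unfolding conv_def by (simp only: nn_integral_const) simp
      then show ?thesis using that fneg[of y] by (simp add: S_def) (simp add: F_def)
    qed
    have Sb: "S y \<le> ennreal (C * \<epsilon>) * ennreal (exp (- \<theta> * y)) + ennreal (C / \<epsilon>) * ennreal (g y)" if "y > \<beta> * x" for y
    proof -
      have "S y \<le> ennreal (C * (\<epsilon> * exp (- \<theta> * y) + g y / \<epsilon>))"
        using pair[of \<epsilon> f y] e e0 w that xpb by (simp add: S_def F_def \<theta>_def)
      also have "\<dots> = ennreal (C * \<epsilon>) * ennreal (exp (- \<theta> * y)) + ennreal (C / \<epsilon>) * ennreal (g y)"
        using C e by (simp add: ennreal_mult[symmetric] ennreal_plus[symmetric] algebra_simps del: ennreal_plus)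
      finally show ?thesis .
    qed
    have Smass: "ennreal (\<epsilon>\<^sup>2) + (\<integral>\<^sup>+y. S y \<partial>lborel) = 1"
    proof -
      have "(\<integral>\<^sup>+y. S y \<partial>lborel) = ennreal (2 * \<epsilon>) * ennreal (1 - \<epsilon>) + ennreal (1 - \<epsilon>) * ennreal (1 - \<epsilon>)"
        unfolding S_def by (simp add: nn_integral_add nn_integral_cmult nn_integral_conv mass)
      then have "ennreal (\<epsilon>\<^sup>2) + (\<integral>\<^sup>+y. S y \<partial>lborel) = ennreal (\<epsilon>\<^sup>2 + (2 * \<epsilon> * (1 - \<epsilon>) + (1 - \<epsilon>) * (1 - \<epsilon>)))"
        using e by (simp add: ennreal_mult[symmetric] ennreal_plus[symmetric] del: ennreal_plus)
      also have "\<epsilon>\<^sup>2 + (2 * \<epsilon> * (1 - \<epsilon>) + (1 - \<epsilon>) * (1 - \<epsilon>)) = 1" by (simp add: power2_eq_square algebra_simps)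
      finally show ?thesis by simp
    qed
    let ?S1 = "\<lambda>y. S y * indicator {..\<beta> * x} y" and ?S2 = "\<lambda>y. S y * indicator {\<beta> * x<..} y"
    have Ssplit: "(\<integral>\<^sup>+y. S y \<partial>lborel) = (\<integral>\<^sup>+y. ?S1 y \<partial>lborel) + (\<integral>\<^sup>+y. ?S2 y \<partial>lborel)"
      by (subst nn_integral_add[symmetric], measurable, intro nn_integral_cong) (auto simp: indicator_def)
    have sb: "ennreal (\<epsilon> * (x * f x)) = ennreal (1 - \<epsilon>) * (ennreal (\<epsilon>\<^sup>2) * ?k x + (?k \<diamondop> S) x)"
      using size_bias[OF e(1,3) w, of x] by (simp add: S_def F_def)
    have ksplit: "(?k \<diamondop> S) x = (\<integral>\<^sup>+y. ?k (x - y) * ?S1 y \<partial>lborel) + (\<integral>\<^sup>+y. ?k (x - y) * ?S2 y \<partial>lborel)"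
      unfolding conv_def
      by (subst nn_integral_add[symmetric], measurable, intro nn_integral_cong) (auto simp: indicator_def)
    have decay: "b * exp (- \<theta> * \<beta> * x) \<le> r" if "b / (r * \<nu> * \<beta>) \<le> Y" "b > 0" "r > 0" for b r
    proof -
      have t: "\<theta> * \<beta> * x \<ge> b / r"
      proof -
        have "b / r = \<nu> * \<beta> * (b / (r * \<nu> * \<beta>))" using nu b2 by simp
        also have "\<dots> \<le> \<nu> * \<beta> * (\<epsilon> * x)" using that exY nu b2 by (intro mult_left_mono) auto
        also have "\<dots> = \<beta> * (\<theta> * x)" unfolding thx by simp
        finally show ?thesis by (simp add: mult_ac)
      qed
      then have "b / r \<le> exp (\<theta> * \<beta> * x)" using exp_ge_add_one_self[of "\<theta> * \<beta> * x"] by linarith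
      then show ?thesis using that by (simp add: exp_minus field_simps)
    qed

    have tailS: "(\<integral>\<^sup>+y. ?S2 y \<partial>lborel) \<le> ennreal \<eta>"
    proof -
      have "(\<integral>\<^sup>+y. ?S2 y \<partial>lborel) \<le> (\<integral>\<^sup>+y. ennreal (C * \<epsilon>) * (ennreal (exp (- \<theta> * y)) * indicator {\<beta> * x<..} y)
          + ennreal (C / \<epsilon> / (\<beta> * x)) * ennreal (y * g y) \<partial>lborel)"
      proof (rule nn_integral_mono)
        fix y
        show "?S2 y \<le> ennreal (C * \<epsilon>) * (ennreal (exp (- \<theta> * y)) * indicator {\<beta> * x<..} y)
          + ennreal (C / \<epsilon> / (\<beta> * x)) * ennreal (y * g y)"
        proof (cases "y > \<beta> * x")
          case True
          have "C / \<epsilon> * g y * 1 \<le> C / \<epsilon> * g y * (y / (\<beta> * x))"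
            using True C e b2 xp0 by (intro mult_left_mono) auto
          also have "\<dots> = C / \<epsilon> / (\<beta> * x) * (y * g y)" by (simp add: mult_ac)
          finally have "C / \<epsilon> * g y \<le> C / \<epsilon> / (\<beta> * x) * (y * g y)" by simp
          then have "ennreal (C / \<epsilon>) * ennreal (g y) \<le> ennreal (C / \<epsilon> / (\<beta> * x)) * ennreal (y * g y)"
            using C e b2 xp0 by (simp add: ennreal_mult[symmetric] ennreal_mult'[symmetric] ennreal_leI del: times_divide_eq_left)
          then show ?thesis using Sb[OF True] True by (simp add: order_trans[OF _ add_left_mono])
        qed simp
      qed
      also have "\<dots> = ennreal (C * \<epsilon>) * (\<integral>\<^sup>+y. ennreal (exp (- \<theta> * y)) * indicator {\<beta> * x<..} y \<partial>lborel)
          + ennreal (C / \<epsilon> / (\<beta> * x)) * ennreal \<mu>"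
        by (subst nn_integral_add, measurable, subst nn_integral_cmult, measurable, subst nn_integral_cmult, measurable, simp add: g_mean)
      also have "\<dots> \<le> ennreal (C * \<epsilon>) * ennreal (exp (- \<theta> * (\<beta> * x)) / \<theta>) + ennreal (C / \<epsilon> / (\<beta> * x)) * ennreal \<mu>"
        by (intro add_mono mult_left_mono nn_integral_exp_tail th) auto
      also have "\<dots> = ennreal (C * \<epsilon> * (exp (- \<theta> * (\<beta> * x)) / \<theta>) + C / \<epsilon> / (\<beta> * x) * \<mu>)"
        using C e th b2 xp0 mu_pos by (simp add: ennreal_mult[symmetric] ennreal_plus[symmetric] del: ennreal_plus)
      also have "\<dots> \<le> ennreal \<eta>"
      proof (rule ennreal_leI)
        have "C * \<epsilon> * (exp (- \<theta> * (\<beta> * x)) / \<theta>) = C * \<mu> / c * exp (- \<theta> * \<beta> * x)"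
          using e c mu_pos by (simp add: \<theta>_def mult.assoc)
        also have "\<dots> \<le> \<eta> / 2" using Y(8) C mu_pos c eta by (intro decay) (auto simp: mult_ac)
        finally have a: "C * \<epsilon> * (exp (- \<theta> * (\<beta> * x)) / \<theta>) \<le> \<eta> / 2" .
        have "2 * C * \<mu> / (\<eta> * \<beta>) \<le> \<epsilon> * x" using Y(9) exY by simp
        then have "C / \<epsilon> / (\<beta> * x) * \<mu> \<le> \<eta> / 2" using eta b2 e xp0 by (simp add: field_simps)
        with a show "C * \<epsilon> * (exp (- \<theta> * (\<beta> * x)) / \<theta>) + C / \<epsilon> / (\<beta> * x) * \<mu> \<le> \<eta>"
          by (rule order_trans[OF add_mono]) simp
      qed
      finally show ?thesis .
    qed

    have R: "(\<integral>\<^sup>+y. ?k (x - y) * ?S2 y \<partial>lborel) \<le> ennreal (\<eta> * (x * g x))"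
    proof -
      have "(\<integral>\<^sup>+y. ?k (x - y) * ?S2 y \<partial>lborel) \<le>
        (\<integral>\<^sup>+y. ennreal (C * \<epsilon>) * (?k (x - y) * (ennreal (exp (- \<theta> * y)) * indicator {\<beta> * x<..} y))
          + ennreal (C / \<epsilon> * g (\<beta> * x)) * ?k (x - y) \<partial>lborel)"
      proof (rule nn_integral_mono)
        fix y
        show "?k (x - y) * ?S2 y \<le> ennreal (C * \<epsilon>) * (?k (x - y) * (ennreal (exp (- \<theta> * y)) * indicator {\<beta> * x<..} y))
          + ennreal (C / \<epsilon> * g (\<beta> * x)) * ?k (x - y)"
        proof (cases "y > \<beta> * x")
          case True
          have "g y \<le> g (\<beta> * x)" using True b2 xp0 by (intro g_anti) auto
          then have "ennreal (C / \<epsilon>) * ennreal (g y) \<le> ennreal (C / \<epsilon> * g (\<beta> * x))"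
            using C e by (simp add: ennreal_mult[symmetric] ennreal_leI divide_right_mono)
          then have "S y \<le> ennreal (C * \<epsilon>) * ennreal (exp (- \<theta> * y)) + ennreal (C / \<epsilon> * g (\<beta> * x))"
            using Sb[OF True] by (meson add_left_mono order_trans)
          then have "?k (x - y) * S y \<le> ?k (x - y) * (ennreal (C * \<epsilon>) * ennreal (exp (- \<theta> * y)) + ennreal (C / \<epsilon> * g (\<beta> * x)))"
            by (intro mult_left_mono) auto
          then show ?thesis using True by (simp add: distrib_left mult_ac)
        qed simp
      qed
      also have "\<dots> = ennreal (C * \<epsilon>) * (\<integral>\<^sup>+y. ?k (x - y) * (ennreal (exp (- \<theta> * y)) * indicator {\<beta> * x<..} y) \<partial>lborel)
          + ennreal (C / \<epsilon> * g (\<beta> * x)) * (\<integral>\<^sup>+y. ?k (x - y) \<partial>lborel)"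
        by (subst nn_integral_add, measurable, intro arg_cong2[where f = "(+)"] nn_integral_cmult, measurable)
      also have "(\<integral>\<^sup>+y. ?k (x - y) \<partial>lborel) = ennreal \<mu>"
        unfolding g_mean[symmetric] by (rule nn_integral_reflect) measurable
      also have "ennreal (C * \<epsilon>) * (\<integral>\<^sup>+y. ?k (x - y) * (ennreal (exp (- \<theta> * y)) * indicator {\<beta> * x<..} y) \<partial>lborel)
          + ennreal (C / \<epsilon> * g (\<beta> * x)) * ennreal \<mu>
        \<le> ennreal (C * \<epsilon>) * ennreal (exp 1 * exp (- \<theta> * x) * \<mu> + x * (2 * real p) ^ p * env ((1 - \<beta>) * x) * exp (- \<theta> * \<beta> * x) * (2 / \<theta>))
          + ennreal (C / \<epsilon> * g (\<beta> * x)) * ennreal \<mu>"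
        by (intro add_mono mult_left_mono k_exp_conv th xp0 b2) auto
      also have "\<dots> = ennreal (C * \<epsilon> * (exp 1 * exp (- \<theta> * x) * \<mu> + x * Cp * env ((1 - \<beta>) * x) * exp (- \<theta> * \<beta> * x) * (2 / \<theta>))
          + C / \<epsilon> * g (\<beta> * x) * \<mu>)"
        using C e th b2 xp0 mu_pos Cp unfolding Cp_def[symmetric]
        by (simp add: ennreal_mult[symmetric] ennreal_plus[symmetric] del: ennreal_plus)
      also have "\<dots> \<le> ennreal (\<eta> * (x * g x))"
      proof (rule ennreal_leI)
        have "C * \<epsilon> * (exp 1 * exp (- \<theta> * x) * \<mu>) = C * exp 1 * \<mu> * (\<epsilon> * exp (- \<nu> * \<epsilon> * x))"
          using thx by (simp add: mult_ac)
        also have "\<dots> \<le> C * exp 1 * \<mu> * (\<eta>1 * (x * g x))"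
          using C mu_pos e e0 x x1 by (intro mult_left_mono negl) auto
        also have "\<dots> = \<eta> / 3 * (x * g x)" using C mu_pos by (simp add: \<eta>1_def)
        finally have r1: "C * \<epsilon> * (exp 1 * exp (- \<theta> * x) * \<mu>) \<le> \<eta> / 3 * (x * g x)" .
        have "env ((1 - \<beta>) * x) \<le> Ce * g ((1 - \<beta>) * x)" by (rule Ce(3)[OF xcb])
        also have "\<dots> \<le> Ce * ((1 + \<eta>) * g x)" using ga Ce(1) by (intro mult_left_mono) auto
        also have "\<dots> \<le> Ce * (2 * g x)" using Ce eta by (intro mult_left_mono mult_right_mono) auto
        finally have ev: "env ((1 - \<beta>) * x) \<le> Ce * (2 * g x)" .
        have "C * \<epsilon> * (x * Cp * env ((1 - \<beta>) * x) * exp (- \<theta> * \<beta> * x) * (2 / \<theta>))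
          = x * exp (- \<theta> * \<beta> * x) * (2 * C * Cp * \<mu> / c) * env ((1 - \<beta>) * x)" using e c by (simp add: \<theta>_def)
        also have "\<dots> \<le> x * exp (- \<theta> * \<beta> * x) * (2 * C * Cp * \<mu> / c) * (Ce * (2 * g x))"
          using xp0 C Cp c mu_pos ev by (intro mult_left_mono) auto
        also have "\<dots> = x * g x * (B * exp (- \<theta> * \<beta> * x))" by (simp add: B_def)
        also have "\<dots> \<le> x * g x * (\<eta> / 3)" using Y(7) B eta xp0 by (intro mult_left_mono decay) (auto simp: mult_ac)
        finally have r2: "C * \<epsilon> * (x * Cp * env ((1 - \<beta>) * x) * exp (- \<theta> * \<beta> * x) * (2 / \<theta>)) \<le> \<eta> / 3 * (x * g x)"
          by (simp add: mult_ac)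
        have "C / \<epsilon> * g (\<beta> * x) * \<mu> \<le> C / \<epsilon> * (Cb * g x) * \<mu>"
          using gb C e mu_pos by (intro mult_right_mono mult_left_mono) auto
        also have "\<dots> \<le> \<eta> / 3 * (x * g x)"
        proof -
          have "3 * C * Cb * \<mu> / \<eta> \<le> \<epsilon> * x" using Y(6) exY by simp
          then have "C * Cb * \<mu> / \<epsilon> \<le> \<eta> / 3 * x" using eta e by (simp add: field_simps)
          then have "C * Cb * \<mu> / \<epsilon> * g x \<le> \<eta> / 3 * x * g x" by (intro mult_right_mono) auto
          then show ?thesis by (simp add: mult_ac)
        qed
        finally have r3: "C / \<epsilon> * g (\<beta> * x) * \<mu> \<le> \<eta> / 3 * (x * g x)" .
        show "C * \<epsilon> * (exp 1 * exp (- \<theta> * x) * \<mu> + x * Cp * env ((1 - \<beta>) * x) * exp (- \<theta> * \<beta> * x) * (2 / \<theta>))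
          + C / \<epsilon> * g (\<beta> * x) * \<mu> \<le> \<eta> * (x * g x)"
          using r1 r2 r3 unfolding distrib_left by linarith
      qed
      finally show ?thesis .
    qed

    have upper: "\<epsilon> * (x * f x) \<le> (1 + 2 * \<eta>) * (x * g x)"
    proof -
      let ?u = "x * g ((1 - \<beta>) * x)"
      have "(\<integral>\<^sup>+y. ?k (x - y) * ?S1 y \<partial>lborel) \<le> (\<integral>\<^sup>+y. ennreal ?u * ?S1 y \<partial>lborel)"
      proof (rule nn_integral_mono)
        fix y
        show "?k (x - y) * ?S1 y \<le> ennreal ?u * ?S1 y"
        proof (cases "0 \<le> y \<and> y \<le> \<beta> * x")
          case True
          moreover have "\<beta> * x \<le> 1 * x" using b2 xp0 by (intro mult_right_mono) auto
          ultimately have "(x - y) * g (x - y) \<le> ?u"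
            using b2 xp0 by (intro mult_mono g_anti) (auto simp: algebra_simps)
          then show ?thesis by (intro mult_right_mono ennreal_leI) auto
        next
          case False
          then show ?thesis using Sneg[of y] by (auto simp: indicator_def)
        qed
      qed
      also have "\<dots> = ennreal ?u * (\<integral>\<^sup>+y. ?S1 y \<partial>lborel)" by (rule nn_integral_cmult) measurable
      finally have k1: "(\<integral>\<^sup>+y. ?k (x - y) * ?S1 y \<partial>lborel) \<le> ennreal ?u * (\<integral>\<^sup>+y. ?S1 y \<partial>lborel)" .
      have "g x \<le> g ((1 - \<beta>) * x)" using b2 xp0 by (intro g_anti) (auto simp: algebra_simps)
      then have k0: "?k x \<le> ennreal ?u" using xp0 by (intro ennreal_leI mult_left_mono) auto
      have "ennreal (\<epsilon> * (x * f x)) \<le> 1 * (ennreal (\<epsilon>\<^sup>2) * ennreal ?u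
          + (ennreal ?u * (\<integral>\<^sup>+y. ?S1 y \<partial>lborel) + ennreal (\<eta> * (x * g x))))"
        unfolding sb ksplit using e
        by (intro mult_mono add_mono k0 k1 R order_refl) (auto simp: ennreal_1[symmetric] intro!: ennreal_leI simp del: ennreal_1)
      also have "\<dots> = ennreal ?u * (ennreal (\<epsilon>\<^sup>2) + (\<integral>\<^sup>+y. ?S1 y \<partial>lborel)) + ennreal (\<eta> * (x * g x))"
        by (simp add: distrib_left mult_ac add.assoc)
      also have "\<dots> \<le> ennreal ?u * 1 + ennreal (\<eta> * (x * g x))"
        unfolding Smass[symmetric] Ssplit by (intro add_mono mult_left_mono order_refl) (auto simp: add.assoc[symmetric])
      also have "\<dots> = ennreal (?u + \<eta> * (x * g x))" using xp0 eta by (simp add: ennreal_plus)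
      finally have "\<epsilon> * (x * f x) \<le> ?u + \<eta> * (x * g x)" using xp0 eta by (subst (asm) ennreal_le_iff) auto
      also have "?u \<le> x * ((1 + \<eta>) * g x)" using ga xp0 by (intro mult_left_mono) auto
      finally show ?thesis by (simp add: algebra_simps)
    qed

    have lower: "(1 - 3 * \<eta>) * (x * g x) \<le> \<epsilon> * (x * f x)"
    proof -
      let ?l = "(1 - \<beta>) * x * g x"
      define P where "P = ennreal (\<epsilon>\<^sup>2) + (\<integral>\<^sup>+y. ?S1 y \<partial>lborel)"
      have "1 = P + (\<integral>\<^sup>+y. ?S2 y \<partial>lborel)" unfolding Smass[symmetric] Ssplit P_def by (simp add: add.assoc)
      then have P1: "1 \<le> P + ennreal \<eta>" using add_left_mono[OF tailS, of P] by (simp only:)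
      have P: "ennreal (1 - \<eta>) \<le> P"
      proof (cases P)
        case (real r)
        then have "ennreal 1 \<le> ennreal (r + \<eta>)" using P1 eta by simp
        then show ?thesis using real eta by (subst (asm) ennreal_le_iff) (auto intro: ennreal_leI)
      qed simp
      have "ennreal ?l * (\<integral>\<^sup>+y. ?S1 y \<partial>lborel) = (\<integral>\<^sup>+y. ennreal ?l * ?S1 y \<partial>lborel)"
        by (rule nn_integral_cmult[symmetric]) measurable
      also have "\<dots> \<le> (\<integral>\<^sup>+y. ?k (x - y) * ?S1 y \<partial>lborel)"
      proof (rule nn_integral_mono)
        fix y
        show "ennreal ?l * ?S1 y \<le> ?k (x - y) * ?S1 y"
        proof (cases "0 \<le> y \<and> y \<le> \<beta> * x")
          case True
          moreover have "\<beta> * x \<le> 1 * x" using b2 xp0 by (intro mult_right_mono) auto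
          ultimately have "y \<le> x" by simp
          with True have "?l \<le> (x - y) * g (x - y)"
            using b2 xp0 by (intro mult_mono g_anti) (auto simp: algebra_simps)
          then show ?thesis by (intro mult_right_mono ennreal_leI) auto
        next
          case False
          then show ?thesis using Sneg[of y] by (auto simp: indicator_def)
        qed
      qed
      finally have k1: "ennreal ?l * (\<integral>\<^sup>+y. ?S1 y \<partial>lborel) \<le> (?k \<diamondop> S) x"
        unfolding ksplit by (simp add: add_increasing2)
      have "(1 - \<beta>) * (x * g x) \<le> 1 * (x * g x)" using b2 xp0 by (intro mult_right_mono) auto
      then have k0: "ennreal ?l \<le> ?k x" by (intro ennreal_leI) (simp add: mult_ac)
      have "ennreal ((1 - \<epsilon>) * (?l * (1 - \<eta>))) = ennreal (1 - \<epsilon>) * (ennreal ?l * ennreal (1 - \<eta>))"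
        using e eta b2 xp0 by (simp add: ennreal_mult)
      also have "\<dots> \<le> ennreal (1 - \<epsilon>) * (ennreal ?l * P)" by (intro mult_left_mono P) auto
      also have "ennreal ?l * P = ennreal (\<epsilon>\<^sup>2) * ennreal ?l + ennreal ?l * (\<integral>\<^sup>+y. ?S1 y \<partial>lborel)"
        unfolding P_def by (simp add: distrib_left mult_ac)
      also have "ennreal (1 - \<epsilon>) * \<dots> \<le> ennreal (1 - \<epsilon>) * (ennreal (\<epsilon>\<^sup>2) * ?k x + (?k \<diamondop> S) x)"
        by (intro mult_left_mono add_mono k0 k1) auto
      also have "\<dots> = ennreal (\<epsilon> * (x * f x))" by (simp add: sb)
      finally have low1: "(1 - \<epsilon>) * (?l * (1 - \<eta>)) \<le> \<epsilon> * (x * f x)"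
        using e xp0 fnn by (subst (asm) ennreal_le_iff) auto
      have "(1 - 3 * \<eta>) * (x * g x) \<le> ((1 - \<eta>) * (1 - \<eta>) * (1 - \<eta>)) * (x * g x)"
      proof (intro mult_right_mono)
        have "(1 - \<eta>) * (1 - \<eta>) * (1 - \<eta>) = 1 - 3 * \<eta> + \<eta> * \<eta> * (3 - \<eta>)" by (simp add: algebra_simps)
        then show "1 - 3 * \<eta> \<le> (1 - \<eta>) * (1 - \<eta>) * (1 - \<eta>)" using eta by simp
      qed (use xp0 in auto)
      also have "\<dots> \<le> ((1 - \<epsilon>) * (1 - \<beta>) * (1 - \<eta>)) * (x * g x)"
        using e e0 b2 eta xp0 by (intro mult_right_mono mult_mono) auto
      also have "\<dots> = (1 - \<epsilon>) * (?l * (1 - \<eta>))" by (simp add: mult_ac)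
      finally show ?thesis using low1 by simp
    qed
    have xg: "x * g x > 0" using xp0 gx by simp
    have eq: "\<epsilon> * f x / g x = \<epsilon> * (x * f x) / (x * g x)" using xp0 by simp
    have "\<epsilon> * (x * f x) / (x * g x) \<le> 1 + 2 * \<eta>" using upper by (subst pos_divide_le_eq[OF xg])
    moreover have "1 - 3 * \<eta> \<le> \<epsilon> * (x * f x) / (x * g x)" using lower by (subst pos_le_divide_eq[OF xg])
    ultimately show ?thesis using eta unfolding eq by linarith
  qed
  then show ?thesis using e0(1) by blast
qed

end

section \<open>The net input on a grid as a random walk\<close>

text \<open>The value after \<open>k\<close> grid cells of length \<open>h\<close>, when \<open>d i\<close> claims arrive in cell \<open>i\<close> and the
  claims have the sizes \<open>b 0, b 1, \<dots>\<close>.\<close>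

definition walk :: "real \<Rightarrow> nat \<Rightarrow> (nat \<Rightarrow> nat) \<Rightarrow> (nat \<Rightarrow> real) \<Rightarrow> real" where
  "walk h k d b = (\<Sum>j<(\<Sum>i<k. d i). b j) - real k * h"

text \<open>The maximum of \<open>0\<close> and the first \<open>n\<close> values, in Lindley's recursive form: the walk after the first cell
  is a walk of the same kind with shifted arguments. Lemma \<open>walk_max_le_iff\<close> links it to \<open>walk\<close>.\<close>

primrec walk_max :: "real \<Rightarrow> nat \<Rightarrow> (nat \<Rightarrow> nat) \<Rightarrow> (nat \<Rightarrow> real) \<Rightarrow> real" where
  "walk_max h 0 d b = 0"
| "walk_max h (Suc n) d b =
     max 0 ((\<Sum>j<d 0. b j) - h + walk_max h n (\<lambda>i. d (Suc i)) (\<lambda>j. b (d 0 + j)))"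

lemma sum_lessThan_add:
  fixes b :: "nat \<Rightarrow> 'a::comm_monoid_add"
  shows "(\<Sum>j<m + n. b j) = (\<Sum>j<m. b j) + (\<Sum>j<n. b (m + j))"
  by (induction n) (auto simp: add.assoc)

lemma walk_0 [simp]: "walk h 0 d b = 0" by (simp add: walk_def)

lemma walk_Suc:
  "walk h (Suc k) d b = (\<Sum>j<d 0. b j) - h + walk h k (\<lambda>i. d (Suc i)) (\<lambda>j. b (d 0 + j))"
  unfolding walk_def by (subst sum.lessThan_Suc_shift) (simp add: sum_lessThan_add algebra_simps)

lemma walk_max_nonneg: "0 \<le> walk_max h n d b" by (cases n) auto

lemma walk_max_le_iff: "walk_max h n d b \<le> x \<longleftrightarrow> (\<forall>k\<le>n. walk h k d b \<le> x)"
proof (induction n arbitrary: d b x)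
  case (Suc n)
  let ?d = "\<lambda>i. d (Suc i)" and ?b = "\<lambda>j. b (d 0 + j)"
  have "walk_max h (Suc n) d b \<le> x \<longleftrightarrow> 0 \<le> x \<and> walk_max h n ?d ?b \<le> x - ((\<Sum>j<d 0. b j) - h)"
    by auto
  also have "\<dots> \<longleftrightarrow> 0 \<le> x \<and> (\<forall>k\<le>n. walk h k ?d ?b \<le> x - ((\<Sum>j<d 0. b j) - h))"
    unfolding Suc.IH ..
  also have "\<dots> \<longleftrightarrow> 0 \<le> x \<and> (\<forall>k\<le>n. walk h (Suc k) d b \<le> x)"
    unfolding walk_Suc by (simp add: algebra_simps)
  also have "\<dots> \<longleftrightarrow> (\<forall>k\<le>Suc n. walk h k d b \<le> x)"
    using All_less_Suc2[of "Suc n" "\<lambda>k. walk h k d b \<le> x"] by (simp add: less_Suc_eq_le)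
  finally show ?case .
qed simp

lemma walk_max_mono: "walk_max h n d b \<le> walk_max h (Suc n) d b"
  using walk_max_le_iff[of h n d b "walk_max h (Suc n) d b"] walk_max_le_iff[of h "Suc n" d b "walk_max h (Suc n) d b"]
  by auto

abbreviation "count_seq \<equiv> (\<Pi>\<^sub>M i\<in>(UNIV::nat set). count_space (UNIV :: nat set))"
abbreviation "real_seq \<equiv> (\<Pi>\<^sub>M i\<in>(UNIV::nat set). (borel :: real measure))"

lemma const_in_count_seq [measurable]: "d \<in> space count_seq"
  by (simp add: space_PiM)

lemma shift_seq_measurable: "(\<lambda>b j. b (Suc j)) \<in> measurable real_seq real_seq"
proof (rule measurable_PiM_single')
  show "(\<lambda>b. b (Suc i)) \<in> borel_measurable real_seq" for i
    by (rule measurable_component_singleton) simp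
qed (simp add: space_PiM)

lemma partial_sum_measurable [measurable (raw)]:
  assumes [measurable]: "N \<in> measurable M (count_space UNIV)" "b \<in> measurable M real_seq"
  shows "(\<lambda>x. \<Sum>j<N x. b x j) \<in> borel_measurable M"
proof (rule measurable_compose_countable[where f = "\<lambda>n x. \<Sum>j<n. b x j" and g = N])
  fix n :: nat
  show "(\<lambda>x. \<Sum>j<n. b x j) \<in> borel_measurable M" by measurable
qed measurable

lemma walk_measurable [measurable (raw)]:
  assumes [measurable]: "d \<in> measurable M count_seq" "b \<in> measurable M real_seq"
  shows "(\<lambda>x. walk h k (d x) (b x)) \<in> borel_measurable M"
proof -
  have [measurable]: "(\<lambda>x. \<Sum>i<k. d x i) \<in> measurable M (count_space UNIV)"
    by (induction k) auto
  show ?thesis unfolding walk_def by measurable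
qed

lemma walk_max_measurable [measurable (raw)]:
  assumes [measurable]: "d \<in> measurable M count_seq" "b \<in> measurable M real_seq"
  shows "(\<lambda>x. walk_max h n (d x) (b x)) \<in> borel_measurable M"
  unfolding borel_measurable_iff_le walk_max_le_iff by measurable

lemma poisson_mean:
  assumes "0 < a"
  shows "(\<integral>\<^sup>+k. ennreal (real k) \<partial>measure_pmf (poisson_pmf a)) = ennreal a"
proof -
  have "(\<lambda>i. exp (- a) * a * (a ^ i /\<^sub>R fact i)) sums (exp (- a) * a * exp a)"
    by (intro sums_mult exp_converges)
  moreover have "exp (- a) * a * (a ^ i /\<^sub>R fact i) = real (Suc i) * (a ^ Suc i / fact (Suc i) * exp (- a))" for i
    unfolding fact_Suc by (simp add: inverse_eq_divide)
  moreover have "exp (- a) * a * exp a = a" by (simp add: exp_minus)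
  ultimately have "(\<lambda>i. real (Suc i) * (a ^ Suc i / fact (Suc i) * exp (- a))) sums a" by (simp only:)
  then have "(\<lambda>i. real i * (a ^ i / fact i * exp (- a))) sums a"
    using sums_Suc[of "\<lambda>i. real i * (a ^ i / fact i * exp (- a))" a] by (simp only: of_nat_0 mult_zero_left add_0_right)
  then have "(\<Sum>i. ennreal (real i * (a ^ i / fact i * exp (- a)))) = ennreal a"
    using assms by (intro suminf_ennreal_eq) auto
  moreover have "(\<integral>\<^sup>+k. ennreal (real k) \<partial>measure_pmf (poisson_pmf a)) = (\<Sum>i. ennreal (real i * (a ^ i / fact i * exp (- a))))"
    using assms unfolding nn_integral_measure_pmf nn_integral_count_space_nat
    by (intro suminf_cong) (simp add: ennreal_mult[symmetric] mult.commute)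
  ultimately show ?thesis by simp
qed

text \<open>Two or more arrivals have probability \<open>1 - (1 + a) exp (- a) \<le> 1 - (1 + a) (1 - a) = a\<^sup>2\<close>.\<close>

lemma poisson_expectation_expand:
  fixes T :: "nat \<Rightarrow> ennreal"
  assumes a: "0 < a" and T: "\<And>k. T k \<le> 1"
  shows "ennreal (exp (- a)) * T 0 + ennreal (a * exp (- a)) * T 1 \<le> (\<integral>\<^sup>+k. T k \<partial>measure_pmf (poisson_pmf a))"
    and "(\<integral>\<^sup>+k. T k \<partial>measure_pmf (poisson_pmf a)) \<le> ennreal (exp (- a)) * T 0 + ennreal (a * exp (- a)) * T 1 + ennreal (a\<^sup>2)"
proof -
  let ?M = "measure_pmf (poisson_pmf a)"
  have e0: "emeasure ?M {0} = ennreal (exp (- a))" and e1: "emeasure ?M {1} = ennreal (a * exp (- a))"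
    using a by (simp_all add: emeasure_pmf_single)
  have "measure ?M (UNIV - {0, 1}) = 1 - measure ?M {0, 1}"
    using measure_pmf.prob_compl[of "{0, 1}" "poisson_pmf a"] by simp
  also have "measure ?M {0, 1} = exp (- a) + a * exp (- a)"
    using a by (subst measure_measure_pmf_finite) auto
  also have "1 - (exp (- a) + a * exp (- a)) \<le> a\<^sup>2"
  proof -
    have "1 - a\<^sup>2 = (1 + a) * (1 - a)" by (simp add: power2_eq_square algebra_simps)
    also have "\<dots> \<le> (1 + a) * exp (- a)" using a exp_ge_add_one_self[of "- a"] by (intro mult_left_mono) auto
    finally show ?thesis by (simp add: algebra_simps)
  qed
  finally have e2: "emeasure ?M (UNIV - {0, 1}) \<le> ennreal (a\<^sup>2)"
    by (simp add: measure_pmf.emeasure_eq_measure ennreal_leI)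
  have "(\<integral>\<^sup>+k. T k \<partial>?M) = (\<integral>\<^sup>+k. T 0 * indicator {0} k + T 1 * indicator {1} k + T k * indicator (UNIV - {0, 1}) k \<partial>?M)"
    by (intro nn_integral_cong) (auto simp: indicator_def)
  also have "\<dots> = T 0 * ennreal (exp (- a)) + T 1 * ennreal (a * exp (- a)) + (\<integral>\<^sup>+k. T k * indicator (UNIV - {0, 1}) k \<partial>?M)"
    by (simp add: nn_integral_add nn_integral_cmult_indicator e0 e1[unfolded One_nat_def])
  finally have eq: "(\<integral>\<^sup>+k. T k \<partial>?M) = \<dots>" .
  have "(\<integral>\<^sup>+k. T k * indicator (UNIV - {0, 1}) k \<partial>?M) \<le> (\<integral>\<^sup>+k. indicator (UNIV - {0, 1}) k \<partial>?M)"
    using T by (intro nn_integral_mono) (auto simp: indicator_def)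
  also have "\<dots> \<le> ennreal (a\<^sup>2)" using e2 by simp
  finally have r: "(\<integral>\<^sup>+k. T k * indicator (UNIV - {0, 1}) k \<partial>?M) \<le> ennreal (a\<^sup>2)" .
  show "ennreal (exp (- a)) * T 0 + ennreal (a * exp (- a)) * T 1 \<le> (\<integral>\<^sup>+k. T k \<partial>?M)"
    unfolding eq by (simp add: mult.commute add_increasing2)
  show "(\<integral>\<^sup>+k. T k \<partial>?M) \<le> ennreal (exp (- a)) * T 0 + ennreal (a * exp (- a)) * T 1 + ennreal (a\<^sup>2)"
    unfolding eq using r by (simp add: mult.commute add_left_mono)
qed

text \<open>The canonical space: independent Poisson counts of mean \<open>a\<close> per cell, and independent claims with law \<open>F\<close>.\<close>

locale skeleton =
  fixes F :: "real measure" and a h :: real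
  assumes F_prob: "prob_space F" and F_sets [measurable_cong]: "sets F = sets borel"
    and F_nonneg: "AE b in F. 0 \<le> b" and a_pos: "0 < a" and h_pos: "0 < h"
begin

abbreviation "PD \<equiv> (\<Pi>\<^sub>M i\<in>(UNIV::nat set). measure_pmf (poisson_pmf a))"
abbreviation "PB \<equiv> (\<Pi>\<^sub>M i\<in>(UNIV::nat set). F)"

lemma PD_sets [measurable_cong]: "sets PD = sets count_seq"
  by (intro sets_PiM_cong) auto
lemma PB_sets [measurable_cong]: "sets PB = sets real_seq"
  by (intro sets_PiM_cong) (auto simp: F_sets)

sublocale D: sequence_space "measure_pmf (poisson_pmf a)"
  by (simp add: sequence_space_def product_prob_spaceI measure_pmf.prob_space_axioms)
sublocale B: sequence_space F
  by (simp add: sequence_space_def product_prob_spaceI F_prob)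
sublocale F: prob_space F by (rule F_prob)
sublocale PDB: pair_prob_space PD PB
  by (simp add: pair_prob_space_def pair_sigma_finite_def prob_space_imp_sigma_finite
      D.P.prob_space_axioms B.P.prob_space_axioms)

definition max_expect :: "nat \<Rightarrow> (real \<Rightarrow> ennreal) \<Rightarrow> ennreal" where
  "max_expect n \<phi> = (\<integral>\<^sup>+d. (\<integral>\<^sup>+b. \<phi> (walk_max h n d b) \<partial>PB) \<partial>PD)"

text \<open>Condition on the number \<open>k\<close> of claims in the first cell. The remaining counts and the claims after
  the first \<open>k\<close> have the same joint law as the whole sequences, and are independent of the first cell.\<close>

lemma max_expect_step:
  assumes [measurable]: "\<phi> \<in> borel_measurable borel"
  shows "max_expect (Suc n) \<phi> = (\<integral>\<^sup>+k. (\<integral>\<^sup>+b. max_expect n (\<lambda>v. \<phi> (max 0 ((\<Sum>j<k. b j) - h + v))) \<partial>PB) \<partial>measure_pmf (poisson_pmf a))"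
proof -
  have "max_expect (Suc n) \<phi> = (\<integral>\<^sup>+d. (\<integral>\<^sup>+b. \<phi> (walk_max h (Suc n) d b) \<partial>PB)
      \<partial>distr (measure_pmf (poisson_pmf a) \<Otimes>\<^sub>M PD) PD (\<lambda>(s, \<omega>). case_nat s \<omega>))"
    unfolding D.PiM_iter max_expect_def ..
  also have "\<dots> = (\<integral>\<^sup>+x. (\<integral>\<^sup>+b. \<phi> (walk_max h (Suc n) (case_nat (fst x) (snd x)) b) \<partial>PB)
      \<partial>(measure_pmf (poisson_pmf a) \<Otimes>\<^sub>M PD))"
    by (subst nn_integral_distr) (auto simp: split_beta' simp del: walk_max.simps)
  also have "\<dots> = (\<integral>\<^sup>+k. (\<integral>\<^sup>+d. (\<integral>\<^sup>+b. \<phi> (walk_max h (Suc n) (case_nat k d) b) \<partial>PB) \<partial>PD) \<partial>measure_pmf (poisson_pmf a))"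
    by (subst D.P.nn_integral_fst[symmetric]) (auto simp del: walk_max.simps)
  also have "\<dots> = (\<integral>\<^sup>+k. (\<integral>\<^sup>+b. max_expect n (\<lambda>v. \<phi> (max 0 ((\<Sum>j<k. b j) - h + v))) \<partial>PB) \<partial>measure_pmf (poisson_pmf a))"
  proof (rule nn_integral_cong)
    fix k
    have "(\<integral>\<^sup>+d. (\<integral>\<^sup>+b. \<phi> (walk_max h (Suc n) (case_nat k d) b) \<partial>PB) \<partial>PD)
      = (\<integral>\<^sup>+d. (\<integral>\<^sup>+b. (\<integral>\<^sup>+b'. \<phi> (max 0 ((\<Sum>j<k. b j) - h + walk_max h n d b')) \<partial>PB) \<partial>PB) \<partial>PD)"
    proof (rule nn_integral_cong)
      fix d
      have "(\<integral>\<^sup>+b. \<phi> (walk_max h (Suc n) (case_nat k d) b) \<partial>PB)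
        = (\<integral>\<^sup>+b. \<phi> (walk_max h (Suc n) (case_nat k d) b) \<partial>distr (PB \<Otimes>\<^sub>M PB) PB (\<lambda>(\<omega>, \<omega>'). comb_seq k \<omega> \<omega>'))"
        unfolding B.PiM_comb_seq ..
      also have "\<dots> = (\<integral>\<^sup>+x. \<phi> (walk_max h (Suc n) (case_nat k d) (comb_seq k (fst x) (snd x))) \<partial>(PB \<Otimes>\<^sub>M PB))"
        by (subst nn_integral_distr) (auto simp: split_beta' simp del: walk_max.simps)
      also have "\<dots> = (\<integral>\<^sup>+x. \<phi> (max 0 ((\<Sum>j<k. fst x j) - h + walk_max h n d (snd x))) \<partial>(PB \<Otimes>\<^sub>M PB))"
        by (intro nn_integral_cong) (simp add: comb_seq_less comb_seq_def)
      also have "\<dots> = (\<integral>\<^sup>+b. (\<integral>\<^sup>+b'. \<phi> (max 0 ((\<Sum>j<k. b j) - h + walk_max h n d b')) \<partial>PB) \<partial>PB)"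
        by (subst B.P.nn_integral_fst[symmetric]) auto
      finally show "(\<integral>\<^sup>+b. \<phi> (walk_max h (Suc n) (case_nat k d) b) \<partial>PB) = \<dots>" .
    qed
    also have "\<dots> = (\<integral>\<^sup>+b. (\<integral>\<^sup>+d. (\<integral>\<^sup>+b'. \<phi> (max 0 ((\<Sum>j<k. b j) - h + walk_max h n d b')) \<partial>PB) \<partial>PD) \<partial>PB)"
      by (rule PDB.Fubini'[symmetric]) measurable
    finally show "(\<integral>\<^sup>+d. (\<integral>\<^sup>+b. \<phi> (walk_max h (Suc n) (case_nat k d) b) \<partial>PB) \<partial>PD)
      = (\<integral>\<^sup>+b. max_expect n (\<lambda>v. \<phi> (max 0 ((\<Sum>j<k. b j) - h + v))) \<partial>PB)" unfolding max_expect_def .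
  qed
  finally show ?thesis .
qed

lemma max_expect_mono:
  assumes "\<And>v. 0 \<le> v \<Longrightarrow> \<phi> v \<le> \<psi> v"
  shows "max_expect n \<phi> \<le> max_expect n \<psi>"
  unfolding max_expect_def by (intro nn_integral_mono assms walk_max_nonneg)

lemma max_expect_const [simp]: "max_expect n (\<lambda>v. c) = c"
  by (simp add: max_expect_def D.P.emeasure_space_1 B.P.emeasure_space_1)

lemma max_expect_measurable [measurable (raw)]:
  assumes [measurable]: "(\<lambda>(x, v). \<phi> x v) \<in> borel_measurable (M \<Otimes>\<^sub>M borel)"
  shows "(\<lambda>x. max_expect n (\<phi> x)) \<in> borel_measurable M"
  unfolding max_expect_def by measurable

lemma max_expect_add:
  assumes [measurable]: "\<phi> \<in> borel_measurable borel" "\<psi> \<in> borel_measurable borel"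
  shows "max_expect n (\<lambda>v. \<phi> v + \<psi> v) = max_expect n \<phi> + max_expect n \<psi>"
  unfolding max_expect_def by (simp add: nn_integral_add)

lemma max_expect_cmult:
  assumes [measurable]: "\<phi> \<in> borel_measurable borel"
  shows "max_expect n (\<lambda>v. c * \<phi> v) = c * max_expect n \<phi>"
  unfolding max_expect_def by (simp add: nn_integral_cmult)

lemma PB_component: "\<phi> \<in> borel_measurable borel \<Longrightarrow> (\<integral>\<^sup>+b. \<phi> (b j) \<partial>PB) = (\<integral>\<^sup>+x. \<phi> x \<partial>F)"
  using B.PiM_component[of j] nn_integral_distr[of "\<lambda>b. b j" PB F \<phi>]
  by (simp add: measurable_cong_sets[OF F_sets refl])

lemma walk_first_step:
  assumes x: "x \<ge> 0"
  defines "\<Phi> \<equiv> \<lambda>n x. max_expect n (indicator {..x})"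
  defines "\<Psi> \<equiv> \<lambda>n x. \<integral>\<^sup>+b. max_expect n (\<lambda>v. indicator {..x} (b + v)) \<partial>F"
  shows "ennreal (exp (- a)) * \<Phi> n (x + h) + ennreal (a * exp (- a)) * \<Psi> n (x + h) \<le> \<Phi> (Suc n) x"
    and "\<Phi> (Suc n) x \<le> ennreal (exp (- a)) * \<Phi> n (x + h) + ennreal (a * exp (- a)) * \<Psi> n (x + h) + ennreal (a\<^sup>2)"
proof -
  define T where "T = (\<lambda>k. \<integral>\<^sup>+b. max_expect n (\<lambda>v. indicator {..x + h} ((\<Sum>j<k. b j) + v)) \<partial>PB)"
  have T1: "T k \<le> 1" for k
  proof -
    have "T k \<le> (\<integral>\<^sup>+b. 1 \<partial>PB)" unfolding T_def
      by (intro nn_integral_mono order_trans[OF max_expect_mono eq_refl[OF max_expect_const]]) (auto simp: indicator_def)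
    then show ?thesis by (simp add: B.P.emeasure_space_1)
  qed
  have "\<Phi> (Suc n) x = (\<integral>\<^sup>+k. T k \<partial>measure_pmf (poisson_pmf a))"
    unfolding \<Phi>_def T_def
    by (subst max_expect_step) (use x in \<open>auto simp: indicator_def algebra_simps intro!: nn_integral_cong arg_cong[where f = "max_expect n"]\<close>)
  moreover have "T 0 = \<Phi> n (x + h)"
    by (simp add: T_def \<Phi>_def B.P.emeasure_space_1)
  moreover have "T 1 = \<Psi> n (x + h)"
    unfolding T_def \<Psi>_def
    by (subst PB_component[of "\<lambda>b. max_expect n (\<lambda>v. indicator {..x + h} (b + v))" 0, symmetric]) auto
  ultimately show "ennreal (exp (- a)) * \<Phi> n (x + h) + ennreal (a * exp (- a)) * \<Psi> n (x + h) \<le> \<Phi> (Suc n) x"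
    and "\<Phi> (Suc n) x \<le> ennreal (exp (- a)) * \<Phi> n (x + h) + ennreal (a * exp (- a)) * \<Psi> n (x + h) + ennreal (a\<^sup>2)"
    using poisson_expectation_expand[where T = T, OF a_pos T1] by simp_all
qed

text \<open>In one step the maximum gains the input of a cell and loses \<open>h\<close>, except that it is reflected
  at \<open>0\<close>; reflection requires that the maximum is at most \<open>h\<close> and returns at most \<open>h\<close>. The mean of the maximum is
  nondecreasing in \<open>n\<close>, so reflection must make up for the negative drift \<open>- \<epsilon> * h\<close>.\<close>

lemma drift:
  assumes m: "(\<integral>\<^sup>+b. ennreal b \<partial>F) = ennreal m" "m \<ge> 0" and am: "a * m = (1 - \<epsilon>) * h"
  shows "ennreal \<epsilon> \<le> max_expect n (indicator {..h})"
proof -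
  let ?e = "\<lambda>n. max_expect n ennreal" and ?P = "max_expect n (indicator {..h})"
  have nonneg: "AE b in PB. \<forall>j. 0 \<le> b j"
    unfolding AE_all_countable by (auto intro!: AE_PiM_component F_prob F_nonneg)
  have inner: "(\<integral>\<^sup>+b. ennreal (\<Sum>j<k. b j) \<partial>PB) = ennreal (real k) * ennreal m" for k
  proof -
    have "(\<integral>\<^sup>+b. ennreal (\<Sum>j<k. b j) \<partial>PB) = (\<integral>\<^sup>+b. (\<Sum>j<k. ennreal (b j)) \<partial>PB)"
      using nonneg by (intro nn_integral_cong_AE) (auto simp: sum_ennreal)
    also have "\<dots> = (\<Sum>j<k. \<integral>\<^sup>+b. ennreal (b j) \<partial>PB)" by (rule nn_integral_sum) measurable
    also have "\<dots> = (\<Sum>j<k. ennreal m)" by (intro sum.cong refl) (simp add: PB_component m)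
    finally show ?thesis by (simp add: ennreal_of_nat_eq_real_of_nat)
  qed
  have step: "?e (Suc n) + ennreal h \<le> ennreal (a * m) + ?e n + ennreal h * max_expect n (indicator {..h})" for n
  proof -
    have "?e (Suc n) + ennreal h = max_expect (Suc n) (\<lambda>v. ennreal v + ennreal h)" by (simp add: max_expect_add)
    also have "\<dots> = (\<integral>\<^sup>+k. (\<integral>\<^sup>+b. max_expect n (\<lambda>v. ennreal (max 0 ((\<Sum>j<k. b j) - h + v)) + ennreal h) \<partial>PB) \<partial>measure_pmf (poisson_pmf a))"
      by (rule max_expect_step) measurable
    also have "\<dots> \<le> (\<integral>\<^sup>+k. (\<integral>\<^sup>+b. ennreal (\<Sum>j<k. b j) + (?e n + ennreal h * max_expect n (indicator {..h})) \<partial>PB) \<partial>measure_pmf (poisson_pmf a))"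
    proof (rule nn_integral_mono, rule nn_integral_mono_AE)
      fix k
      show "AE b in PB. max_expect n (\<lambda>v. ennreal (max 0 ((\<Sum>j<k. b j) - h + v)) + ennreal h)
          \<le> ennreal (\<Sum>j<k. b j) + (?e n + ennreal h * max_expect n (indicator {..h}))"
        using nonneg
      proof eventually_elim
        case (elim b)
        then have s: "0 \<le> (\<Sum>j<k. b j)" by (simp add: sum_nonneg)
        have "max_expect n (\<lambda>v. ennreal (max 0 ((\<Sum>j<k. b j) - h + v)) + ennreal h)
          \<le> max_expect n (\<lambda>v. ennreal (\<Sum>j<k. b j) + (ennreal v + ennreal h * indicator {..h} v))"
          using s h_pos by (intro max_expect_mono) (auto simp: indicator_def ennreal_plus[symmetric] max_def simp del: ennreal_plus intro!: ennreal_leI)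
        also have "\<dots> = ennreal (\<Sum>j<k. b j) + (?e n + ennreal h * max_expect n (indicator {..h}))"
          by (simp add: max_expect_add max_expect_cmult)
        finally show ?case .
      qed
    qed
    also have "\<dots> = (\<integral>\<^sup>+k. ennreal (real k) * ennreal m + (?e n + ennreal h * max_expect n (indicator {..h})) \<partial>measure_pmf (poisson_pmf a))"
      by (simp add: nn_integral_add inner B.P.emeasure_space_1)
    also have "\<dots> = ennreal a * ennreal m + (?e n + ennreal h * max_expect n (indicator {..h}))"
      by (simp add: nn_integral_add nn_integral_multc poisson_mean[OF a_pos])
    finally show ?thesis using a_pos m by (simp add: ennreal_mult add.assoc)
  qed
  have P1: "max_expect n (indicator {..h}) \<le> 1" for n
    using max_expect_mono[of "indicator {..h}" "\<lambda>_. 1" n] by (simp add: indicator_def)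
  have fin: "?e n < \<top>" for n
  proof (induction n)
    case 0
    then show ?case by (simp add: max_expect_def)
  next
    case (Suc n)
    have "?e (Suc n) \<le> ?e (Suc n) + ennreal h" by (simp add: add_increasing2)
    also have "\<dots> \<le> ennreal (a * m) + ?e n + ennreal h * 1"
      by (rule order_trans[OF step]) (intro add_mono mult_left_mono P1, auto)
    also have "\<dots> < \<top>" using Suc by simp
    finally show ?case .
  qed
  have "?e n \<le> ?e (Suc n)"
    unfolding max_expect_def by (intro nn_integral_mono ennreal_leI walk_max_mono)
  then have "?e n + ennreal h \<le> ?e (Suc n) + ennreal h" by (intro add_right_mono)
  also have "\<dots> \<le> ?e n + (ennreal (a * m) + ennreal h * ?P)" using step[of n] by (simp add: ac_simps)
  finally have "ennreal h \<le> ennreal (a * m) + ennreal h * ?P"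
    using fin[of n] by (auto simp: ennreal_add_left_cancel_le)
  moreover obtain r where r: "?P = ennreal r" "r \<ge> 0" using P1[of n] by (cases ?P) (auto simp: top_unique)
  ultimately have "h \<le> a * m + h * r"
    using h_pos a_pos m by (simp add: ennreal_mult[symmetric] ennreal_plus[symmetric] ennreal_le_iff del: ennreal_plus)
  then have "\<epsilon> * h \<le> r * h" unfolding am by (simp add: algebra_simps)
  then have "\<epsilon> \<le> r" using h_pos by simp
  then show ?thesis using r by (simp add: ennreal_leI)
qed

text \<open>Claim \<open>0\<close> is the initial value and does not enter the walk.\<close>

lemma split_first_claim:
  assumes [measurable]: "\<phi> \<in> borel_measurable (borel \<Otimes>\<^sub>M borel)"
  shows "(\<integral>\<^sup>+d. (\<integral>\<^sup>+b. \<phi> (b 0, walk_max h n d (\<lambda>j. b (Suc j))) \<partial>PB) \<partial>PD) = (\<integral>\<^sup>+b. max_expect n (\<lambda>v. \<phi> (b, v)) \<partial>F)"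
proof -
  have [measurable]: "(\<lambda>b. walk_max h n d (\<lambda>j. b (Suc j))) \<in> borel_measurable PB" for d
  proof -
    have "walk_max h n d \<in> borel_measurable real_seq"
      using walk_max_measurable[of "\<lambda>_. d" real_seq "\<lambda>b. b" h n] by simp
    moreover have "(\<lambda>b j. b (Suc j)) \<in> measurable PB real_seq"
      using shift_seq_measurable by (simp add: measurable_cong_sets[OF PB_sets refl])
    ultimately show ?thesis by (rule measurable_compose[rotated])
  qed
  have "(\<integral>\<^sup>+d. (\<integral>\<^sup>+b. \<phi> (b 0, walk_max h n d (\<lambda>j. b (Suc j))) \<partial>PB) \<partial>PD)
    = (\<integral>\<^sup>+d. (\<integral>\<^sup>+b0. (\<integral>\<^sup>+b. \<phi> (b0, walk_max h n d b) \<partial>PB) \<partial>F) \<partial>PD)"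
  proof (rule nn_integral_cong)
    fix d
    have "(\<integral>\<^sup>+b. \<phi> (b 0, walk_max h n d (\<lambda>j. b (Suc j))) \<partial>PB)
      = (\<integral>\<^sup>+b. \<phi> (b 0, walk_max h n d (\<lambda>j. b (Suc j))) \<partial>distr (F \<Otimes>\<^sub>M PB) PB (\<lambda>(s, \<omega>). case_nat s \<omega>))"
      unfolding B.PiM_iter ..
    also have "\<dots> = (\<integral>\<^sup>+x. \<phi> (fst x, walk_max h n d (snd x)) \<partial>(F \<Otimes>\<^sub>M PB))"
      by (subst nn_integral_distr, measurable) (simp add: split_beta')
    also have "\<dots> = (\<integral>\<^sup>+b0. (\<integral>\<^sup>+b. \<phi> (b0, walk_max h n d b) \<partial>PB) \<partial>F)"
      by (subst B.P.nn_integral_fst[symmetric]) auto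
    finally show "(\<integral>\<^sup>+b. \<phi> (b 0, walk_max h n d (\<lambda>j. b (Suc j))) \<partial>PB) = \<dots>" .
  qed
  also have "\<dots> = (\<integral>\<^sup>+b0. (\<integral>\<^sup>+d. (\<integral>\<^sup>+b. \<phi> (b0, walk_max h n d b) \<partial>PB) \<partial>PD) \<partial>F)"
  proof -
    interpret FD: pair_prob_space F PD
      by (simp add: pair_prob_space_def pair_sigma_finite_def prob_space_imp_sigma_finite
          D.P.prob_space_axioms F_prob)
    show ?thesis by (rule FD.Fubini') measurable
  qed
  finally show ?thesis by (simp add: max_expect_def)
qed

end

section \<open>The net input process and its supremum\<close>

locale queue = prob_space M for M :: "'a measure" +
  fixes B :: "'a \<Rightarrow> real" and Bs :: "nat \<Rightarrow> 'a \<Rightarrow> real" and N :: "real \<Rightarrow> 'a \<Rightarrow> nat" and \<rho> :: real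
  assumes B_rv [measurable]: "B \<in> borel_measurable M"
    and B_pos: "measure M {\<omega> \<in> space M. B \<omega> \<le> 0} = 0"
    and B_mean: "integral\<^sup>L M B > 0"
    and B_int: "integrable M B"
    and Bs_indep: "indep_vars (\<lambda>_. borel) Bs UNIV"
    and Bs_distr: "\<And>i. distr M borel (Bs i) = distr M borel B"
    and N_poisson: "poisson_process M (1 / integral\<^sup>L M B) N"
    and N_Bs_indep: "indep_set
          (sets (vimage_algebra (space M) (\<lambda>\<omega>. \<lambda>t\<in>{0..}. N t \<omega>)
             (Pi\<^sub>M {0..} (\<lambda>_. count_space UNIV))))
          (sets (vimage_algebra (space M) (\<lambda>\<omega> i. Bs i \<omega>) (Pi\<^sub>M UNIV (\<lambda>_. borel))))"
    and rho: "0 < \<rho>" "\<rho> < 1"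
begin

definition "m = integral\<^sup>L M B"
definition "F = distr M borel B"
definition "lam = \<rho> / m"

lemma m_pos: "m > 0" using B_mean by (simp add: m_def)
lemma lam_pos: "lam > 0" using m_pos rho by (simp add: lam_def)

lemma Bs_rv [measurable]: "Bs i \<in> borel_measurable M"
  using Bs_indep unfolding indep_vars_def by auto

lemma F_sets [simp, measurable_cong]: "sets F = sets borel" by (simp add: F_def)
lemma F_prob: "prob_space F" unfolding F_def by (rule prob_space_distr) simp

lemma B_pos_AE: "AE \<omega> in M. 0 < B \<omega>"
proof -
  have "{\<omega> \<in> space M. B \<omega> \<le> 0} \<in> null_sets M"
    using B_pos by (auto simp: null_sets_def emeasure_eq_measure)
  then have "AE \<omega> in M. \<omega> \<notin> {\<omega> \<in> space M. B \<omega> \<le> 0}" by (rule AE_not_in)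
  then show ?thesis using AE_space by eventually_elim auto
qed

lemma F_pos: "AE b in F. 0 < b"
  unfolding F_def by (subst AE_distr_iff) (use B_pos_AE in auto)

lemma Bs_pos: "AE \<omega> in M. \<forall>i. 0 < Bs i \<omega>"
  unfolding AE_all_countable
proof
  fix i
  have "AE b in distr M borel (Bs i). 0 < b" using F_pos unfolding Bs_distr F_def .
  then show "AE \<omega> in M. 0 < Bs i \<omega>" by (subst (asm) AE_distr_iff) auto
qed

lemma F_mean: "(\<integral>\<^sup>+b. ennreal b \<partial>F) = ennreal m"
  unfolding F_def m_def using B_int B_pos_AE
  by (subst nn_integral_distr) (auto intro!: nn_integral_eq_integral)

lemma N_rv: "t \<ge> 0 \<Longrightarrow> N t \<in> measurable M (count_space UNIV)"
  using N_poisson by (auto simp: poisson_process_def)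
lemma N_0: "\<omega> \<in> space M \<Longrightarrow> N 0 \<omega> = 0"
  using N_poisson by (auto simp: poisson_process_def)
lemma N_mono: "\<omega> \<in> space M \<Longrightarrow> 0 \<le> s \<Longrightarrow> s \<le> t \<Longrightarrow> N s \<omega> \<le> N t \<omega>"
  using N_poisson by (auto simp: poisson_process_def mono_on_def)

definition path :: "real \<Rightarrow> 'a \<Rightarrow> real" where
  "path t \<omega> = (\<Sum>i=1..N (\<rho> * t) \<omega>. Bs i \<omega>) - t"

lemma path_0 [simp]: "\<omega> \<in> space M \<Longrightarrow> path 0 \<omega> = 0"
  by (simp add: path_def N_0)

lemma path_eq: "path t \<omega> = (\<Sum>j<N (\<rho> * t) \<omega>. Bs (Suc j) \<omega>) - t"
proof -
  have "(\<Sum>i=1..n. Bs i \<omega>) = (\<Sum>j<n. Bs (Suc j) \<omega>)" for n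
    by (induction n) auto
  then show ?thesis by (simp add: path_def)
qed

lemma path_rv: "t \<ge> 0 \<Longrightarrow> path t \<in> borel_measurable M"
proof -
  assume t: "t \<ge> 0"
  have [measurable]: "N (\<rho> * t) \<in> measurable M (count_space UNIV)" using t rho by (intro N_rv) simp
  have "(\<lambda>\<omega>. (\<Sum>j<N (\<rho> * t) \<omega>. Bs (Suc j) \<omega>)) \<in> borel_measurable M"
    by (rule measurable_compose_countable[where f = "\<lambda>n x. \<Sum>j<n. Bs (Suc j) x" and g = "N (\<rho> * t)"]) measurable
  then show ?thesis unfolding path_eq[abs_def] by measurable
qed

text \<open>Between arrivals the path decreases with slope \<open>-1\<close>, so by right-continuity of the counts its value at
  \<open>t\<close> is the limit of its values at rational times above \<open>t\<close>.\<close>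

lemma path_le_rational:
  assumes w: "\<omega> \<in> space M" and q: "\<And>q. q \<in> \<rat> \<Longrightarrow> q \<ge> 0 \<Longrightarrow> path q \<omega> \<le> x" and t: "t \<ge> 0"
  shows "path t \<omega> \<le> x"
proof -
  have "continuous (at_right (\<rho> * t)) (\<lambda>u. N u \<omega>)"
    using N_poisson w t rho by (auto simp: poisson_process_def)
  then have "eventually (\<lambda>u. N u \<omega> \<in> {N (\<rho> * t) \<omega>}) (at_right (\<rho> * t))"
    unfolding continuous_within by (rule topological_tendstoD) (auto simp: Topological_Spaces.open_discrete)
  then obtain b where b: "b > \<rho> * t" "\<And>u. \<rho> * t < u \<Longrightarrow> u < b \<Longrightarrow> N u \<omega> = N (\<rho> * t) \<omega>"
    unfolding eventually_at_right_field by auto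
  have "path t \<omega> \<le> x + e" if e: "e > 0" for e
  proof -
    have "t < min (b / \<rho>) (t + e)" using b rho e by (simp add: field_simps)
    then obtain q where q': "q \<in> \<rat>" "t < q" "q < min (b / \<rho>) (t + e)" using Rats_dense_in_real by blast
    have "N (\<rho> * q) \<omega> = N (\<rho> * t) \<omega>" using q' rho by (intro b(2)) (auto simp: field_simps)
    then have "path t \<omega> = path q \<omega> + (q - t)" by (simp add: path_def)
    then show ?thesis using q[OF q'(1)] q' t by simp
  qed
  then show ?thesis by (rule field_le_epsilon)
qed

definition below :: "real \<Rightarrow> 'a set" where
  "below x = {\<omega> \<in> space M. \<forall>t\<ge>0. path t \<omega> \<le> x}"
definition below0 :: "real \<Rightarrow> 'a set" where
  "below0 x = {\<omega> \<in> space M. \<forall>t\<ge>0. Bs 0 \<omega> + path t \<omega> \<le> x}"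

lemma all_times_iff_rat:
  assumes "\<omega> \<in> space M"
  shows "(\<forall>t\<ge>0. path t \<omega> \<le> x) \<longleftrightarrow> (\<forall>r::rat. path (of_rat (max 0 r)) \<omega> \<le> x)"
proof
  assume *: "\<forall>r::rat. path (of_rat (max 0 r)) \<omega> \<le> x"
  show "\<forall>t\<ge>0. path t \<omega> \<le> x"
  proof (intro allI impI, rule path_le_rational[OF assms])
    fix q :: real assume "q \<in> \<rat>" "q \<ge> 0"
    from \<open>q \<in> \<rat>\<close> obtain r where r: "q = of_rat r" by (rule Rats_cases)
    with \<open>q \<ge> 0\<close> have "max 0 r = r" by (simp add: zero_le_of_rat_iff)
    then show "path q \<omega> \<le> x" using *[rule_format, of r] r by simp
  qed
qed (simp add: zero_le_of_rat_iff)

lemma below_sets [measurable]: "below x \<in> sets M"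
proof -
  have "below x = {\<omega> \<in> space M. \<forall>r::rat. path (of_rat (max 0 r)) \<omega> \<le> x}"
    unfolding below_def using all_times_iff_rat by blast
  moreover have [measurable]: "path (of_rat (max 0 r)) \<in> borel_measurable M" for r
    by (rule path_rv) simp
  ultimately show ?thesis by simp
qed

lemma below0_sets [measurable]: "below0 x \<in> sets M"
proof -
  have "below0 x = {\<omega> \<in> space M. \<forall>r::rat. path (of_rat (max 0 r)) \<omega> \<le> x - Bs 0 \<omega>}"
    unfolding below0_def le_diff_eq[symmetric] add.commute[of "Bs 0 _"] using all_times_iff_rat by blast
  moreover have [measurable]: "path (of_rat (max 0 r)) \<in> borel_measurable M" for r
    by (rule path_rv) simp
  ultimately show ?thesis by simp
qed

text \<open>The distribution functions of the supremum \<open>W\<close> without the initial claim and of the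
  all-time supremum. A defect at infinity is not excluded at this stage.\<close>

definition "\<Phi> x = prob (below x)"
definition "\<Psi> x = prob (below0 x)"

lemma below_mono: "x \<le> y \<Longrightarrow> below x \<subseteq> below y" "x \<le> y \<Longrightarrow> below0 x \<subseteq> below0 y"
  by (auto simp: below_def below0_def intro: order_trans)

lemma Phi_mono: "mono \<Phi>"
  unfolding \<Phi>_def by (intro monoI finite_measure_mono below_sets below_mono)
lemma Psi_mono: "mono \<Psi>"
  unfolding \<Psi>_def by (intro monoI finite_measure_mono below0_sets below_mono)
lemma Phi_bounds: "0 \<le> \<Phi> x" "\<Phi> x \<le> 1" by (auto simp: \<Phi>_def)
lemma Psi_bounds: "0 \<le> \<Psi> x" "\<Psi> x \<le> 1" by (auto simp: \<Psi>_def)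
lemma Phi_neg: "x < 0 \<Longrightarrow> \<Phi> x = 0"
proof -
  assume "x < 0"
  then have "below x = {}" unfolding below_def using path_0 by (metis (no_types, lifting) Collect_empty_eq not_le order_refl)
  then show ?thesis by (simp add: \<Phi>_def)
qed

lemma right_limit:
  assumes c: "c > 0"
  shows "(\<lambda>n. \<Phi> (x + c / real (Suc n))) \<longlonglongrightarrow> \<Phi> x" "(\<lambda>n. \<Psi> (x + c / real (Suc n))) \<longlonglongrightarrow> \<Psi> x"
proof -
  have dec: "c / real (Suc n) \<le> c / real (Suc k)" if "k \<le> n" for k n
    using that c by (intro divide_left_mono) auto
  have lim: "(\<lambda>n. y + c / real (Suc n)) \<longlonglongrightarrow> y" for y
    using tendsto_add[OF tendsto_const[of y] tendsto_mult[OF tendsto_const[of c] LIMSEQ_Suc[OF lim_1_over_n]]] by simp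
  have le: "u \<le> y" if "\<And>n. u \<le> y + c / real (Suc n)" for u y
    by (rule LIMSEQ_le_const[OF lim[of y]]) (use that in auto)
  have "(\<lambda>n. \<Phi> (x + c / real (Suc n))) \<longlonglongrightarrow> prob (\<Inter>n. below (x + c / real (Suc n)))"
    unfolding \<Phi>_def
  proof (rule finite_Lim_measure_decseq)
    show "decseq (\<lambda>n. below (x + c / real (Suc n)))"
      unfolding decseq_def by (intro allI impI below_mono add_left_mono dec)
  qed auto
  also have "(\<Inter>n. below (x + c / real (Suc n))) = below x"
  proof
    show "below x \<subseteq> (\<Inter>n. below (x + c / real (Suc n)))"
      using c by (intro INT_greatest below_mono) simp
    show "(\<Inter>n. below (x + c / real (Suc n))) \<subseteq> below x"
    proof
      fix \<omega> assume "\<omega> \<in> (\<Inter>n. below (x + c / real (Suc n)))"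
      then have "\<omega> \<in> below (x + c / real (Suc n))" for n by blast
      then show "\<omega> \<in> below x" unfolding below_def mem_Collect_eq by (blast intro: le)
    qed
  qed
  finally show "(\<lambda>n. \<Phi> (x + c / real (Suc n))) \<longlonglongrightarrow> \<Phi> x" by (simp add: \<Phi>_def)
  have "(\<lambda>n. \<Psi> (x + c / real (Suc n))) \<longlonglongrightarrow> prob (\<Inter>n. below0 (x + c / real (Suc n)))"
    unfolding \<Psi>_def
  proof (rule finite_Lim_measure_decseq)
    show "decseq (\<lambda>n. below0 (x + c / real (Suc n)))"
      unfolding decseq_def by (intro allI impI below_mono add_left_mono dec)
  qed auto
  also have "(\<Inter>n. below0 (x + c / real (Suc n))) = below0 x"
  proof
    show "below0 x \<subseteq> (\<Inter>n. below0 (x + c / real (Suc n)))"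
      using c by (intro INT_greatest below_mono) simp
    show "(\<Inter>n. below0 (x + c / real (Suc n))) \<subseteq> below0 x"
    proof
      fix \<omega> assume "\<omega> \<in> (\<Inter>n. below0 (x + c / real (Suc n)))"
      then have "\<omega> \<in> below0 (x + c / real (Suc n))" for n by blast
      then show "\<omega> \<in> below0 x" unfolding below0_def mem_Collect_eq by (blast intro: le)
    qed
  qed
  finally show "(\<lambda>n. \<Psi> (x + c / real (Suc n))) \<longlonglongrightarrow> \<Psi> x" by (simp add: \<Psi>_def)
qed

definition incr :: "real \<Rightarrow> nat \<Rightarrow> 'a \<Rightarrow> nat" where
  "incr h i \<omega> = N (\<rho> * (h * real (Suc i))) \<omega> - N (\<rho> * (h * real i)) \<omega>"
definition grid_max :: "real \<Rightarrow> nat \<Rightarrow> 'a \<Rightarrow> real" where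
  "grid_max h n \<omega> = walk_max h n (\<lambda>i. incr h i \<omega>) (\<lambda>j. Bs (Suc j) \<omega>)"

lemma sum_incr:
  assumes "\<omega> \<in> space M" "h > 0"
  shows "(\<Sum>i<k. incr h i \<omega>) = N (\<rho> * (h * real k)) \<omega>"
proof (induction k)
  case (Suc k)
  have "N (\<rho> * (h * real k)) \<omega> \<le> N (\<rho> * (h * real (Suc k))) \<omega>"
    using assms rho by (intro N_mono mult_left_mono) auto
  then show ?case using Suc by (simp add: incr_def)
qed (use assms N_0 in simp)

lemma grid_max_le_iff:
  assumes "\<omega> \<in> space M" "h > 0"
  shows "grid_max h n \<omega> \<le> x \<longleftrightarrow> (\<forall>k\<le>n. path (h * real k) \<omega> \<le> x)"
  unfolding grid_max_def walk_max_le_iff walk_def sum_incr[OF assms] path_eq by (simp add: mult.commute)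

lemma skel: "h > 0 \<Longrightarrow> skeleton F (lam * h) h"
  using F_pos lam_pos by (auto simp: skeleton_def F_prob elim: eventually_mono)

lemma incr_rv: "h > 0 \<Longrightarrow> incr h i \<in> measurable M (count_space UNIV)"
proof -
  assume h: "h > 0"
  have [measurable]: "N (\<rho> * (h * real j)) \<in> measurable M (count_space UNIV)" for j
    using h rho by (intro N_rv) auto
  show ?thesis unfolding incr_def[abs_def] by measurable
qed

lemma incr_indep: assumes h: "h > 0" shows "indep_vars (\<lambda>_. count_space UNIV) (incr h) UNIV"
  unfolding indep_vars_def
proof (intro conjI ballI incr_rv h)
  have fin: "indep_vars (\<lambda>_. count_space UNIV) (incr h) {..<n}" for n
  proof -
    define \<tau> where "\<tau> = (\<lambda>i. \<rho> * (h * real i))"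
    have "0 \<le> \<tau> 0 \<and> (\<forall>i<n. \<tau> i \<le> \<tau> (Suc i))" using h rho by (auto simp: \<tau>_def intro!: mult_left_mono)
    then have "indep_vars (\<lambda>_. count_space UNIV) (\<lambda>i \<omega>. N (\<tau> (Suc i)) \<omega> - N (\<tau> i) \<omega>) {..<n}"
      using N_poisson unfolding poisson_process_def by blast
    then show ?thesis by (simp add: \<tau>_def incr_def[abs_def])
  qed
  show "indep_sets (\<lambda>i. sigma_sets (space M) {incr h i -` A \<inter> space M |A. A \<in> sets (count_space UNIV)}) UNIV"
  proof (subst indep_sets_finite_index_sets, intro allI impI)
    fix J :: "nat set" assume J: "J \<noteq> {}" "finite J"
    then obtain n where "J \<subseteq> {..<n}" using finite_nat_iff_bounded by blast
    with fin[of n] show "indep_sets (\<lambda>i. sigma_sets (space M) {incr h i -` A \<inter> space M |A. A \<in> sets (count_space UNIV)}) J"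
      unfolding indep_vars_def by (auto intro: indep_sets_mono_index)
  qed
qed

lemma incr_distr: assumes h: "h > 0" shows "distr M (count_space UNIV) (incr h i) = measure_pmf (poisson_pmf (lam * h))"
proof -
  have lt: "0 \<le> \<rho> * (h * real i)" "\<rho> * (h * real i) < \<rho> * (h * real (Suc i))" using h rho by auto
  have "distr M (count_space UNIV) (\<lambda>\<omega>. N (\<rho> * (h * real (Suc i))) \<omega> - N (\<rho> * (h * real i)) \<omega>)
    = measure_pmf (poisson_pmf (1 / integral\<^sup>L M B * (\<rho> * (h * real (Suc i)) - \<rho> * (h * real i))))"
    using N_poisson lt unfolding poisson_process_def by blast
  also have "1 / integral\<^sup>L M B * (\<rho> * (h * real (Suc i)) - \<rho> * (h * real i)) = lam * h"
    by (simp add: lam_def m_def algebra_simps)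
  finally show ?thesis by (simp add: incr_def[abs_def])
qed

text \<open>Independence is given for the path of the Poisson process as a whole; the grid increments are a measurable
  function of it.\<close>

lemma incr_Bs_law:
  assumes h: "h > 0"
  shows "distr M (count_seq \<Otimes>\<^sub>M real_seq) (\<lambda>\<omega>. (\<lambda>i. incr h i \<omega>, \<lambda>i. Bs i \<omega>))
     = (\<Pi>\<^sub>M i\<in>UNIV. measure_pmf (poisson_pmf (lam * h))) \<Otimes>\<^sub>M (\<Pi>\<^sub>M i\<in>UNIV. F)"
proof -
  let ?incr = "\<lambda>\<omega> i. incr h i \<omega>" and ?B = "\<lambda>\<omega> i. Bs i \<omega>"
  have lawD: "distr M count_seq ?incr = (\<Pi>\<^sub>M i\<in>UNIV. measure_pmf (poisson_pmf (lam * h)))"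
    using indep_vars_iff_distr_eq_PiM[THEN iffD1, OF _ incr_rv[OF h] incr_indep[OF h]]
    by (simp add: restrict_UNIV incr_distr[OF h])
  have lawB: "distr M real_seq ?B = (\<Pi>\<^sub>M i\<in>UNIV. F)"
    using indep_vars_iff_distr_eq_PiM[THEN iffD1, OF _ Bs_rv Bs_indep]
    by (simp add: restrict_UNIV Bs_distr F_def)
  have rvD: "?incr \<in> measurable M count_seq"
    by (rule measurable_PiM_single') (use incr_rv[OF h] in auto)
  have rvB: "?B \<in> measurable M real_seq"
    by (rule measurable_PiM_single') (use Bs_rv in auto)
  let ?V1 = "vimage_algebra (space M) (\<lambda>\<omega>. \<lambda>t\<in>{0..}. N t \<omega>) (Pi\<^sub>M {0..} (\<lambda>_. count_space UNIV))"
  let ?V2 = "vimage_algebra (space M) ?B real_seq"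
  have V1D: "?incr \<in> measurable ?V1 count_seq"
  proof (rule measurable_PiM_single')
    fix i :: nat
    have path: "(\<lambda>\<omega>. \<lambda>t\<in>{0..}. N t \<omega>) \<in> measurable ?V1 (Pi\<^sub>M {0..} (\<lambda>_. count_space UNIV))"
      by (rule measurable_vimage_algebra1) (auto simp: space_PiM)
    have Nm: "N t \<in> measurable ?V1 (count_space UNIV)" if "t \<ge> 0" for t
      using measurable_compose[OF path measurable_component_singleton[of t]] that by simp
    have [measurable]: "N (\<rho> * (h * real j)) \<in> measurable ?V1 (count_space UNIV)" for j
      using h rho by (intro Nm) auto
    show "(\<lambda>\<omega>. incr h i \<omega>) \<in> measurable ?V1 (count_space UNIV)" unfolding incr_def by measurable
  qed auto
  have V2B: "?B \<in> measurable ?V2 real_seq"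
    by (rule measurable_vimage_algebra1) (auto simp: space_PiM)
  have sp: "space ?V1 = space M" "space ?V2 = space M" by simp_all
  interpret skeleton F "lam * h" h by (rule skel[OF h])
  show ?thesis
  proof (rule pair_measure_eqI[symmetric])
    show "sigma_finite_measure PD" "sigma_finite_measure PB"
      by (auto intro: prob_space_imp_sigma_finite D.P.prob_space_axioms B.P.prob_space_axioms)
    show "sets (PD \<Otimes>\<^sub>M PB) = sets (distr M (count_seq \<Otimes>\<^sub>M real_seq) (\<lambda>\<omega>. (?incr \<omega>, ?B \<omega>)))"
      by (simp add: sets_pair_measure_cong[OF PD_sets PB_sets])
    fix A C assume "A \<in> sets PD" "C \<in> sets PB"
    then have AC: "A \<in> sets count_seq" "C \<in> sets real_seq" by (auto simp: PD_sets PB_sets)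
    have "prob ((?incr -` A \<inter> space M) \<inter> (?B -` C \<inter> space M)) = prob (?incr -` A \<inter> space M) * prob (?B -` C \<inter> space M)"
      using measurable_sets[OF V1D AC(1)] measurable_sets[OF V2B AC(2)] sp by (intro indep_setD[OF N_Bs_indep]) auto
    moreover have "(?incr -` A \<inter> space M) \<inter> (?B -` C \<inter> space M) = (\<lambda>\<omega>. (?incr \<omega>, ?B \<omega>)) -` (A \<times> C) \<inter> space M" by auto
    ultimately have "emeasure M ((\<lambda>\<omega>. (?incr \<omega>, ?B \<omega>)) -` (A \<times> C) \<inter> space M)
        = emeasure M (?incr -` A \<inter> space M) * emeasure M (?B -` C \<inter> space M)"
      by (simp add: emeasure_eq_measure ennreal_mult)
    then show "emeasure PD A * emeasure PB C = emeasure (distr M (count_seq \<Otimes>\<^sub>M real_seq) (\<lambda>\<omega>. (?incr \<omega>, ?B \<omega>))) (A \<times> C)"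
      unfolding lawD[symmetric] lawB[symmetric] using rvD rvB AC by (simp add: emeasure_distr)
  qed
qed

lemma grid_max_law:
  assumes h: "h > 0" and [measurable]: "\<phi> \<in> borel_measurable (borel \<Otimes>\<^sub>M borel)"
  shows "(\<integral>\<^sup>+\<omega>. \<phi> (Bs 0 \<omega>, grid_max h n \<omega>) \<partial>M) = (\<integral>\<^sup>+b. skeleton.max_expect F (lam * h) h n (\<lambda>v. \<phi> (b, v)) \<partial>F)"
proof -
  interpret skeleton F "lam * h" h by (rule skel[OF h])
  have rvD: "(\<lambda>\<omega> i. incr h i \<omega>) \<in> measurable M count_seq"
    by (rule measurable_PiM_single') (use incr_rv[OF h] in auto)
  have rvB: "(\<lambda>\<omega> i. Bs i \<omega>) \<in> measurable M real_seq"
    by (rule measurable_PiM_single') (use Bs_rv in auto)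
  have w: "(\<lambda>z. walk_max h n (fst z) (\<lambda>j. snd z (Suc j))) \<in> borel_measurable (count_seq \<Otimes>\<^sub>M real_seq)"
    using measurable_compose[OF measurable_snd shift_seq_measurable]
    by (intro walk_max_measurable) auto
  then have m: "(\<lambda>z. \<phi> (snd z 0, walk_max h n (fst z) (\<lambda>j. snd z (Suc j)))) \<in> borel_measurable (count_seq \<Otimes>\<^sub>M real_seq)"
    by measurable
  have "(\<integral>\<^sup>+\<omega>. \<phi> (Bs 0 \<omega>, grid_max h n \<omega>) \<partial>M)
    = (\<integral>\<^sup>+z. \<phi> (snd z 0, walk_max h n (fst z) (\<lambda>j. snd z (Suc j))) \<partial>distr M (count_seq \<Otimes>\<^sub>M real_seq) (\<lambda>\<omega>. (\<lambda>i. incr h i \<omega>, \<lambda>i. Bs i \<omega>)))"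
    using rvD rvB m by (subst nn_integral_distr) (auto simp: grid_max_def)
  also have "\<dots> = (\<integral>\<^sup>+z. \<phi> (snd z 0, walk_max h n (fst z) (\<lambda>j. snd z (Suc j))) \<partial>(PD \<Otimes>\<^sub>M PB))"
    unfolding incr_Bs_law[OF h] ..
  also have "\<dots> = (\<integral>\<^sup>+d. (\<integral>\<^sup>+b. \<phi> (b 0, walk_max h n d (\<lambda>j. b (Suc j))) \<partial>PB) \<partial>PD)"
  proof (subst B.P.nn_integral_fst[symmetric])
    show "(\<lambda>z. \<phi> (snd z 0, walk_max h n (fst z) (\<lambda>j. snd z (Suc j)))) \<in> borel_measurable (PD \<Otimes>\<^sub>M PB)"
      using m by (simp add: measurable_cong_sets[OF sets_pair_measure_cong[OF PD_sets PB_sets] refl])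
  qed simp
  also have "\<dots> = (\<integral>\<^sup>+b. max_expect n (\<lambda>v. \<phi> (b, v)) \<partial>F)" by (rule split_first_claim) measurable
  finally show ?thesis .
qed

lemma grid_max_rv: "h > 0 \<Longrightarrow> grid_max h n \<in> borel_measurable M"
  unfolding grid_max_def[abs_def]
  by (intro walk_max_measurable measurable_PiM_single') (use incr_rv Bs_rv in auto)

definition "P_steps h n x = prob {\<omega> \<in> space M. grid_max h n \<omega> \<le> x}"
definition "Q_steps h n x = prob {\<omega> \<in> space M. Bs 0 \<omega> + grid_max h n \<omega> \<le> x}"

lemma P_steps_eq: assumes h: "h > 0" shows "ennreal (P_steps h n x) = skeleton.max_expect F (lam * h) h n (indicator {..x})"
proof -
  interpret skeleton F "lam * h" h by (rule skel[OF h])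
  note grid_max_rv[OF h, measurable]
  have "ennreal (P_steps h n x) = (\<integral>\<^sup>+\<omega>. indicator {\<omega> \<in> space M. grid_max h n \<omega> \<le> x} \<omega> \<partial>M)"
    by (simp add: P_steps_def emeasure_eq_measure)
  also have "\<dots> = (\<integral>\<^sup>+\<omega>. (\<lambda>z. indicator {..x} (snd z)) (Bs 0 \<omega>, grid_max h n \<omega>) \<partial>M)"
    by (intro nn_integral_cong) (auto simp: indicator_def)
  also have "\<dots> = (\<integral>\<^sup>+b. max_expect n (\<lambda>v. indicator {..x} (snd (b, v))) \<partial>F)" by (rule grid_max_law[OF h]) measurable
  also have "\<dots> = max_expect n (indicator {..x})" by (simp add: prob_space.emeasure_space_1[OF F_prob])
  finally show ?thesis .
qed

lemma Q_steps_eq: assumes h: "h > 0" shows "ennreal (Q_steps h n x) = (\<integral>\<^sup>+b. skeleton.max_expect F (lam * h) h n (\<lambda>v. indicator {..x} (b + v)) \<partial>F)"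
proof -
  interpret skeleton F "lam * h" h by (rule skel[OF h])
  note grid_max_rv[OF h, measurable]
  have "ennreal (Q_steps h n x) = (\<integral>\<^sup>+\<omega>. indicator {\<omega> \<in> space M. Bs 0 \<omega> + grid_max h n \<omega> \<le> x} \<omega> \<partial>M)"
    by (simp add: Q_steps_def emeasure_eq_measure)
  also have "\<dots> = (\<integral>\<^sup>+\<omega>. (\<lambda>z. indicator {..x} (fst z + snd z)) (Bs 0 \<omega>, grid_max h n \<omega>) \<partial>M)"
    by (intro nn_integral_cong) (auto simp: indicator_def)
  also have "\<dots> = (\<integral>\<^sup>+b. max_expect n (\<lambda>v. indicator {..x} (fst (b, v) + snd (b, v))) \<partial>F)" by (rule grid_max_law[OF h]) measurable
  finally show ?thesis by simp
qed

lemma P_steps_Suc: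
  assumes h: "h > 0" and x: "x \<ge> 0"
  defines "\<beta> \<equiv> lam * h"
  shows "exp (- \<beta>) * P_steps h n (x + h) + \<beta> * exp (- \<beta>) * Q_steps h n (x + h) \<le> P_steps h (Suc n) x"
    and "P_steps h (Suc n) x \<le> exp (- \<beta>) * P_steps h n (x + h) + \<beta> * exp (- \<beta>) * Q_steps h n (x + h) + \<beta>\<^sup>2"
proof -
  interpret skeleton F "lam * h" h by (rule skel[OF h])
  have nn: "0 \<le> P_steps h n x" "0 \<le> Q_steps h n x" for n x by (auto simp: P_steps_def Q_steps_def)
  have b: "\<beta> \<ge> 0" using lam_pos h by (simp add: \<beta>_def)
  have s: "ennreal (exp (- \<beta>)) * ennreal (P_steps h n (x + h)) + ennreal (\<beta> * exp (- \<beta>)) * ennreal (Q_steps h n (x + h))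
    = ennreal (exp (- \<beta>) * P_steps h n (x + h) + \<beta> * exp (- \<beta>) * Q_steps h n (x + h))"
    using nn b by (simp add: ennreal_mult[symmetric] ennreal_plus[symmetric] del: ennreal_plus)
  show "exp (- \<beta>) * P_steps h n (x + h) + \<beta> * exp (- \<beta>) * Q_steps h n (x + h) \<le> P_steps h (Suc n) x"
    using walk_first_step(1)[OF x, of n, folded P_steps_eq[OF h] Q_steps_eq[OF h], folded \<beta>_def, unfolded s] nn by simp
  have "ennreal (P_steps h (Suc n) x) \<le> ennreal (exp (- \<beta>) * P_steps h n (x + h) + \<beta> * exp (- \<beta>) * Q_steps h n (x + h)) + ennreal (\<beta>\<^sup>2)"
    using walk_first_step(2)[OF x, of n, folded P_steps_eq[OF h] Q_steps_eq[OF h], folded \<beta>_def, unfolded s] .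
  also have "\<dots> = ennreal (exp (- \<beta>) * P_steps h n (x + h) + \<beta> * exp (- \<beta>) * Q_steps h n (x + h) + \<beta>\<^sup>2)"
    using nn b by (intro ennreal_plus[symmetric]) auto
  finally show "P_steps h (Suc n) x \<le> exp (- \<beta>) * P_steps h n (x + h) + \<beta> * exp (- \<beta>) * Q_steps h n (x + h) + \<beta>\<^sup>2"
    using nn b by (subst (asm) ennreal_le_iff) auto
qed

lemma P_steps_drift:
  assumes h: "h > 0" shows "1 - \<rho> \<le> P_steps h n h"
proof -
  interpret skeleton F "lam * h" h by (rule skel[OF h])
  have "ennreal (1 - \<rho>) \<le> max_expect n (indicator {..h})"
    using m_pos by (intro drift[where m = m]) (auto simp: F_mean lam_def)
  then show ?thesis unfolding P_steps_eq[OF h, symmetric] by (simp add: P_steps_def)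
qed

lemma Q_steps_integral:
  assumes h: "h > 0" shows "ennreal (Q_steps h n x) = (\<integral>\<^sup>+b. ennreal (P_steps h n (x - b)) \<partial>F)"
  unfolding Q_steps_eq[OF h] P_steps_eq[OF h]
  by (intro nn_integral_cong arg_cong[where f = "skeleton.max_expect F (lam * h) h n"]) (auto simp: indicator_def)

definition grid :: "real \<Rightarrow> real \<Rightarrow> 'a set" where
  "grid h x = {\<omega> \<in> space M. \<forall>k::nat. path (h * real k) \<omega> \<le> x}"
definition grid0 :: "real \<Rightarrow> real \<Rightarrow> 'a set" where
  "grid0 h x = {\<omega> \<in> space M. \<forall>k::nat. Bs 0 \<omega> + path (h * real k) \<omega> \<le> x}"
definition "P_grid h x = prob (grid h x)"
definition "Q_grid h x = prob (grid0 h x)"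

lemma grid_sets [measurable]: "h > 0 \<Longrightarrow> grid h x \<in> sets M" "h > 0 \<Longrightarrow> grid0 h x \<in> sets M"
proof -
  assume h: "h > 0"
  have [measurable]: "path (h * real k) \<in> borel_measurable M" for k
    using h by (intro path_rv) simp
  show "grid h x \<in> sets M" "grid0 h x \<in> sets M" unfolding grid_def grid0_def by measurable
qed

lemma P_steps_limit:
  assumes h: "h > 0"
  shows "(\<lambda>n. P_steps h n x) \<longlonglongrightarrow> P_grid h x" "(\<lambda>n. Q_steps h n x) \<longlonglongrightarrow> Q_grid h x"
proof -
  note grid_max_rv[OF h, measurable]
  have "(\<lambda>n. P_steps h n x) \<longlonglongrightarrow> prob (\<Inter>n. {\<omega> \<in> space M. grid_max h n \<omega> \<le> x})"
    unfolding P_steps_def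
  proof (rule finite_Lim_measure_decseq)
    show "decseq (\<lambda>n. {\<omega> \<in> space M. grid_max h n \<omega> \<le> x})"
      by (auto simp: decseq_def grid_max_le_iff[OF _ h])
  qed auto
  also have "(\<Inter>n. {\<omega> \<in> space M. grid_max h n \<omega> \<le> x}) = grid h x"
    by (auto simp: grid_def grid_max_le_iff[OF _ h]) blast
  finally show "(\<lambda>n. P_steps h n x) \<longlonglongrightarrow> P_grid h x" by (simp add: P_grid_def)
  have eq: "{\<omega> \<in> space M. Bs 0 \<omega> + grid_max h n \<omega> \<le> x} = {\<omega> \<in> space M. \<forall>k\<le>n. Bs 0 \<omega> + path (h * real k) \<omega> \<le> x}" for n
    using grid_max_le_iff[OF _ h, of _ n "x - Bs 0 _"] by (auto simp: algebra_simps)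
  have "(\<lambda>n. Q_steps h n x) \<longlonglongrightarrow> prob (\<Inter>n. {\<omega> \<in> space M. Bs 0 \<omega> + grid_max h n \<omega> \<le> x})"
    unfolding Q_steps_def
  proof (rule finite_Lim_measure_decseq)
    show "decseq (\<lambda>n. {\<omega> \<in> space M. Bs 0 \<omega> + grid_max h n \<omega> \<le> x})"
      unfolding eq by (auto simp: decseq_def)
  qed auto
  also have "(\<Inter>n. {\<omega> \<in> space M. Bs 0 \<omega> + grid_max h n \<omega> \<le> x}) = grid0 h x"
    unfolding eq by (auto simp: grid0_def)
  finally show "(\<lambda>n. Q_steps h n x) \<longlonglongrightarrow> Q_grid h x" by (simp add: Q_grid_def)
qed

text \<open>Passage to infinitely many grid points in the one-step estimate.\<close>

lemma P_grid_step:
  assumes h: "h > 0" and x: "x \<ge> 0"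
  defines "\<beta> \<equiv> lam * h"
  shows "exp (- \<beta>) * P_grid h (x + h) + \<beta> * exp (- \<beta>) * Q_grid h (x + h) \<le> P_grid h x"
    and "P_grid h x \<le> exp (- \<beta>) * P_grid h (x + h) + \<beta> * exp (- \<beta>) * Q_grid h (x + h) + \<beta>\<^sup>2"
proof -
  have lim: "(\<lambda>n. exp (- \<beta>) * P_steps h n (x + h) + \<beta> * exp (- \<beta>) * Q_steps h n (x + h))
      \<longlonglongrightarrow> exp (- \<beta>) * P_grid h (x + h) + \<beta> * exp (- \<beta>) * Q_grid h (x + h)"
    by (intro tendsto_add tendsto_mult tendsto_const P_steps_limit[OF h])
  note lim' = LIMSEQ_Suc[OF P_steps_limit(1)[OF h, of x]]
  show "exp (- \<beta>) * P_grid h (x + h) + \<beta> * exp (- \<beta>) * Q_grid h (x + h) \<le> P_grid h x"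
    by (rule LIMSEQ_le[OF lim lim']) (use P_steps_Suc(1)[OF h x] in \<open>auto simp: \<beta>_def\<close>)
  show "P_grid h x \<le> exp (- \<beta>) * P_grid h (x + h) + \<beta> * exp (- \<beta>) * Q_grid h (x + h) + \<beta>\<^sup>2"
    by (rule LIMSEQ_le[OF lim' tendsto_add[OF lim tendsto_const]]) (use P_steps_Suc(2)[OF h x] in \<open>auto simp: \<beta>_def\<close>)
qed

lemma P_grid_drift: "h > 0 \<Longrightarrow> 1 - \<rho> \<le> P_grid h h"
  by (rule LIMSEQ_le_const[OF P_steps_limit(1)]) (auto intro: P_steps_drift)

text \<open>All claims are positive almost surely, so before the next grid point the path exceeds its value there by
  at most \<open>h\<close>.\<close>

lemma grid_sandwich:
  assumes h: "h > 0"
  shows "\<Phi> x \<le> P_grid h x" "P_grid h x \<le> \<Phi> (x + h)" "\<Psi> x \<le> Q_grid h x" "Q_grid h x \<le> \<Psi> (x + h)"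
proof -
  have key: "path t \<omega> \<le> x + h" if w: "\<omega> \<in> space M" and pos: "\<forall>i. 0 < Bs i \<omega>"
    and g: "\<And>k::nat. path (h * real k) \<omega> \<le> x" and t: "t \<ge> 0" for t \<omega> x
  proof -
    define k where "k = nat \<lceil>t / h\<rceil>"
    have k: "t / h \<le> real k" "real k < t / h + 1" using t h unfolding k_def by (auto simp: of_nat_ceiling) linarith
    then have tk: "t \<le> h * real k" "h * real k \<le> t + h" using h by (auto simp: field_simps)
    have "N (\<rho> * t) \<omega> \<le> N (\<rho> * (h * real k)) \<omega>" using tk t w rho by (intro N_mono mult_left_mono) auto
    then have "(\<Sum>j<N (\<rho> * t) \<omega>. Bs (Suc j) \<omega>) \<le> (\<Sum>j<N (\<rho> * (h * real k)) \<omega>. Bs (Suc j) \<omega>)"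
      using pos by (intro sum_mono2) (auto intro: less_imp_le)
    then show ?thesis using g[of k] tk unfolding path_eq by linarith
  qed
  show "\<Phi> x \<le> P_grid h x" unfolding \<Phi>_def P_grid_def
    using h by (intro finite_measure_mono grid_sets) (auto simp: below_def grid_def)
  show "\<Psi> x \<le> Q_grid h x" unfolding \<Psi>_def Q_grid_def
    using h by (intro finite_measure_mono grid_sets) (auto simp: below0_def grid0_def)
  show "P_grid h x \<le> \<Phi> (x + h)" unfolding \<Phi>_def P_grid_def
  proof (rule finite_measure_mono_AE)
    show "AE \<omega> in M. \<omega> \<in> grid h x \<longrightarrow> \<omega> \<in> below (x + h)"
      using Bs_pos by eventually_elim (auto simp: grid_def below_def intro: key)
  qed auto
  show "Q_grid h x \<le> \<Psi> (x + h)" unfolding \<Psi>_def Q_grid_def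
  proof (rule finite_measure_mono_AE)
    show "AE \<omega> in M. \<omega> \<in> grid0 h x \<longrightarrow> \<omega> \<in> below0 (x + h)"
      using Bs_pos
    proof eventually_elim
      case (elim \<omega>)
      show ?case
      proof
        assume "\<omega> \<in> grid0 h x"
        then have w: "\<omega> \<in> space M" and g: "path (h * real k) \<omega> \<le> x - Bs 0 \<omega>" for k
          by (auto simp: grid0_def le_diff_eq add.commute)
        have "path t \<omega> \<le> x - Bs 0 \<omega> + h" if "t \<ge> 0" for t by (rule key[OF w elim g that])
        then show "\<omega> \<in> below0 (x + h)" using w by (auto simp: below0_def algebra_simps)
      qed
    qed
  qed auto
qed

lemma Phi_meas [measurable]: "\<Phi> \<in> borel_measurable borel"
  by (rule borel_measurable_mono[OF Phi_mono])
lemma Psi_meas [measurable]: "\<Psi> \<in> borel_measurable borel"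
  by (rule borel_measurable_mono[OF Psi_mono])

lemma F_measurable_iff: "\<phi> \<in> borel_measurable borel \<Longrightarrow> \<phi> \<in> borel_measurable F"
  by (simp add: measurable_cong_sets[OF F_sets refl])

lemma F_limit:
  fixes u :: "nat \<Rightarrow> real \<Rightarrow> real"
  assumes "\<And>n. mono (u n)" "\<And>n y. 0 \<le> u n y \<and> u n y \<le> 1" "\<And>y. (\<lambda>n. u n y) \<longlonglongrightarrow> v y" "v \<in> borel_measurable borel"
  shows "(\<lambda>n. \<integral>\<^sup>+b. ennreal (u n (x - b)) \<partial>F) \<longlonglongrightarrow> (\<integral>\<^sup>+b. ennreal (v (x - b)) \<partial>F)"
proof (rule nn_integral_dominated_convergence[where w = "\<lambda>_. 1"])
  have [measurable]: "u n \<in> borel_measurable borel" for n by (rule borel_measurable_mono) (rule assms)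
  show "(\<lambda>b. ennreal (u n (x - b))) \<in> borel_measurable F" for n
    by (rule F_measurable_iff) measurable
  show "(\<lambda>b. ennreal (v (x - b))) \<in> borel_measurable F"
  proof (rule F_measurable_iff)
    have [measurable]: "v \<in> borel_measurable borel" by fact
    show "(\<lambda>b. ennreal (v (x - b))) \<in> borel_measurable borel" by measurable
  qed
  show "AE b in F. ennreal (u n (x - b)) \<le> 1" for n
    using assms(2)[of n] by (auto simp: ennreal_1[symmetric] intro!: ennreal_leI simp del: ennreal_1)
  show "AE b in F. (\<lambda>n. ennreal (u n (x - b))) \<longlonglongrightarrow> ennreal (v (x - b))"
    by (intro AE_I2 tendsto_ennrealI assms)
qed (auto simp: prob_space.emeasure_space_1[OF F_prob])

lemma Q_grid_integral: assumes h: "h > 0" shows "ennreal (Q_grid h x) = (\<integral>\<^sup>+b. ennreal (P_grid h (x - b)) \<partial>F)"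
proof -
  note grid_max_rv[OF h, measurable]
  have m1: "mono (P_steps h n)" for n
    unfolding P_steps_def[abs_def] by (intro monoI finite_measure_mono) (auto intro: order_trans)
  have "mono (P_grid h)"
    unfolding P_grid_def[abs_def] by (intro monoI finite_measure_mono grid_sets h) (auto simp: grid_def intro: order_trans)
  then have m2: "P_grid h \<in> borel_measurable borel" by (rule borel_measurable_mono)
  have "(\<lambda>n. \<integral>\<^sup>+b. ennreal (P_steps h n (x - b)) \<partial>F) \<longlonglongrightarrow> (\<integral>\<^sup>+b. ennreal (P_grid h (x - b)) \<partial>F)"
    by (intro F_limit m1 m2 P_steps_limit h) (auto simp: P_steps_def)
  moreover have "(\<lambda>n. ennreal (Q_steps h n x)) \<longlonglongrightarrow> ennreal (Q_grid h x)"
    by (intro tendsto_ennrealI P_steps_limit h)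
  ultimately show ?thesis unfolding Q_steps_integral[OF h] by (rule LIMSEQ_unique[symmetric])
qed

text \<open>The initial claim is independent of the walk on every grid; the identity survives the limit
  because \<open>\<Phi>\<close> is right-continuous.\<close>

lemma Psi_integral: "ennreal (\<Psi> x) = (\<integral>\<^sup>+b. ennreal (\<Phi> (x - b)) \<partial>F)"
proof (rule antisym)
  define h where "h n = 1 / real (Suc n)" for n
  have h: "h n > 0" for n by (simp add: h_def)
  have limP: "(\<lambda>n. \<Phi> (y + h n)) \<longlonglongrightarrow> \<Phi> y" and limQ: "(\<lambda>n. \<Psi> (y + h n)) \<longlonglongrightarrow> \<Psi> y" for y
    unfolding h_def by (rule right_limit, simp)+
  have "ennreal (\<Psi> x) \<le> (\<integral>\<^sup>+b. ennreal (\<Phi> (x - b + h n)) \<partial>F)" for n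
  proof -
    have "ennreal (\<Psi> x) \<le> ennreal (Q_grid (h n) x)" by (intro ennreal_leI grid_sandwich h)
    also have "\<dots> \<le> (\<integral>\<^sup>+b. ennreal (\<Phi> (x - b + h n)) \<partial>F)"
      unfolding Q_grid_integral[OF h] by (intro nn_integral_mono ennreal_leI grid_sandwich h)
    finally show ?thesis .
  qed
  moreover have "(\<lambda>n. \<integral>\<^sup>+b. ennreal ((\<lambda>y. \<Phi> (y + h n)) (x - b)) \<partial>F) \<longlonglongrightarrow> (\<integral>\<^sup>+b. ennreal (\<Phi> (x - b)) \<partial>F)"
    by (intro F_limit limP Phi_meas) (auto intro!: monoI monoD[OF Phi_mono] simp: Phi_bounds)
  ultimately show "ennreal (\<Psi> x) \<le> (\<integral>\<^sup>+b. ennreal (\<Phi> (x - b)) \<partial>F)"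
    by (intro LIMSEQ_le_const) auto
  have "(\<integral>\<^sup>+b. ennreal (\<Phi> (x - b)) \<partial>F) \<le> ennreal (\<Psi> (x + h n))" for n
  proof -
    have "(\<integral>\<^sup>+b. ennreal (\<Phi> (x - b)) \<partial>F) \<le> ennreal (Q_grid (h n) x)"
      unfolding Q_grid_integral[OF h] by (intro nn_integral_mono ennreal_leI grid_sandwich h)
    also have "\<dots> \<le> ennreal (\<Psi> (x + h n))" by (intro ennreal_leI grid_sandwich h)
    finally show ?thesis .
  qed
  then show "(\<integral>\<^sup>+b. ennreal (\<Phi> (x - b)) \<partial>F) \<le> ennreal (\<Psi> x)"
    by (intro LIMSEQ_le_const[OF tendsto_ennrealI[OF limQ]]) auto
qed

end

section \<open>Level crossing and the law of the supremum\<close>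

lemma mono_integrable: 
  fixes u :: "real \<Rightarrow> real" assumes "mono u" shows "u integrable_on {a..b}"
  using assms by (intro integrable_on_mono_on) (auto simp: mono_on_def mono_def)

lemma riemann_bounds:
  fixes u :: "real \<Rightarrow> real"
  assumes u: "mono u" and h: "h > 0"
  shows "integral {0..real n * h} u \<le> h * (\<Sum>j<n. u (real (Suc j) * h))"
    and "h * (\<Sum>j<n. u (real j * h)) \<le> integral {0..real n * h} u"
proof -
  have cell: "h * u (real n * h) \<le> integral {real n * h..real (Suc n) * h} u \<and>
      integral {real n * h..real (Suc n) * h} u \<le> h * u (real (Suc n) * h)" for n
  proof -
    have le: "real n * h \<le> real (Suc n) * h" using h by (intro mult_right_mono) auto
    have c: "integral {real n * h..real (Suc n) * h} (\<lambda>_. k) = h * k" for k :: real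
      using le by (simp add: algebra_simps)
    have "integral {real n * h..real (Suc n) * h} (\<lambda>_. u (real n * h)) \<le> integral {real n * h..real (Suc n) * h} u"
      by (intro integral_le mono_integrable u) (auto intro: monoD[OF u])
    moreover have "integral {real n * h..real (Suc n) * h} u \<le> integral {real n * h..real (Suc n) * h} (\<lambda>_. u (real (Suc n) * h))"
      by (intro integral_le mono_integrable u) (auto intro: monoD[OF u])
    ultimately show ?thesis unfolding c by simp
  qed
  have split: "integral {0..real (Suc n) * h} u = integral {0..real n * h} u + integral {real n * h..real (Suc n) * h} u" for n
    using h by (intro Henstock_Kurzweil_Integration.integral_combine[symmetric] mono_integrable u) auto
  show "integral {0..real n * h} u \<le> h * (\<Sum>j<n. u (real (Suc j) * h))"
  proof (induction n)
    case (Suc n)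
    then show ?case using cell[of n] unfolding split by (simp add: distrib_left del: of_nat_Suc)
  qed simp
  show "h * (\<Sum>j<n. u (real j * h)) \<le> integral {0..real n * h} u"
  proof (induction n)
    case (Suc n)
    then show ?case using cell[of n] unfolding split by (simp add: distrib_left del: of_nat_Suc)
  qed simp
qed

text \<open>The values \<open>a j\<close> may overshoot by one cell and are sampled at right end points, which costs two
  cells in total.\<close>

lemma riemann_sandwich:
  fixes u :: "real \<Rightarrow> real"
  assumes u: "mono u" "\<And>x. 0 \<le> u x" "\<And>x. u x \<le> 1" and h: "h > 0"
    and a: "\<And>j. u (real j * h) \<le> a j" "\<And>j. a j \<le> u (real j * h + h)"
  shows "integral {0..real n * h} u \<le> h * (\<Sum>j<n. a (Suc j))"
    and "h * (\<Sum>j<n. a (Suc j)) \<le> integral {0..real n * h} u + 2 * h"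
proof -
  have "h * (\<Sum>j<n. u (real (Suc j) * h)) \<le> h * (\<Sum>j<n. a (Suc j))"
    using h a(1)[of "Suc _"] by (intro mult_left_mono sum_mono) auto
  with riemann_bounds(1)[OF u(1) h, of n] show "integral {0..real n * h} u \<le> h * (\<Sum>j<n. a (Suc j))" by linarith
  have shift: "(\<Sum>j<n. u (real (Suc (Suc j)) * h)) \<le> (\<Sum>j<n. u (real j * h)) + 2"
  proof -
    have "(\<Sum>j<n. v (Suc j)) = (\<Sum>j<n. v j) + v n - v 0" for v :: "nat \<Rightarrow> real"
      by (induction n) auto
    from this[of "\<lambda>j. u (real (Suc j) * h)"] this[of "\<lambda>j. u (real j * h)"]
    show ?thesis using u(2)[of "real (Suc 0) * h"] u(3)[of "real (Suc n) * h"] u(2)[of "real 0 * h"] u(3)[of "real n * h"]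
      by linarith
  qed
  have "h * (\<Sum>j<n. a (Suc j)) \<le> h * (\<Sum>j<n. u (real (Suc (Suc j)) * h))"
  proof (intro mult_left_mono sum_mono)
    fix j show "a (Suc j) \<le> u (real (Suc (Suc j)) * h)"
      using a(2)[of "Suc j"] by (simp add: algebra_simps)
  qed (use h in simp)
  also have "\<dots> \<le> h * ((\<Sum>j<n. u (real j * h)) + 2)" using h shift by (intro mult_left_mono) auto
  also have "\<dots> \<le> integral {0..real n * h} u + 2 * h"
    using riemann_bounds(2)[OF u(1) h, of n] by (simp add: algebra_simps)
  finally show "h * (\<Sum>j<n. a (Suc j)) \<le> integral {0..real n * h} u + 2 * h" .
qed

lemma exp_recursion_bound:
  fixes \<beta> p q r :: real
  assumes b: "\<beta> \<ge> 0" and p: "0 \<le> p" "p \<le> 1" and q: "0 \<le> q" "q \<le> 1"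
    and l: "exp (- \<beta>) * p + \<beta> * exp (- \<beta>) * q \<le> r" and r: "r \<le> exp (- \<beta>) * p + \<beta> * exp (- \<beta>) * q + \<beta>\<^sup>2"
  shows "\<bar>p - r - \<beta> * (p - q)\<bar> \<le> 2 * \<beta>\<^sup>2"
proof -
  have e1: "1 - \<beta> \<le> exp (- \<beta>)" using exp_ge_add_one_self[of "- \<beta>"] by simp
  have e2: "exp (- \<beta>) \<le> 1 - \<beta> + \<beta>\<^sup>2"
  proof -
    have "(1 - \<beta> + \<beta>\<^sup>2) * (1 + \<beta>) = 1 + \<beta> ^ 3" by (simp add: power2_eq_square power3_eq_cube algebra_simps)
    then have "1 \<le> (1 - \<beta> + \<beta>\<^sup>2) * (1 + \<beta>)" using b by simp
    also have "\<dots> \<le> (1 - \<beta> + \<beta>\<^sup>2) * exp \<beta>"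
    proof (intro mult_left_mono exp_ge_add_one_self)
      have "0 \<le> (1 - \<beta> / 2)\<^sup>2 + 3 / 4 * \<beta>\<^sup>2" by simp
      also have "\<dots> = 1 - \<beta> + \<beta>\<^sup>2" by (simp add: power2_eq_square algebra_simps)
      finally show "0 \<le> 1 - \<beta> + \<beta>\<^sup>2" .
    qed
    finally show ?thesis by (simp add: exp_minus field_simps)
  qed
  have e3: "exp (- \<beta>) \<le> 1" using b by simp
  have "(1 - exp (- \<beta>)) * p \<le> \<beta> * p" using e1 p by (intro mult_right_mono) auto
  moreover have "(\<beta> - \<beta>\<^sup>2) * p \<le> (1 - exp (- \<beta>)) * p" using e2 p by (intro mult_right_mono) auto
  moreover have "\<beta>\<^sup>2 * p \<le> \<beta>\<^sup>2 * 1" using p by (intro mult_left_mono) auto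
  moreover have "(\<beta> - \<beta>\<^sup>2) * q \<le> \<beta> * exp (- \<beta>) * q"
  proof (rule mult_right_mono)
    have "\<beta> * (1 - \<beta>) \<le> \<beta> * exp (- \<beta>)" using e1 b by (intro mult_left_mono) auto
    then show "\<beta> - \<beta>\<^sup>2 \<le> \<beta> * exp (- \<beta>)" by (simp add: algebra_simps power2_eq_square)
  qed (use q in simp)
  moreover have "\<beta> * exp (- \<beta>) * q \<le> \<beta> * q" using e3 b q by (intro mult_right_mono) (auto intro: mult_left_le)
  moreover have "\<beta>\<^sup>2 * q \<le> \<beta>\<^sup>2 * 1" using q by (intro mult_left_mono) auto
  ultimately show ?thesis using l r unfolding abs_le_iff by (simp only: left_diff_distrib right_diff_distrib mult_1_left mult_1_right) linarith
qed

context queue begin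

text \<open>Summing the one-step estimate along \<open>x = 0, h, 2h, \<dots>, c\<close> gives a telescoping sum on the left and Riemann
  sums on the right; the errors \<open>O(h\<^sup>2)\<close> add up to \<open>O(h)\<close>. Sandwiching is postponed until after the
  summation, since a shift by \<open>h\<close> in a single step is as large as the step itself.\<close>

lemma level_crossing:
  assumes c: "c > 0"
  shows "\<Phi> c - \<Phi> 0 = lam * (integral {0..c} \<Phi> - integral {0..c} \<Psi>)"
proof -
  define h where "h k = c / real (Suc k)" for k
  define I where "I = lam * (integral {0..c} \<Phi> - integral {0..c} \<Psi>)"
  define K where "K = 2 * lam\<^sup>2 * c + 2 * lam"
  have h: "h k > 0" for k using c by (simp add: h_def)
  have nh: "real (Suc k) * h k = c" for k by (simp add: h_def)
  have main: "\<bar>P_grid (h k) c - P_grid (h k) 0 - I\<bar> \<le> h k * K" for k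
  proof -
    define \<beta> where "\<beta> = lam * h k"
    have b: "\<beta> \<ge> 0" using lam_pos h[of k] by (simp add: \<beta>_def)
    define p q where "p j = P_grid (h k) (real j * h k)" and "q j = Q_grid (h k) (real j * h k)" for j
    have pq: "0 \<le> p j" "p j \<le> 1" "0 \<le> q j" "q j \<le> 1" for j by (auto simp: p_def q_def P_grid_def Q_grid_def)
    have step: "\<bar>p (Suc j) - p j - \<beta> * (p (Suc j) - q (Suc j))\<bar> \<le> 2 * \<beta>\<^sup>2" for j
    proof -
      have x: "real j * h k \<ge> 0" using h[of k] by simp
      have e: "real j * h k + h k = real (Suc j) * h k" by (simp add: algebra_simps)
      show ?thesis using P_grid_step[OF h[of k] x, folded \<beta>_def] pq b
        unfolding e p_def[symmetric] q_def[symmetric] by (intro exp_recursion_bound) auto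
    qed
    have sum: "\<bar>p n - p 0 - \<beta> * (\<Sum>j<n. p (Suc j)) + \<beta> * (\<Sum>j<n. q (Suc j))\<bar> \<le> real n * (2 * \<beta>\<^sup>2)" for n
    proof (induction n)
      case (Suc n)
      have "p (Suc n) - p 0 - \<beta> * (\<Sum>j<Suc n. p (Suc j)) + \<beta> * (\<Sum>j<Suc n. q (Suc j))
        = (p n - p 0 - \<beta> * (\<Sum>j<n. p (Suc j)) + \<beta> * (\<Sum>j<n. q (Suc j))) + (p (Suc n) - p n - \<beta> * (p (Suc n) - q (Suc n)))"
        by (simp add: algebra_simps)
      then show ?case using Suc step[of n] by (simp add: distrib_right)
    qed simp
    have ps: "integral {0..c} \<Phi> \<le> h k * (\<Sum>j<Suc k. p (Suc j))" "h k * (\<Sum>j<Suc k. p (Suc j)) \<le> integral {0..c} \<Phi> + 2 * h k"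
      using riemann_sandwich[OF Phi_mono Phi_bounds h[of k], of p "Suc k"] grid_sandwich[OF h[of k]]
      unfolding nh by (auto simp: p_def)
    have qs: "integral {0..c} \<Psi> \<le> h k * (\<Sum>j<Suc k. q (Suc j))" "h k * (\<Sum>j<Suc k. q (Suc j)) \<le> integral {0..c} \<Psi> + 2 * h k"
      using riemann_sandwich[OF Psi_mono Psi_bounds h[of k], of q "Suc k"] grid_sandwich[OF h[of k]]
      unfolding nh by (auto simp: q_def)
    define s t where "s = h k * (\<Sum>j<Suc k. p (Suc j))" and "t = h k * (\<Sum>j<Suc k. q (Suc j))"
    have "real (Suc k) * (2 * \<beta>\<^sup>2) = 2 * lam\<^sup>2 * (real (Suc k) * h k) * h k"
      by (simp add: \<beta>_def power2_eq_square)
    then have a: "real (Suc k) * (2 * \<beta>\<^sup>2) = h k * (2 * lam\<^sup>2 * c)" unfolding nh by simp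
    have "\<bar>p (Suc k) - p 0 - lam * s + lam * t\<bar> \<le> h k * (2 * lam\<^sup>2 * c)"
      using sum[of "Suc k", unfolded a] unfolding s_def t_def \<beta>_def by (simp only: mult.assoc)
    moreover have "\<bar>lam * s - lam * t - I\<bar> \<le> h k * (2 * lam)"
    proof -
      have "\<bar>(s - integral {0..c} \<Phi>) - (t - integral {0..c} \<Psi>)\<bar> \<le> 2 * h k"
        using ps qs unfolding s_def[symmetric] t_def[symmetric] by linarith
      then have "lam * \<bar>(s - integral {0..c} \<Phi>) - (t - integral {0..c} \<Psi>)\<bar> \<le> lam * (2 * h k)"
        using lam_pos by (intro mult_left_mono) auto
      moreover have "lam * s - lam * t - I = lam * ((s - integral {0..c} \<Phi>) - (t - integral {0..c} \<Psi>))"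
        by (simp add: I_def algebra_simps)
      ultimately show ?thesis using lam_pos by (simp add: abs_mult mult_ac)
    qed
    ultimately have "\<bar>p (Suc k) - p 0 - I\<bar> \<le> h k * (2 * lam\<^sup>2 * c) + h k * (2 * lam)" by linarith
    then show ?thesis unfolding p_def nh by (simp add: K_def distrib_left)
  qed
  have h0: "(\<lambda>k. h k * K) \<longlonglongrightarrow> 0"
  proof -
    have "(\<lambda>k. c * (1 / real (Suc k)) * K) \<longlonglongrightarrow> c * 0 * K"
      by (intro tendsto_intros LIMSEQ_Suc[OF lim_1_over_n])
    then show ?thesis by (simp add: h_def)
  qed
  have up: "\<Phi> c - \<Phi> (0 + h k) - I \<le> h k * K" and lo: "- (h k * K) \<le> \<Phi> (c + h k) - \<Phi> 0 - I" for k
    using main[of k] grid_sandwich(1,2)[OF h[of k], of c] grid_sandwich(1,2)[OF h[of k], of 0] by (auto simp: abs_le_iff)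
  have "(\<lambda>k. \<Phi> c - \<Phi> (0 + h k) - I) \<longlonglongrightarrow> \<Phi> c - \<Phi> 0 - I"
    unfolding h_def by (intro tendsto_intros right_limit c)
  then have "\<Phi> c - \<Phi> 0 - I \<le> 0" by (rule LIMSEQ_le[OF _ h0]) (use up in auto)
  moreover have "(\<lambda>k. \<Phi> (c + h k) - \<Phi> 0 - I) \<longlonglongrightarrow> \<Phi> c - \<Phi> 0 - I"
    unfolding h_def by (intro tendsto_intros right_limit c)
  then have "- 0 \<le> \<Phi> c - \<Phi> 0 - I" by (rule LIMSEQ_le[OF tendsto_minus[OF h0]]) (use lo in auto)
  ultimately show ?thesis by (simp add: I_def)
qed

text \<open>The density of \<open>W\<close> on the positive half-line, as suggested by \<open>level_crossing\<close>; see \<open>Phi_eq\<close>.\<close>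

definition f :: "real \<Rightarrow> real" where "f y = (if y < 0 then 0 else lam * (\<Phi> y - \<Psi> y))"
definition tail :: "real \<Rightarrow> real" where "tail y = prob {\<omega> \<in> space M. B \<omega> > y}"
text \<open>The density of the excess distribution.\<close>

definition g :: "real \<Rightarrow> real" where "g y = (if y < 0 then 0 else tail y / m)"

lemma Psi_le_Phi: "\<Psi> x \<le> \<Phi> x"
proof -
  have "ennreal (\<Psi> x) \<le> (\<integral>\<^sup>+b. ennreal (\<Phi> x) \<partial>F)"
    unfolding Psi_integral using F_pos
    by (intro nn_integral_mono_AE) (auto elim!: eventually_mono intro!: ennreal_leI monoD[OF Phi_mono])
  also have "\<dots> = ennreal (\<Phi> x)" by (simp add: prob_space.emeasure_space_1[OF F_prob])
  finally show ?thesis by (simp add: Phi_bounds)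
qed

lemma f_nonneg: "0 \<le> f y" using Psi_le_Phi[of y] lam_pos by (simp add: f_def)
lemma f_neg: "y < 0 \<Longrightarrow> f y = 0" by (simp add: f_def)
lemma f_le: "f y \<le> lam"
proof (cases "y < 0")
  case False
  have "lam * (\<Phi> y - \<Psi> y) \<le> lam * 1" using lam_pos Phi_bounds(2)[of y] Psi_bounds(1)[of y] by (intro mult_left_mono) auto
  then show ?thesis using False by (simp add: f_def)
qed (use lam_pos in \<open>simp add: f_def\<close>)
lemma f_meas [measurable]: "f \<in> borel_measurable borel" unfolding f_def[abs_def] by measurable

lemma Phi_eq:
  assumes c: "c \<ge> 0"
  shows "ennreal (\<Phi> c) = ennreal (\<Phi> 0) + (\<integral>\<^sup>+w. ennreal (f w) * indicator {0..c} w \<partial>lborel)"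
proof (cases "c = 0")
  case True
  have "(\<integral>\<^sup>+w. ennreal (f w) * indicator {0..0} w \<partial>lborel) = (\<integral>\<^sup>+w. 0 \<partial>(lborel :: real measure))"
    using AE_lborel_singleton[of 0] by (intro nn_integral_cong_AE) (auto elim!: eventually_mono simp: indicator_def)
  then show ?thesis using True by simp
next
  case False
  then have c: "c > 0" using assms by simp
  have "((\<lambda>w. lam * (\<Phi> w - \<Psi> w)) has_integral lam * (integral {0..c} \<Phi> - integral {0..c} \<Psi>)) {0..c}"
    by (intro has_integral_mult_right has_integral_diff integrable_integral mono_integrable Phi_mono Psi_mono)
  then have "(f has_integral (\<Phi> c - \<Phi> 0)) {0..c}"
    unfolding level_crossing[OF c] by (rule has_integral_eq[rotated]) (simp add: f_def)
  then have "((\<lambda>w. if w \<in> {0..c} then f w else 0) has_integral (\<Phi> c - \<Phi> 0)) UNIV"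
    by (simp only: has_integral_restrict_UNIV)
  then have "(\<integral>\<^sup>+w. ennreal (if w \<in> {0..c} then f w else 0) \<partial>lborel) = ennreal (\<Phi> c - \<Phi> 0)"
    by (intro nn_integral_has_integral_lborel) (auto simp: f_nonneg)
  also have "(\<integral>\<^sup>+w. ennreal (if w \<in> {0..c} then f w else 0) \<partial>lborel) = (\<integral>\<^sup>+w. ennreal (f w) * indicator {0..c} w \<partial>lborel)"
    by (intro nn_integral_cong) (auto simp: indicator_def)
  finally show ?thesis using monoD[OF Phi_mono, of 0 c] c Phi_bounds
    by (simp add: ennreal_plus[symmetric] del: ennreal_plus)
qed

lemma tail_meas [measurable]: "tail \<in> borel_measurable borel"
proof -
  have "mono (\<lambda>y. - tail y)"
    unfolding tail_def by (intro monoI le_imp_neg_le finite_measure_mono) auto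
  then have "(\<lambda>y. - tail y) \<in> borel_measurable borel" by (rule borel_measurable_mono)
  then show ?thesis by simp
qed

lemma tail_eq: "emeasure F {y<..} = ennreal (tail y)"
  unfolding F_def tail_def by (subst emeasure_distr) (auto simp: emeasure_eq_measure intro!: arg_cong[where f = prob])

lemma tail_integral: "ennreal (tail y) = (\<integral>\<^sup>+b. (if b > y then 1 else 0) \<partial>F)"
proof -
  have "(\<integral>\<^sup>+b. (if b > y then 1 else 0) \<partial>F) = (\<integral>\<^sup>+b. indicator {y<..} b \<partial>F)"
    by (intro nn_integral_cong) (auto simp: indicator_def)
  then show ?thesis by (simp add: tail_eq)
qed

lemma g_meas [measurable]: "g \<in> borel_measurable borel" unfolding g_def[abs_def] by measurable
lemma g_nonneg: "0 \<le> g y" using m_pos by (simp add: g_def tail_def)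

text \<open>Inserting the law of \<open>W\<close> into \<open>Psi_integral\<close> and exchanging the integrations: the difference is
  the probability that \<open>W \<le> x\<close> and that the initial claim carries \<open>W\<close> above \<open>x\<close>.\<close>

lemma Phi_minus_Psi:
  assumes x: "x \<ge> 0"
  shows "ennreal (\<Phi> x - \<Psi> x) = ennreal (\<Phi> 0) * ennreal (tail x)
     + (\<integral>\<^sup>+w. ennreal (f w) * indicator {0..x} w * ennreal (tail (x - w)) \<partial>lborel)"
proof -
  interpret F: prob_space F by (rule F_prob)
  interpret FL: pair_sigma_finite F lborel
    by (simp add: pair_sigma_finite_def prob_space_imp_sigma_finite[OF F_prob] lborel.sigma_finite_measure_axioms)
  let ?p = "ennreal (\<Phi> 0)"
  let ?R = "ennreal (\<Phi> 0) * ennreal (tail x) + (\<integral>\<^sup>+w. ennreal (f w) * indicator {0..x} w * ennreal (tail (x - w)) \<partial>lborel)"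
  let ?h = "\<lambda>b w. ennreal (f w) * indicator {0..x} w * (if b > x - w then 1 else 0)"
  note t = tail_integral
  have m1: "(\<lambda>(b, w). ?h b w) \<in> borel_measurable (F \<Otimes>\<^sub>M lborel)" by measurable
  have "(\<integral>\<^sup>+w. ennreal (f w) * indicator {0..x} w * ennreal (tail (x - w)) \<partial>lborel) = (\<integral>\<^sup>+w. (\<integral>\<^sup>+b. ?h b w \<partial>F) \<partial>lborel)"
    unfolding t by (intro nn_integral_cong nn_integral_cmult[symmetric]) measurable
  also have "\<dots> = (\<integral>\<^sup>+b. (\<integral>\<^sup>+w. ?h b w \<partial>lborel) \<partial>F)" by (rule FL.Fubini'[OF m1])
  finally have R2: "(\<integral>\<^sup>+w. ennreal (f w) * indicator {0..x} w * ennreal (tail (x - w)) \<partial>lborel) = \<dots>" .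
  have R1: "?p * ennreal (tail x) = (\<integral>\<^sup>+b. ?p * (if b > x then 1 else 0) \<partial>F)"
    unfolding t by (intro nn_integral_cmult[symmetric]) measurable
  define t1 t2 t3 where "t1 b = ennreal (\<Phi> (x - b))" and "t2 b = ?p * (if b > x then 1 else 0)"
    and "t3 b = (\<integral>\<^sup>+w. ?h b w \<partial>lborel)" for b
  have m3: "t3 \<in> borel_measurable F"
    unfolding t3_def using lborel.borel_measurable_nn_integral[OF m1] .
  have m12: "t1 \<in> borel_measurable F" "t2 \<in> borel_measurable F" unfolding t1_def t2_def by measurable
  have "ennreal (\<Psi> x) + ?R = (\<integral>\<^sup>+b. t1 b \<partial>F) + ((\<integral>\<^sup>+b. t2 b \<partial>F) + (\<integral>\<^sup>+b. t3 b \<partial>F))"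
    unfolding t1_def t2_def t3_def Psi_integral R1 R2 ..
  also have "\<dots> = (\<integral>\<^sup>+b. t1 b + (t2 b + t3 b) \<partial>F)"
    using m12 m3 by (simp add: nn_integral_add)
  also have "\<dots> = (\<integral>\<^sup>+b. ennreal (\<Phi> x) \<partial>F)"
  proof (rule nn_integral_cong_AE)
    show "AE b in F. t1 b + (t2 b + t3 b) = ennreal (\<Phi> x)"
      unfolding t1_def t2_def t3_def using F_pos
    proof eventually_elim
      case (elim b)
      show ?case
      proof (cases "b > x")
        case True
        have "(\<integral>\<^sup>+w. ?h b w \<partial>lborel) = (\<integral>\<^sup>+w. ennreal (f w) * indicator {0..x} w \<partial>lborel)"
          using True by (intro nn_integral_cong) (auto simp: indicator_def)
        then show ?thesis using True x by (simp add: Phi_neg Phi_eq[of x])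
      next
        case False
        have "(\<integral>\<^sup>+w. ennreal (f w) * indicator {0..x} w \<partial>lborel)
          = (\<integral>\<^sup>+w. ennreal (f w) * indicator {0..x - b} w + ?h b w \<partial>lborel)"
          using False elim by (intro nn_integral_cong) (auto simp: indicator_def)
        also have "\<dots> = (\<integral>\<^sup>+w. ennreal (f w) * indicator {0..x - b} w \<partial>lborel) + (\<integral>\<^sup>+w. ?h b w \<partial>lborel)"
          by (rule nn_integral_add) measurable
        finally show ?thesis using False x by (simp add: Phi_eq[of x] Phi_eq[of "x - b"] add.assoc)
      qed
    qed
  qed
  also have "\<dots> = ennreal (\<Psi> x) + ennreal (\<Phi> x - \<Psi> x)"
    using Psi_le_Phi[of x] Psi_bounds by (simp add: F.emeasure_space_1 ennreal_plus[symmetric] del: ennreal_plus)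
  finally show ?thesis by (simp add: ennreal_add_left_cancel)
qed

lemma f_renewal:
  "(\<lambda>x. ennreal (f x)) = (\<lambda>x. ennreal (\<rho> * \<Phi> 0) * ennreal (g x) + ennreal \<rho> * ((\<lambda>x. ennreal (g x)) \<diamondop> (\<lambda>x. ennreal (f x))) x)"
proof
  fix x
  show "ennreal (f x) = ennreal (\<rho> * \<Phi> 0) * ennreal (g x) + ennreal \<rho> * ((\<lambda>x. ennreal (g x)) \<diamondop> (\<lambda>x. ennreal (f x))) x"
  proof (cases "x < 0")
    case True
    have "g (x - y) = 0 \<or> f y = 0" for y using True by (cases "y < 0") (auto simp: g_def f_def)
    then have "((\<lambda>x. ennreal (g x)) \<diamondop> (\<lambda>x. ennreal (f x))) x = (\<integral>\<^sup>+y. 0 \<partial>(lborel::real measure))"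
      unfolding conv_def by (intro nn_integral_cong) (metis ennreal_0 mult_zero_left mult_zero_right)
    then show ?thesis using True by (simp add: f_def g_def)
  next
    case False
    have lt: "ennreal lam * ennreal (tail y) = ennreal \<rho> * ennreal (g y)" if "y \<ge> 0" for y
      using that lam_pos rho m_pos by (simp add: ennreal_mult'[symmetric] g_def lam_def tail_def)
    have "ennreal (f x) = ennreal lam * ennreal (\<Phi> x - \<Psi> x)"
      using False lam_pos Psi_le_Phi[of x] by (simp add: f_def ennreal_mult)
    also have "\<dots> = ennreal (\<Phi> 0) * (ennreal lam * ennreal (tail x))
       + ennreal lam * (\<integral>\<^sup>+w. ennreal (f w) * indicator {0..x} w * ennreal (tail (x - w)) \<partial>lborel)"
      using False by (simp add: Phi_minus_Psi distrib_left mult_ac)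
    also have "ennreal lam * (\<integral>\<^sup>+w. ennreal (f w) * indicator {0..x} w * ennreal (tail (x - w)) \<partial>lborel)
      = (\<integral>\<^sup>+w. ennreal \<rho> * (ennreal (g (x - w)) * ennreal (f w)) \<partial>lborel)"
    proof (subst nn_integral_cmult[symmetric], measurable, rule nn_integral_cong)
      fix w
      show "ennreal lam * (ennreal (f w) * indicator {0..x} w * ennreal (tail (x - w))) = ennreal \<rho> * (ennreal (g (x - w)) * ennreal (f w))"
      proof (cases "0 \<le> w \<and> w \<le> x")
        case True
        then have "ennreal lam * (ennreal (f w) * indicator {0..x} w * ennreal (tail (x - w))) = ennreal (f w) * (ennreal lam * ennreal (tail (x - w)))"
          by (simp add: mult_ac)
        also have "\<dots> = ennreal (f w) * (ennreal \<rho> * ennreal (g (x - w)))" using True by (simp add: lt)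
        finally show ?thesis by (simp add: mult_ac)
      next
        case False
        then show ?thesis by (auto simp: f_def g_def indicator_def)
      qed
    qed
    also have "\<dots> = ennreal \<rho> * ((\<lambda>x. ennreal (g x)) \<diamondop> (\<lambda>x. ennreal (f x))) x"
      unfolding conv_def by (rule nn_integral_cmult) measurable
    also have "ennreal lam * ennreal (tail x) = ennreal \<rho> * ennreal (g x)" using False by (simp add: lt)
    finally show ?thesis using rho Phi_bounds by (simp add: ennreal_mult mult_ac)
  qed
qed

text \<open>Integrating the renewal equation gives mass \<open>\<rho> * \<Phi> 0 / (1 - \<rho>)\<close> for the density. As the total mass is at
  most one, \<open>\<Phi> 0 \<le> 1 - \<rho>\<close>; the reverse inequality is the drift estimate on ever finer grids.\<close>

lemma atom_and_mass:
  assumes gm: "(\<integral>\<^sup>+x. ennreal (g x) \<partial>lborel) = 1"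
  shows "\<Phi> 0 = 1 - \<rho>" and "(\<integral>\<^sup>+x. ennreal (f x) \<partial>lborel) = ennreal \<rho>"
proof -
  let ?I = "\<integral>\<^sup>+x. ennreal (f x) \<partial>lborel"
  have "?I = (\<integral>\<^sup>+x. (SUP n. ennreal (f x) * indicator {0..real n} x) \<partial>lborel)"
  proof (rule nn_integral_cong)
    fix x
    show "ennreal (f x) = (SUP n. ennreal (f x) * indicator {0..real n} x)"
    proof (cases "x < 0")
      case True then show ?thesis by (simp add: f_def)
    next
      case False
      obtain n :: nat where "x \<le> real n" using real_arch_simple by blast
      with False have "ennreal (f x) \<le> (SUP n. ennreal (f x) * indicator {0..real n} x)"
        by (intro SUP_upper2[of n]) auto
      moreover have "(SUP n. ennreal (f x) * indicator {0..real n} x) \<le> ennreal (f x)"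
        by (intro SUP_least) (auto simp: indicator_def)
      ultimately show ?thesis by (rule antisym)
    qed
  qed
  also have "\<dots> = (SUP n. \<integral>\<^sup>+x. ennreal (f x) * indicator {0..real n} x \<partial>lborel)"
    by (intro nn_integral_monotone_convergence_SUP) (auto simp: incseq_def le_fun_def indicator_def)
  finally have I: "?I = \<dots>" .
  have "ennreal (\<Phi> 0) + ?I = (SUP n. ennreal (\<Phi> 0) + (\<integral>\<^sup>+x. ennreal (f x) * indicator {0..real n} x \<partial>lborel))"
    unfolding I by (rule ennreal_SUP_add_right) simp
  also have "\<dots> \<le> 1"
  proof (rule SUP_least)
    fix n
    have "ennreal (\<Phi> (real n)) \<le> 1" using Phi_bounds(2)[of "real n"] by (simp add: ennreal_le_1)
    then show "ennreal (\<Phi> 0) + (\<integral>\<^sup>+x. ennreal (f x) * indicator {0..real n} x \<partial>lborel) \<le> 1"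
      using Phi_eq[of "real n"] by simp
  qed
  finally have total: "ennreal (\<Phi> 0) + ?I \<le> 1" .
  then have "?I \<le> 1" by (metis add_increasing2 order_trans order_refl add.commute zero_le)
  then obtain r where r: "?I = ennreal r" "r \<ge> 0" by (cases ?I) (auto simp: top_unique)
  have "?I = (\<integral>\<^sup>+x. ennreal (\<rho> * \<Phi> 0) * ennreal (g x) + ennreal \<rho> * ((\<lambda>x. ennreal (g x)) \<diamondop> (\<lambda>x. ennreal (f x))) x \<partial>lborel)"
    by (subst f_renewal) simp
  also have "\<dots> = ennreal (\<rho> * \<Phi> 0) * 1 + ennreal \<rho> * (1 * ?I)"
    by (simp add: nn_integral_add nn_integral_cmult nn_integral_conv gm)
  finally have "ennreal r = ennreal (\<rho> * \<Phi> 0 + \<rho> * r)"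
    unfolding r using rho r Phi_bounds by (simp add: ennreal_mult[symmetric] ennreal_plus[symmetric] del: ennreal_plus)
  then have r1: "r = \<rho> * \<Phi> 0 + \<rho> * r" using rho r Phi_bounds by (subst (asm) ennreal_inj) auto
  have r2: "\<Phi> 0 + r \<le> 1" using total r Phi_bounds
    by (simp add: ennreal_plus[symmetric] ennreal_1[symmetric] del: ennreal_plus ennreal_1)
  have r3: "1 - \<rho> \<le> \<Phi> 0"
  proof (rule LIMSEQ_le_const[OF right_limit(1)[of 1 0]])
    have "1 - \<rho> \<le> \<Phi> (0 + 1 / real (Suc n))" for n
    proof -
      define h where "h = 1 / real (Suc n) / 2"
      have h: "h > 0" by (simp add: h_def)
      have "1 - \<rho> \<le> P_grid h h" by (rule P_grid_drift[OF h])
      also have "\<dots> \<le> \<Phi> (h + h)" by (rule grid_sandwich[OF h])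
      also have "h + h = 0 + 1 / real (Suc n)" unfolding h_def by (simp only: field_sum_of_halves add_0_left)
      finally show ?thesis .
    qed
    then show "\<exists>N. \<forall>n\<ge>N. 1 - \<rho> \<le> \<Phi> (0 + 1 / real (Suc n))" by blast
  qed simp
  have "(1 - \<rho>) * r = \<rho> * \<Phi> 0" using r1 by (simp add: algebra_simps)
  moreover have "(1 - \<rho>) * (\<Phi> 0 + r) \<le> (1 - \<rho>) * 1" using r2 rho by (intro mult_left_mono) auto
  ultimately have "\<Phi> 0 \<le> 1 - \<rho>" by (simp add: algebra_simps)
  with r3 show p0: "\<Phi> 0 = 1 - \<rho>" by simp
  have "(1 - \<rho>) * r = (1 - \<rho>) * \<rho>" using \<open>(1 - \<rho>) * r = \<rho> * \<Phi> 0\<close> p0 by simp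
  then have "r = \<rho>" using rho by simp
  then show "?I = ennreal \<rho>" using r by simp
qed

section \<open>Local probabilities\<close>

lemma all_time_sup_le_iff:
  assumes "\<omega> \<in> space M"
  shows "all_time_sup Bs N \<rho> \<omega> \<le> ereal y \<longleftrightarrow> \<omega> \<in> below0 y"
  using assms by (auto simp: all_time_sup_def net_input_def below0_def path_def SUP_le_iff add_diff_eq)

lemma all_time_sup_less:
  "{\<omega> \<in> space M. all_time_sup Bs N \<rho> \<omega> < ereal y} = (\<Union>n. below0 (y - 1 / real (Suc n)))"
proof (intro equalityI subsetI)
  fix \<omega> assume "\<omega> \<in> {\<omega> \<in> space M. all_time_sup Bs N \<rho> \<omega> < ereal y}"
  then have w: "\<omega> \<in> space M" "all_time_sup Bs N \<rho> \<omega> < ereal y" by auto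
  obtain z where z: "all_time_sup Bs N \<rho> \<omega> < ereal z" "ereal z < ereal y" using ereal_dense2[OF w(2)] by blast
  then obtain n where "1 / real (Suc n) < y - z" using nat_approx_posE[of "y - z"] by auto
  then have "ereal z \<le> ereal (y - 1 / real (Suc n))" by simp
  with z have "all_time_sup Bs N \<rho> \<omega> \<le> ereal (y - 1 / real (Suc n))" by (meson less_imp_le order_trans)
  then show "\<omega> \<in> (\<Union>n. below0 (y - 1 / real (Suc n)))" using all_time_sup_le_iff[OF w(1)] by blast
next
  fix \<omega> assume "\<omega> \<in> (\<Union>n. below0 (y - 1 / real (Suc n)))"
  then obtain n where n: "\<omega> \<in> below0 (y - 1 / real (Suc n))" by blast
  then have w: "\<omega> \<in> space M" by (simp add: below0_def)
  have "all_time_sup Bs N \<rho> \<omega> \<le> ereal (y - 1 / real (Suc n))" using n all_time_sup_le_iff[OF w] by blast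
  also have "\<dots> < ereal y" by simp
  finally show "\<omega> \<in> {\<omega> \<in> space M. all_time_sup Bs N \<rho> \<omega> < ereal y}" using w by simp
qed

lemma local_prob_limit:
  assumes T: "T > 0"
  shows "(\<lambda>n. \<Psi> (x + T - 1 / real (Suc n)) - \<Psi> (x - 1 / real (Suc n)))
    \<longlonglongrightarrow> prob {\<omega> \<in> space M. all_time_sup Bs N \<rho> \<omega> \<in> {ereal x..<ereal (x + T)}}"
proof -
  let ?A = "\<lambda>y. {\<omega> \<in> space M. all_time_sup Bs N \<rho> \<omega> < ereal y}"
  have lim: "(\<lambda>n. \<Psi> (y - 1 / real (Suc n))) \<longlonglongrightarrow> prob (?A y)" for y
    unfolding \<Psi>_def all_time_sup_less
  proof (rule finite_Lim_measure_incseq)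
    show "incseq (\<lambda>n. below0 (y - 1 / real (Suc n)))"
      unfolding incseq_def by (intro allI impI below_mono diff_left_mono divide_left_mono) auto
  qed auto
  have meas: "?A y \<in> sets M" for y unfolding all_time_sup_less by auto
  have "{\<omega> \<in> space M. all_time_sup Bs N \<rho> \<omega> \<in> {ereal x..<ereal (x + T)}} = ?A (x + T) - ?A x" by auto
  moreover have "?A x \<subseteq> ?A (x + T)" using T by (auto elim: less_trans)
  ultimately have "prob {\<omega> \<in> space M. all_time_sup Bs N \<rho> \<omega> \<in> {ereal x..<ereal (x + T)}} = prob (?A (x + T)) - prob (?A x)"
    using meas by (simp add: finite_measure_Diff)
  then show ?thesis using tendsto_diff[OF lim[of "x + T"] lim[of x]] by simp
qed

lemma Phi_increment:
  assumes a: "0 \<le> a" "a \<le> b" and lu: "\<And>y. a \<le> y \<Longrightarrow> y \<le> b \<Longrightarrow> l \<le> f y \<and> f y \<le> u" and l: "0 \<le> l"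
  shows "l * (b - a) \<le> \<Phi> b - \<Phi> a" "\<Phi> b - \<Phi> a \<le> u * (b - a)"
proof -
  let ?I = "\<integral>\<^sup>+w. ennreal (f w) * indicator {a<..b} w \<partial>lborel"
  have u: "0 \<le> u" using lu[of a] a l by auto
  have "(\<integral>\<^sup>+w. ennreal (f w) * indicator {0..b} w \<partial>lborel) = (\<integral>\<^sup>+w. ennreal (f w) * indicator {0..a} w + ennreal (f w) * indicator {a<..b} w \<partial>lborel)"
    using a by (intro nn_integral_cong) (auto simp: indicator_def)
  also have "\<dots> = (\<integral>\<^sup>+w. ennreal (f w) * indicator {0..a} w \<partial>lborel) + ?I"
    by (rule nn_integral_add) measurable
  finally have eq: "ennreal (\<Phi> b) = ennreal (\<Phi> a) + ?I"
    using a Phi_eq[of a] Phi_eq[of b] by (simp add: add.assoc)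
  have c: "(\<integral>\<^sup>+w. ennreal k * indicator {a<..b} w \<partial>lborel) = ennreal (k * (b - a))" if "0 \<le> k" for k
    using a that by (simp add: nn_integral_cmult_indicator ennreal_mult)
  have "?I \<le> (\<integral>\<^sup>+w. ennreal u * indicator {a<..b} w \<partial>lborel)"
    using lu by (intro nn_integral_mono) (auto simp: indicator_def intro!: ennreal_leI)
  then have "ennreal (\<Phi> b) \<le> ennreal (\<Phi> a) + ennreal (u * (b - a))" unfolding eq c[OF u] by (rule add_left_mono)
  then have "\<Phi> b \<le> \<Phi> a + u * (b - a)" using u a Phi_bounds
    by (simp add: ennreal_plus[symmetric] ennreal_le_iff del: ennreal_plus)
  then show "\<Phi> b - \<Phi> a \<le> u * (b - a)" by simp
  have "(\<integral>\<^sup>+w. ennreal l * indicator {a<..b} w \<partial>lborel) \<le> ?I"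
    using lu by (intro nn_integral_mono) (auto simp: indicator_def intro!: ennreal_leI)
  then have "ennreal (\<Phi> a) + ennreal (l * (b - a)) \<le> ennreal (\<Phi> b)" unfolding eq c[OF l] by (rule add_left_mono)
  then have "\<Phi> a + l * (b - a) \<le> \<Phi> b" using l a Phi_bounds
    by (simp add: ennreal_plus[symmetric] ennreal_le_iff del: ennreal_plus)
  then show "l * (b - a) \<le> \<Phi> b - \<Phi> a" by simp
qed

lemma tail_anti: "x \<le> y \<Longrightarrow> tail y \<le> tail x"
  unfolding tail_def by (intro finite_measure_mono) auto

lemma g_anti: "0 \<le> x \<Longrightarrow> x \<le> y \<Longrightarrow> g y \<le> g x"
  using m_pos tail_anti[of x y] by (simp add: g_def divide_right_mono)

lemma g_neg: "x < 0 \<Longrightarrow> g x = 0" by (simp add: g_def)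

lemma excess_measure:
  assumes x: "0 \<le> x" and T: "T > 0"
  shows "T * g (x + T) \<le> measure (excess_distribution M B) {x..<x + T}"
    and "measure (excess_distribution M B) {x..<x + T} \<le> T * g x"
proof -
  have "emeasure (excess_distribution M B) {x..<x + T} = (\<integral>\<^sup>+y. ennreal (g y) * indicator {x..<x + T} y \<partial>lborel)"
    unfolding excess_distribution_def
  proof (subst emeasure_density)
    have "(\<lambda>x. ennreal (indicator {0..} x * (measure M {\<omega> \<in> space M. x < B \<omega>} / integral\<^sup>L M B))) = (\<lambda>x. ennreal (g x))"
      by (auto simp: g_def tail_def m_def indicator_def fun_eq_iff)
    then show "(\<lambda>x. ennreal (indicator {0..} x * (measure M {\<omega> \<in> space M. x < B \<omega>} / integral\<^sup>L M B))) \<in> borel_measurable lborel"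
      by simp
    show "(\<integral>\<^sup>+xa. ennreal (indicator {0..} xa * (measure M {\<omega> \<in> space M. xa < B \<omega>} / integral\<^sup>L M B)) * indicator {x..<x + T} xa \<partial>lborel)
      = (\<integral>\<^sup>+y. ennreal (g y) * indicator {x..<x + T} y \<partial>lborel)"
      by (intro nn_integral_cong) (auto simp: g_def tail_def m_def indicator_def)
  qed simp
  then have eq: "emeasure (excess_distribution M B) {x..<x + T} = \<dots>" .
  have c: "(\<integral>\<^sup>+w. ennreal k * indicator {x..<x + T} w \<partial>lborel) = ennreal (T * k)" if "0 \<le> k" for k
    using T that by (simp add: nn_integral_cmult_indicator ennreal_mult mult.commute)
  have up: "emeasure (excess_distribution M B) {x..<x + T} \<le> ennreal (T * g x)"
    unfolding eq c[OF g_nonneg, symmetric] using x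
    by (intro nn_integral_mono) (auto simp: indicator_def intro!: ennreal_leI g_anti)
  have lo: "ennreal (T * g (x + T)) \<le> emeasure (excess_distribution M B) {x..<x + T}"
    unfolding eq c[OF g_nonneg, symmetric] using x
    by (intro nn_integral_mono) (auto simp: indicator_def intro!: ennreal_leI g_anti)
  have "emeasure (excess_distribution M B) {x..<x + T} = ennreal (measure (excess_distribution M B) {x..<x + T})"
    using up by (intro emeasure_eq_ennreal_measure) (auto simp: top_unique)
  with up lo show "T * g (x + T) \<le> measure (excess_distribution M B) {x..<x + T}"
    and "measure (excess_distribution M B) {x..<x + T} \<le> T * g x"
    using T g_nonneg by (simp_all add: ennreal_le_iff)
qed

text \<open>The increments of \<open>\<Psi> = \<Phi> - f / lam\<close> over intervals of length \<open>T\<close> starting just below \<open>x\<close>. By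
  hypothesis \<open>(1 - \<rho>) * f\<close> is sandwiched between multiples of \<open>g (x + T)\<close> on the whole of
  \<open>[x - 1, x + T]\<close>; the unit of slack leaves room for the left limits that half-open
  intervals require. The constants only collect the relative errors.\<close>

lemma local_estimate:
  assumes T: "T > 0" and x: "x \<ge> 1" and d: "0 < \<delta>" "\<delta> \<le> 1 / 2" and rd: "1 - \<delta> \<le> \<rho>"
    and gpos: "0 < g (x + T)"
    and asym: "\<And>y. x - 1 \<le> y \<Longrightarrow> \<bar>(1 - \<rho>) * f y / g y - 1\<bar> \<le> \<delta>"
    and flat: "g (x - 1) \<le> (1 + \<delta>) * g (x + T)"
    and small: "(8 + 16 * m / T) * \<delta> \<le> \<eta>" "\<eta> \<le> 1"
  shows "local_rel_error M B Bs N T \<rho> x \<le> \<eta>"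
proof -
  define \<epsilon> where "\<epsilon> = 1 - \<rho>"
  have e: "\<epsilon> > 0" using rho by (simp add: \<epsilon>_def)
  define G2 where "G2 = g (x + T)"
  have G2: "G2 > 0" using gpos by (simp add: G2_def)
  define P where "P = prob {\<omega> \<in> space M. all_time_sup Bs N \<rho> \<omega> \<in> {ereal x..<ereal (x + T)}}"
  define J where "J = measure (excess_distribution M B) {x..<x + T}"
  define \<kappa> where "\<kappa> = 8 * m / T"
  have kap: "\<kappa> > 0" using m_pos T by (simp add: \<kappa>_def)
  have fb: "(1 - \<delta>) * G2 / \<epsilon> \<le> f y \<and> f y \<le> (1 + \<delta>) * ((1 + \<delta>) * G2) / \<epsilon>" if y: "x - 1 \<le> y" "y \<le> x + T" for y
  proof -
    have g2: "G2 \<le> g y" using y x by (auto simp: G2_def intro: g_anti)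
    have g1: "g y \<le> (1 + \<delta>) * G2" using flat g_anti[of "x - 1" y] y x by (simp add: G2_def)
    have gy: "g y > 0" using g2 G2 by simp
    have "1 - \<delta> \<le> \<epsilon> * f y / g y" "\<epsilon> * f y / g y \<le> 1 + \<delta>" using asym[OF y(1)] by (auto simp: \<epsilon>_def abs_le_iff)
    then have "(1 - \<delta>) * g y \<le> \<epsilon> * f y" "\<epsilon> * f y \<le> (1 + \<delta>) * g y" using gy by (auto simp: field_simps)
    moreover have "(1 - \<delta>) * G2 \<le> (1 - \<delta>) * g y" using g2 d by (intro mult_left_mono) auto
    moreover have "(1 + \<delta>) * g y \<le> (1 + \<delta>) * ((1 + \<delta>) * G2)" using g1 d by (intro mult_left_mono) auto
    ultimately have "(1 - \<delta>) * G2 \<le> f y * \<epsilon>" "f y * \<epsilon> \<le> (1 + \<delta>) * ((1 + \<delta>) * G2)" by (auto simp: mult.commute)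
    then show ?thesis using e by (simp add: pos_le_divide_eq pos_divide_le_eq)
  qed
  define l u where "l = (1 - \<delta>) * G2 / \<epsilon>" and "u = (1 + \<delta>) * ((1 + \<delta>) * G2) / \<epsilon>"
  have l0: "l \<ge> 0" using d G2 e by (simp add: l_def)
  have inc: "l * T - (u - l) / lam \<le> \<Psi> (a + T) - \<Psi> a \<and> \<Psi> (a + T) - \<Psi> a \<le> u * T + (u - l) / lam"
    if a: "x - 1 \<le> a" "a \<le> x" for a
  proof -
    have a0: "a \<ge> 0" using a x by simp
    have ff: "\<Psi> y = \<Phi> y - f y / lam" if "y \<ge> 0" for y using that lam_pos by (simp add: f_def)
    have P_grid: "l * T \<le> \<Phi> (a + T) - \<Phi> a" "\<Phi> (a + T) - \<Phi> a \<le> u * T"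
      using Phi_increment[of a "a + T" l u] a a0 T l0 fb by (auto simp: l_def u_def)
    have "l \<le> f a" "f a \<le> u" "l \<le> f (a + T)" "f (a + T) \<le> u"
      using fb[of a] fb[of "a + T"] a T by (auto simp: l_def u_def)
    then have "(f (a + T) - f a) / lam \<le> (u - l) / lam" "(f a - f (a + T)) / lam \<le> (u - l) / lam"
      using lam_pos by (auto intro!: divide_right_mono)
    moreover have "\<Psi> (a + T) - \<Psi> a = (\<Phi> (a + T) - \<Phi> a) - (f (a + T) - f a) / lam"
      "\<Psi> (a + T) - \<Psi> a = (\<Phi> (a + T) - \<Phi> a) + (f a - f (a + T)) / lam"
      using a0 T by (auto simp: ff diff_divide_distrib)
    ultimately show ?thesis using P_grid by (smt (verit))
  qed
  have inc': "l * T - (u - l) / lam \<le> \<Psi> (x + T - 1 / real (Suc n)) - \<Psi> (x - 1 / real (Suc n)) \<and>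
     \<Psi> (x + T - 1 / real (Suc n)) - \<Psi> (x - 1 / real (Suc n)) \<le> u * T + (u - l) / lam" for n
    using inc[of "x - 1 / real (Suc n)"] by (simp add: algebra_simps)
  have P1: "l * T - (u - l) / lam \<le> P" "P \<le> u * T + (u - l) / lam"
  proof -
    show "l * T - (u - l) / lam \<le> P"
      unfolding P_def by (rule LIMSEQ_le_const[OF local_prob_limit[OF T]]) (use inc' in blast)
    show "P \<le> u * T + (u - l) / lam"
      unfolding P_def by (rule LIMSEQ_le_const2[OF local_prob_limit[OF T]]) (use inc' in blast)
  qed
  have ul: "(u - l) / lam \<le> \<kappa> * \<delta> * (T * G2 / \<epsilon>)"
  proof -
    have "u - l = ((1 + \<delta>) * (1 + \<delta>) - (1 - \<delta>)) * G2 / \<epsilon>" unfolding u_def l_def diff_divide_distrib[symmetric] by (simp only: left_diff_distrib mult.assoc)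
    also have "\<dots> \<le> (4 * \<delta>) * G2 / \<epsilon>"
    proof (intro divide_right_mono mult_right_mono)
      have "\<delta> * \<delta> \<le> \<delta> * 1" using d by (intro mult_left_mono) auto
      then show "(1 + \<delta>) * (1 + \<delta>) - (1 - \<delta>) \<le> 4 * \<delta>" by (simp add: algebra_simps)
    qed (use G2 e in auto)
    finally have "(u - l) / lam \<le> 4 * \<delta> * G2 / \<epsilon> / lam" using lam_pos by (intro divide_right_mono) auto
    also have "\<dots> = 4 * \<delta> * G2 / \<epsilon> * m * (1 / \<rho>)" by (simp add: lam_def)
    also have "\<dots> \<le> 4 * \<delta> * G2 / \<epsilon> * m * 2"
    proof (rule mult_left_mono)
      show "1 / \<rho> \<le> 2" using d rd rho by (simp add: pos_divide_le_eq)
      show "0 \<le> 4 * \<delta> * G2 / \<epsilon> * m" using d G2 e m_pos by simp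
    qed
    also have "\<dots> = \<kappa> * \<delta> * (T * G2 / \<epsilon>)" using T by (simp add: \<kappa>_def)
    finally show ?thesis .
  qed
  define D where "D = \<rho> / \<epsilon> * J"
  have J: "T * G2 \<le> J" "J \<le> T * ((1 + \<delta>) * G2)"
  proof -
    show "T * G2 \<le> J" using excess_measure(1)[of x T] x T by (simp add: J_def G2_def)
    have "g x \<le> (1 + \<delta>) * G2" using flat g_anti[of "x - 1" x] x by (simp add: G2_def)
    then have "T * g x \<le> T * ((1 + \<delta>) * G2)" using T by (intro mult_left_mono) auto
    moreover have "J \<le> T * g x" using excess_measure(2)[of x T] x T by (simp add: J_def)
    ultimately show "J \<le> T * ((1 + \<delta>) * G2)" by (rule order_trans[rotated])
  qed
  define S where "S = T * G2 / \<epsilon>"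
  have S: "S > 0" using T G2 e by (simp add: S_def)
  have D1: "\<rho> * S \<le> D" "D \<le> (1 + \<delta>) * S"
  proof -
    have "\<rho> / \<epsilon> * (T * G2) \<le> D" unfolding D_def using J rho e by (intro mult_left_mono) auto
    then show "\<rho> * S \<le> D" by (simp add: S_def)
    have "D \<le> 1 / \<epsilon> * (T * ((1 + \<delta>) * G2))" unfolding D_def using J rho e
      by (intro mult_mono divide_right_mono) (auto simp: J_def)
    then show "D \<le> (1 + \<delta>) * S" by (simp add: S_def mult_ac)
  qed
  have Dpos: "D > 0" using D1 S rho by (meson less_le_trans mult_pos_pos)
  have lT: "l * T = (1 - \<delta>) * S" and uT: "u * T = (1 + \<delta>) * (1 + \<delta>) * S" by (auto simp: l_def u_def S_def)
  have C: "(8 + 2 * \<kappa>) * \<delta> \<le> \<eta>" using small by (simp add: \<kappa>_def)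
  have kd: "0 \<le> \<kappa> * \<delta>" using kap d by simp
  have "0 \<le> (8 + 2 * \<kappa>) * \<delta>" using kap d by simp
  then have eta0: "0 \<le> \<eta>" using C by linarith
  have up: "P \<le> (1 + \<eta>) * D"
  proof -
    have "P \<le> ((1 + \<delta>) * (1 + \<delta>) + \<kappa> * \<delta>) * S" using P1(2) ul uT by (simp add: S_def algebra_simps)
    also have "\<dots> \<le> ((1 + \<eta>) * \<rho>) * S"
    proof (rule mult_right_mono)
      have dd: "\<delta> * \<delta> \<le> \<delta> * (1 / 2)" using d by (intro mult_left_mono) auto
      have "(1 + (8 + 2 * \<kappa>) * \<delta>) * (1 - \<delta>) \<le> (1 + \<eta>) * \<rho>" using C rd d rho kap eta0 by (intro mult_mono) auto
      moreover have "(1 + \<delta>) * (1 + \<delta>) + \<kappa> * \<delta> \<le> (1 + (8 + 2 * \<kappa>) * \<delta>) * (1 - \<delta>)"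
      proof -
        have "(8 + 2 * \<kappa>) * (\<delta> * \<delta>) \<le> (8 + 2 * \<kappa>) * (\<delta> * (1 / 2))" using kap by (intro mult_left_mono dd) simp
        moreover have "(8 + 2 * \<kappa>) * (\<delta> * (1 / 2)) = 4 * \<delta> + \<kappa> * \<delta>" by (simp add: algebra_simps)
        moreover have "(1 + (8 + 2 * \<kappa>) * \<delta>) * (1 - \<delta>) = 1 + 7 * \<delta> + 2 * (\<kappa> * \<delta>) - (8 + 2 * \<kappa>) * (\<delta> * \<delta>)"
          by (simp add: algebra_simps)
        moreover have "(1 + \<delta>) * (1 + \<delta>) = 1 + 2 * \<delta> + \<delta> * \<delta>" by (simp add: algebra_simps)
        ultimately show ?thesis using dd d(1) by linarith
      qed
      ultimately show "(1 + \<delta>) * (1 + \<delta>) + \<kappa> * \<delta> \<le> (1 + \<eta>) * \<rho>" by linarith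
    qed (use S in simp)
    also have "\<dots> = (1 + \<eta>) * (\<rho> * S)" by simp
    also have "\<dots> \<le> (1 + \<eta>) * D"
    proof (rule mult_left_mono[OF D1(1)])
      show "0 \<le> 1 + \<eta>" using eta0 by simp
    qed
    finally show ?thesis .
  qed
  have lo: "(1 - \<eta>) * D \<le> P"
  proof -
    have "(1 - \<eta>) * D \<le> (1 - \<eta>) * ((1 + \<delta>) * S)" using D1 small by (intro mult_left_mono) auto
    also have "\<dots> \<le> ((1 - \<delta>) - \<kappa> * \<delta>) * S"
    proof -
      have "(1 - \<eta>) * (1 + \<delta>) \<le> (1 - (8 + 2 * \<kappa>) * \<delta>) * (1 + \<delta>)" using C d by (intro mult_right_mono) auto
      also have "\<dots> \<le> (1 - \<delta>) - \<kappa> * \<delta>"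
      proof -
        have "0 \<le> (8 + 2 * \<kappa>) * (\<delta> * \<delta>)" using kap d by simp
        then show ?thesis using kd d by (simp add: algebra_simps)
      qed
      finally have "(1 - \<eta>) * (1 + \<delta>) * S \<le> ((1 - \<delta>) - \<kappa> * \<delta>) * S" using S by (intro mult_right_mono) auto
      then show ?thesis by (simp only: mult.assoc)
    qed
    also have "\<dots> = l * T - \<kappa> * \<delta> * S" unfolding lT by (simp only: left_diff_distrib)
    also have "\<dots> \<le> P" using P1(1) ul unfolding S_def[symmetric] by linarith
    finally show ?thesis .
  qed
  have "\<bar>P / D - 1\<bar> \<le> \<eta>"
  proof -
    have "P / D \<le> 1 + \<eta>" using up by (subst pos_divide_le_eq[OF Dpos])
    moreover have "1 - \<eta> \<le> P / D" using lo by (subst pos_le_divide_eq[OF Dpos])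
    ultimately show ?thesis by (simp add: abs_le_iff)
  qed
  then show ?thesis unfolding local_rel_error_def P_def D_def J_def \<epsilon>_def .
qed

text \<open>The layer-cake formula; it yields the mass and the mean of \<open>g\<close> from the first two moments of \<open>B\<close>.\<close>

lemma weighted_tail_integral:
  assumes [measurable]: "w \<in> borel_measurable borel"
  shows "(\<integral>\<^sup>+x. w x * ennreal (g x) \<partial>lborel) = ennreal (1 / m) * (\<integral>\<^sup>+b. (\<integral>\<^sup>+x. w x * indicator {0..b} x \<partial>lborel) \<partial>F)"
proof -
  interpret FL: pair_sigma_finite F lborel
    by (simp add: pair_sigma_finite_def prob_space_imp_sigma_finite[OF F_prob] lborel.sigma_finite_measure_axioms)
  let ?h = "\<lambda>b x. w x * (if 0 \<le> x then 1 else 0) * (if b > x then 1 else 0)"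
  have m1: "(\<lambda>(b, x). ?h b x) \<in> borel_measurable (F \<Otimes>\<^sub>M lborel)" by measurable
  note t = tail_integral
  have "(\<integral>\<^sup>+x. w x * ennreal (g x) \<partial>lborel) = (\<integral>\<^sup>+x. ennreal (1 / m) * (\<integral>\<^sup>+b. ?h b x \<partial>F) \<partial>lborel)"
  proof (rule nn_integral_cong)
    fix x
    have "(\<integral>\<^sup>+b. ?h b x \<partial>F) = w x * (if 0 \<le> x then 1 else 0) * ennreal (tail x)"
      unfolding t by (rule nn_integral_cmult) measurable
    moreover have "ennreal (g x) = (if 0 \<le> x then 1 else 0) * (ennreal (1 / m) * ennreal (tail x))"
      using m_pos by (auto simp: g_def ennreal_mult'[symmetric])
    ultimately show "w x * ennreal (g x) = ennreal (1 / m) * (\<integral>\<^sup>+b. ?h b x \<partial>F)" by (simp add: mult_ac)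
  qed
  also have "\<dots> = ennreal (1 / m) * (\<integral>\<^sup>+x. (\<integral>\<^sup>+b. ?h b x \<partial>F) \<partial>lborel)"
  proof (rule nn_integral_cmult)
    have "(\<lambda>(x, b). ?h b x) \<in> borel_measurable (lborel \<Otimes>\<^sub>M F)" by measurable
    then show "(\<lambda>x. \<integral>\<^sup>+b. ?h b x \<partial>F) \<in> borel_measurable lborel"
      using sigma_finite_measure.borel_measurable_nn_integral[OF prob_space_imp_sigma_finite[OF F_prob]] by blast
  qed
  also have "(\<integral>\<^sup>+x. (\<integral>\<^sup>+b. ?h b x \<partial>F) \<partial>lborel) = (\<integral>\<^sup>+b. (\<integral>\<^sup>+x. ?h b x \<partial>lborel) \<partial>F)" by (rule FL.Fubini'[OF m1])
  also have "\<dots> = (\<integral>\<^sup>+b. (\<integral>\<^sup>+x. w x * indicator {0..b} x \<partial>lborel) \<partial>F)"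
  proof (rule nn_integral_cong)
    fix b
    show "(\<integral>\<^sup>+x. ?h b x \<partial>lborel) = (\<integral>\<^sup>+x. w x * indicator {0..b} x \<partial>lborel)"
      using AE_lborel_singleton[of b] by (intro nn_integral_cong_AE) (auto elim!: eventually_mono simp: indicator_def)
  qed
  finally show ?thesis .
qed

lemma g_mass: "(\<integral>\<^sup>+x. ennreal (g x) \<partial>lborel) = 1"
proof -
  have "(\<integral>\<^sup>+x. ennreal (g x) \<partial>lborel) = ennreal (1 / m) * (\<integral>\<^sup>+b. (\<integral>\<^sup>+x. 1 * indicator {0..b} x \<partial>lborel) \<partial>F)"
    using weighted_tail_integral[of "\<lambda>_. 1"] by simp
  also have "(\<integral>\<^sup>+b. (\<integral>\<^sup>+x. 1 * indicator {0..b} x \<partial>lborel) \<partial>F) = (\<integral>\<^sup>+b. ennreal b \<partial>F)"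
    using F_pos by (intro nn_integral_cong_AE) (auto elim!: eventually_mono)
  finally show ?thesis using m_pos by (simp add: F_mean ennreal_mult[symmetric])
qed

lemma g_mean:
  assumes B2: "integrable M (\<lambda>\<omega>. (B \<omega>)\<^sup>2)"
  shows "(\<integral>\<^sup>+x. ennreal (x * g x) \<partial>lborel) = ennreal ((\<integral>\<omega>. (B \<omega>)\<^sup>2 \<partial>M) / (2 * m))"
proof -
  have "(\<integral>\<^sup>+x. ennreal (x * g x) \<partial>lborel) = (\<integral>\<^sup>+x. ennreal x * ennreal (g x) \<partial>lborel)"
    using g_nonneg by (intro nn_integral_cong) (auto simp: ennreal_mult'' )
  also have "\<dots> = ennreal (1 / m) * (\<integral>\<^sup>+b. (\<integral>\<^sup>+x. ennreal x * indicator {0..b} x \<partial>lborel) \<partial>F)"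
    by (rule weighted_tail_integral) measurable
  also have "(\<integral>\<^sup>+b. (\<integral>\<^sup>+x. ennreal x * indicator {0..b} x \<partial>lborel) \<partial>F) = (\<integral>\<^sup>+b. ennreal (b\<^sup>2 / 2) \<partial>F)"
  proof (rule nn_integral_cong_AE)
    show "AE b in F. (\<integral>\<^sup>+x. ennreal x * indicator {0..b} x \<partial>lborel) = ennreal (b\<^sup>2 / 2)"
      using F_pos
    proof eventually_elim
      case (elim b)
      have "(\<integral>\<^sup>+x. ennreal x * indicator {0..b} x \<partial>lborel) = ennreal (b\<^sup>2 / 2 - 0\<^sup>2 / 2)"
        using elim by (intro nn_integral_FTC_Icc[where F = "\<lambda>x. x\<^sup>2 / 2"]) (auto intro!: derivative_eq_intros)
      then show ?case by simp
    qed
  qed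
  also have "\<dots> = (\<integral>\<^sup>+\<omega>. ennreal ((B \<omega>)\<^sup>2 / 2) \<partial>M)"
    unfolding F_def by (subst nn_integral_distr) auto
  also have "\<dots> = ennreal (\<integral>\<omega>. (B \<omega>)\<^sup>2 / 2 \<partial>M)"
    using B2 by (intro nn_integral_eq_integral) auto
  finally show ?thesis using m_pos by (simp add: ennreal_mult'[symmetric])
qed

lemma rv_density_g:
  assumes B2: "integrable M (\<lambda>\<omega>. (B \<omega>)\<^sup>2)" and a: "\<alpha> > 2" and L: "slowly_varying L"
    and tl: "\<And>x. x > 0 \<Longrightarrow> measure M {\<omega> \<in> space M. B \<omega> > x} = L x * x powr (- \<alpha>)"
  shows "rv_density g \<alpha> ((\<integral>\<omega>. (B \<omega>)\<^sup>2 \<partial>M) / (2 * m))"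
proof
  show "(\<integral>\<omega>. (B \<omega>)\<^sup>2 \<partial>M) / (2 * m) > 0"
  proof -
    have "0 \<le> variance B" by (rule variance_positive)
    also have "variance B = (\<integral>\<omega>. (B \<omega>)\<^sup>2 \<partial>M) - m\<^sup>2" using variance_eq[OF B_int B2] by (simp add: m_def)
    finally show ?thesis using m_pos by (auto intro!: divide_pos_pos elim: less_le_trans[rotated])
  qed
  fix c :: real assume c: "c > 0"
  have "((\<lambda>x. L (c * x) / L x * c powr (- \<alpha>)) \<longlongrightarrow> 1 * c powr (- \<alpha>)) at_top"
    using L c unfolding slowly_varying_def by (intro tendsto_intros) auto
  moreover have "eventually (\<lambda>x. L (c * x) / L x * c powr (- \<alpha>) = g (c * x) / g x) at_top"
    using eventually_gt_at_top[of 0]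
  proof eventually_elim
    case (elim x)
    then have "c * x > 0" using c by simp
    then have neg: "(c * x < 0) = False" "(x < 0) = False" using elim by auto
    show ?case unfolding g_def neg if_False
      using elim c m_pos tl[of x] tl[OF \<open>c * x > 0\<close>] by (simp add: tail_def powr_mult)
  qed
  ultimately show "((\<lambda>x. g (c * x) / g x) \<longlongrightarrow> c powr (- \<alpha>)) at_top"
    by (auto intro: Lim_transform_eventually)
qed (use a in \<open>auto simp: g_nonneg g_neg g_mass g_mean[OF B2] intro: g_anti\<close>)

lemma workload_density_f:
  assumes "rv_density g \<alpha> \<mu>"
  shows "rv_density.workload_density g (1 - \<rho>) f"
proof -
  interpret rv_density g \<alpha> \<mu> by fact
  show ?thesis
    unfolding workload_density_def
    using f_renewal atom_and_mass[OF local.g_mass] f_nonneg f_neg f_le f_meas by auto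
qed

end

text \<open>The rate \<open>\<kappa> = \<mu> (\<alpha> - 3 / 2)\<close> lies strictly between \<open>\<mu> (\<alpha> - 2)\<close>, which \<open>density_asymptotics\<close> needs, and
  \<open>\<mu> (\<alpha> - 1)\<close>, the rate of the threshold; the gap absorbs the unit of slack in \<open>local_estimate\<close>.\<close>

lemma (in rv_density) error_eventually_small:
  fixes M :: "'a measure"
  assumes q: "\<And>\<rho>. 0 < \<rho> \<Longrightarrow> \<rho> < 1 \<Longrightarrow> queue M B Bs N \<rho>" and g_eq: "g = queue.g M B"
    and T: "T > 0" and \<eta>: "0 < \<eta>" "\<eta> \<le> 1"
  shows "eventually (\<lambda>\<rho>. \<forall>x\<ge>x_threshold 1 \<mu> \<alpha> \<rho>. local_rel_error M B Bs N T \<rho> x \<le> \<eta>) (at_left 1)"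
proof -
  define m where "m = integral\<^sup>L M B"
  have "queue M B Bs N (1 / 2)" by (rule q) auto
  then have m: "m > 0" by (simp add: queue_def queue_axioms_def m_def)
  define C where "C = 8 + 16 * m / T"
  have C: "C \<ge> 8" using m T by (simp add: C_def)
  define \<delta> where "\<delta> = \<eta> / C"
  have d: "0 < \<delta>" "\<delta> \<le> 1 / 2" "C * \<delta> \<le> \<eta>" using C \<eta> by (auto simp: \<delta>_def field_simps)
  define \<kappa> where "\<kappa> = \<mu> * (\<alpha> - 3 / 2)"
  have kap: "\<kappa> > \<mu> * (\<alpha> - 2)" using mu_pos by (simp add: \<kappa>_def)
  obtain e0 where e0: "e0 > 0" and asym: "\<And>\<epsilon> f x. 0 < \<epsilon> \<Longrightarrow> \<epsilon> < e0 \<Longrightarrow> \<epsilon> < 1 \<Longrightarrow> workload_density \<epsilon> f \<Longrightarrow>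
     x \<ge> \<kappa> / \<epsilon> * ln (1 / \<epsilon>) \<Longrightarrow> \<bar>\<epsilon> * f x / g x - 1\<bar> \<le> \<delta>"
    using density_asymptotics[OF kap d(1)] by blast
  obtain y0 where y0: "y0 \<ge> 0" "\<And>y. y \<ge> y0 \<Longrightarrow> g y \<le> (1 + \<delta>) * g (y + (T + 1))"
    using long_tail[OF d(1), of "T + 1"] by blast
  define e1 where "e1 = Min {e0, 1 / 2, \<delta>, exp (- 1), \<mu> / 2, \<mu> * (\<alpha> - 1) / (y0 + 1)}"
  have e1: "e1 > 0" "e1 \<le> e0" "e1 \<le> 1 / 2" "e1 \<le> \<delta>" "e1 \<le> exp (- 1)" "e1 \<le> \<mu> / 2" "e1 \<le> \<mu> * (\<alpha> - 1) / (y0 + 1)"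
  proof -
    show "e1 > 0" using e0 d mu_pos alpha_gt y0 by (auto simp: e1_def)
    show "e1 \<le> e0" "e1 \<le> 1 / 2" "e1 \<le> \<delta>" "e1 \<le> exp (- 1)" "e1 \<le> \<mu> / 2" "e1 \<le> \<mu> * (\<alpha> - 1) / (y0 + 1)"
      unfolding e1_def by (rule Min_le, simp only: finite.intros finite_insert, blast)+
  qed
  have main: "local_rel_error M B Bs N T \<rho> x \<le> \<eta>"
    if r: "1 - e1 < \<rho>" "\<rho> < 1" and x: "x \<ge> x_threshold 1 \<mu> \<alpha> \<rho>" for \<rho> x
  proof -
    define \<epsilon> where "\<epsilon> = 1 - \<rho>"
    have e: "0 < \<epsilon>" "\<epsilon> < e1" "\<epsilon> < 1" using r e1 by (auto simp: \<epsilon>_def)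
    have rp: "\<rho> > 0" using r e1 by simp
    interpret Q: queue M B Bs N \<rho> by (rule q[OF rp r(2)])
    define l where "l = ln (1 / \<epsilon>)"
    have "ln \<epsilon> \<le> ln (exp (- 1))" using e e1 by (subst ln_le_cancel_iff) auto
    then have l: "l \<ge> 1" using e by (simp add: l_def ln_div)
    have xt: "x \<ge> \<mu> * (\<alpha> - 1) / \<epsilon> * l" using x by (simp add: x_threshold_def \<epsilon>_def l_def)
    have "\<mu> * (\<alpha> - 1) / \<epsilon> * 1 \<le> \<mu> * (\<alpha> - 1) / \<epsilon> * l"
      using l mu_pos alpha_gt e by (intro mult_left_mono) auto
    moreover have "y0 + 1 \<le> \<mu> * (\<alpha> - 1) / \<epsilon>"
    proof -
      have "\<epsilon> \<le> \<mu> * (\<alpha> - 1) / (y0 + 1)" using e e1 by simp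
      then show ?thesis using e y0 by (simp add: field_simps)
    qed
    ultimately have xy: "x \<ge> y0 + 1" using xt by linarith
    have x1: "x - 1 \<ge> \<kappa> / \<epsilon> * l"
    proof -
      have "1 \<le> \<mu> / 2 / \<epsilon> * 1" using e e1 by (simp add: field_simps)
      also have "\<dots> \<le> \<mu> / 2 / \<epsilon> * l" using l mu_pos e by (intro mult_left_mono) auto
      finally have "1 \<le> \<mu> / 2 / \<epsilon> * l" .
      moreover have "\<mu> * (\<alpha> - 1) / \<epsilon> * l = \<kappa> / \<epsilon> * l + \<mu> / 2 / \<epsilon> * l"
        by (simp add: \<kappa>_def algebra_simps add_divide_distrib diff_divide_distrib)
      ultimately show ?thesis using xt by linarith
    qed
    have wd: "workload_density \<epsilon> Q.f"
      using Q.workload_density_f[of \<alpha> \<mu>] rv_density_axioms unfolding g_eq[symmetric] \<epsilon>_def by simp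
    show ?thesis
    proof (rule Q.local_estimate[OF T _ d(1,2)])
      show "x \<ge> 1" using xy y0 by simp
      show "1 - \<delta> \<le> \<rho>" using r e1 by simp
      show "0 < Q.g (x + T)" using g_pos[of "x + T"] xy y0 T by (simp add: g_eq)
      show "\<bar>(1 - \<rho>) * Q.f y / Q.g y - 1\<bar> \<le> \<delta>" if "x - 1 \<le> y" for y
        using asym[OF e(1) _ e(3) wd, of y] that x1 e e1 unfolding g_eq[symmetric] by (simp add: \<epsilon>_def l_def)
      show "Q.g (x - 1) \<le> (1 + \<delta>) * Q.g (x + T)" using y0(2)[of "x - 1"] xy unfolding g_eq[symmetric] by (simp add: algebra_simps)
      show "(8 + 16 * Q.m / T) * \<delta> \<le> \<eta>" using d(3) by (simp add: C_def m_def Q.m_def)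
    qed (rule \<eta>)
  qed
  show ?thesis unfolding eventually_at_left_field
    by (rule exI[of _ "1 - e1"]) (use e1 main in auto)
qed

lemma SUP_ereal_tendsto_0:
  fixes e :: "real \<Rightarrow> real \<Rightarrow> real"
  assumes nn: "\<And>\<rho> x. 0 \<le> e \<rho> x"
    and small: "\<And>\<eta>. 0 < \<eta> \<Longrightarrow> \<eta> \<le> 1 \<Longrightarrow> eventually (\<lambda>\<rho>. \<forall>x\<ge>t \<rho>. e \<rho> x \<le> \<eta>) F"
  shows "((\<lambda>\<rho>. SUP x\<in>{t \<rho>..}. ereal (e \<rho> x)) \<longlongrightarrow> 0) F"
proof (rule order_tendstoI)
  fix a :: ereal assume "a < 0"
  have "a < (SUP x\<in>{t \<rho>..}. ereal (e \<rho> x))" for \<rho>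
  proof -
    have "0 \<le> ereal (e \<rho> (t \<rho>))" using nn by simp
    also have "\<dots> \<le> (SUP x\<in>{t \<rho>..}. ereal (e \<rho> x))" by (intro SUP_upper) simp
    finally show ?thesis using \<open>a < 0\<close> by simp
  qed
  then show "eventually (\<lambda>\<rho>. a < (SUP x\<in>{t \<rho>..}. ereal (e \<rho> x))) F" by simp
next
  fix a :: ereal assume "0 < a"
  then obtain z where z: "0 < ereal z" "ereal z < a" using ereal_dense2 by blast
  define \<eta> where "\<eta> = min z 1"
  have eta: "0 < \<eta>" "\<eta> \<le> 1" "ereal \<eta> < a" using z by (auto simp: \<eta>_def intro: le_less_trans[of _ "ereal z"])
  from small[OF eta(1,2)] show "eventually (\<lambda>\<rho>. (SUP x\<in>{t \<rho>..}. ereal (e \<rho> x)) < a) F"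
  proof eventually_elim
    case (elim \<rho>)
    have "(SUP x\<in>{t \<rho>..}. ereal (e \<rho> x)) \<le> ereal \<eta>" using elim by (intro SUP_least) auto
    then show ?case using eta by simp
  qed
qed

theorem theorem3p1:
  fixes M :: "'a measure"
    and B :: "'a \<Rightarrow> real"
    and Bs :: "nat \<Rightarrow> 'a \<Rightarrow> real"
    and N :: "real \<Rightarrow> 'a \<Rightarrow> nat"
    and L :: "real \<Rightarrow> real"
    and \<alpha> \<mu> :: real
  assumes prob_space: "prob_space M"
    and B_rv: "B \<in> borel_measurable M"
    and B_pos: "measure M {\<omega> \<in> space M. B \<omega> \<le> 0} = 0"
    and B_mean: "integral\<^sup>L M B > 0"
    and B_var: "integrable M (\<lambda>\<omega>. (B \<omega>)\<^sup>2)"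
    and Bs_indep: "prob_space.indep_vars M (\<lambda>_. borel) Bs UNIV"
    and Bs_distr: "\<And>i. distr M borel (Bs i) = distr M borel B"
    and N_poisson: "poisson_process M (1 / integral\<^sup>L M B) N"
    and N_Bs_indep: "prob_space.indep_set M
          (sets (vimage_algebra (space M) (\<lambda>\<omega>. \<lambda>t\<in>{0..}. N t \<omega>)
             (Pi\<^sub>M {0..} (\<lambda>_. count_space UNIV))))
          (sets (vimage_algebra (space M) (\<lambda>\<omega> i. Bs i \<omega>) (Pi\<^sub>M UNIV (\<lambda>_. borel))))"
    and \<alpha>: "\<alpha> > 2" "\<alpha> \<noteq> 3"
    and L: "slowly_varying L"
    and tail: "\<And>x. x > 0 \<Longrightarrow> measure M {\<omega> \<in> space M. B \<omega> > x} = L x * x powr (- \<alpha>)"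
    and \<mu>: "\<mu> = (\<integral>\<omega>. (B \<omega>)\<^sup>2 \<partial>M) / (2 * integral\<^sup>L M B)"
  shows "(\<forall>k>1. \<forall>T>0.
            ((\<lambda>\<rho>. SUP x\<in>{x_threshold k \<mu> \<alpha> \<rho>..}. ereal (local_rel_error M B Bs N T \<rho> x))
              \<longlongrightarrow> 0) (at_left 1)) \<and>
         (filterlim (\<lambda>x. L x / (ln x) powr \<alpha>) at_top at_top \<longrightarrow>
           (\<forall>T>0.
             ((\<lambda>\<rho>. SUP x\<in>{x_threshold 1 \<mu> \<alpha> \<rho>..}. ereal (local_rel_error M B Bs N T \<rho> x))
               \<longlongrightarrow> 0) (at_left 1)))"
proof -
  interpret prob_space M by (rule prob_space)
  have B_int: "integrable M B"
    using B_rv B_var by (rule square_integrable_imp_integrable)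
  have q: "queue M B Bs N \<rho>" if "0 < \<rho>" "\<rho> < 1" for \<rho>
    using that B_rv B_pos B_mean B_int Bs_indep Bs_distr N_poisson N_Bs_indep
    by (intro queue.intro prob_space_axioms queue_axioms.intro) auto
  interpret H: queue M B Bs N "1 / 2" by (rule q) auto
  interpret rv_density H.g \<alpha> \<mu>
    unfolding \<mu> using H.rv_density_g[OF B_var \<alpha>(1) L tail] by (simp add: H.m_def)
  have nn: "0 \<le> local_rel_error M B Bs N T \<rho> x" for T \<rho> x by (simp add: local_rel_error_def)
  have lim: "((\<lambda>\<rho>. SUP x\<in>{x_threshold k \<mu> \<alpha> \<rho>..}. ereal (local_rel_error M B Bs N T \<rho> x)) \<longlongrightarrow> 0) (at_left 1)"
    if k: "k \<ge> 1" and T: "T > 0" for k T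
  proof (rule SUP_ereal_tendsto_0[OF nn])
    fix \<eta> :: real assume eta: "0 < \<eta>" "\<eta> \<le> 1"
    have "eventually (\<lambda>\<rho>::real. 0 < \<rho> \<and> \<rho> < 1) (at_left 1)"
      unfolding eventually_at_left_field by (intro exI[of _ 0]) auto
    moreover have "eventually (\<lambda>\<rho>. \<forall>x\<ge>x_threshold 1 \<mu> \<alpha> \<rho>. local_rel_error M B Bs N T \<rho> x \<le> \<eta>) (at_left 1)"
      by (rule error_eventually_small[OF _ refl T eta]) (rule q)
    ultimately show "eventually (\<lambda>\<rho>. \<forall>x\<ge>x_threshold k \<mu> \<alpha> \<rho>. local_rel_error M B Bs N T \<rho> x \<le> \<eta>) (at_left 1)"
    proof eventually_elim
      case (elim \<rho>)
      have "0 \<le> \<mu> * (\<alpha> - 1) * (1 / (1 - \<rho>)) * ln (1 / (1 - \<rho>))"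
        using elim mu_pos alpha_gt by (intro mult_nonneg_nonneg ln_ge_zero) auto
      then have "1 * (\<mu> * (\<alpha> - 1) * (1 / (1 - \<rho>)) * ln (1 / (1 - \<rho>))) \<le> k * (\<mu> * (\<alpha> - 1) * (1 / (1 - \<rho>)) * ln (1 / (1 - \<rho>)))"
        using k by (rule mult_right_mono[rotated])
      then have "x_threshold 1 \<mu> \<alpha> \<rho> \<le> x_threshold k \<mu> \<alpha> \<rho>" by (simp add: x_threshold_def mult.assoc)
      then show ?case using elim by (meson order_trans)
    qed
  qed
  then show ?thesis by simp
qed

end
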